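(* Assume that there are real constants $\sigma^2>0$ and $\rho$ with $|\rho|<\sigma^2$ such that, for all $n\ge p-1$: (i) for every $k\in\mathbb{G}_{n+1}$, $\varepsilon_k\in L^2$, $\mathbb{E}[\varepsilon_k\mid\mathcal{F}_n]=0$ and $\mathbb{E}[\varepsilon_k^2\mid\mathcal{F}_n]=\sigma^2$ a.s.; (ii) for all different $k,l\in\mathbb{G}_{n+1}$, if $[k/2]=[l/2]$ then $\mathbb{E}[\varepsilon_k\varepsilon_l\mid\mathcal{F}_n]=\rho$ a.s., and otherwise $\varepsilon_k$ and $\varepsilon_l$ are conditionally independent given $\mathcal{F}_n$. Assume also that (iii) $\varepsilon_k\in L^4$ for all $k\in\mathbb{G}_{n+1}$, $n\ge p-1$, and $\sup_{n\ge p-1}\sup_{k\in\mathbb{G}_{n+1}}\mathbb{E}[\varepsilon_k^4\mid\mathcal{F}_n]<\infty$ a.s. Then $\widehat\theta_n$ converges almost surely to $\theta$ with the rate of convergence $$\|\widehat\theta_n-\theta\|^2=\mathcal{O}\left(\frac{\log|\mathbb{T}_{n-1}|}{|\mathbb{T}_{n-1}|}\right)\quad\text{a.s.}$$ In addition, one has the quadratic strong law $$\lim_{n\to\infty}\frac1n\sum_{k=p}^n|\mathbb{T}_{k-1}|(\widehat\theta_k-\theta)^t\Lambda(\widehat\theta_k-\theta)=2(p+1)\sigma^2\quad\text{a.s.},$$ where $\Lambda=I_2\otimes L$.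
   Context: Fix an integer $p\ge1$. For $n\ge0$ let $\mathbb{G}_n=\{2^n,\dots,2^{n+1}-1\}$, $\mathbb{T}_n=\bigcup_{k=0}^n\mathbb{G}_k$, and for an integer $q\geq 0$ let $\mathbb{T}_{n,q}=\{k\in\mathbb{T}_n:k\ge2^q\}$; $|E|$ denotes cardinality, so $|\mathbb{G}_n|=2^n$, $|\mathbb{T}_n|=2^{n+1}-1$. $[x]$ is the integer part of $x$. The asymmetric BAR($p$) process consists of real random variables $(X_n)_{n\ge1}$ and $(\varepsilon_n)_{n\ge2^p}$ such that for all $n\ge2^{p-1}$ $$X_{2n}=a_0+\sum_{k=1}^pa_kX_{[n/2^{k-1}]}+\varepsilon_{2n},\qquad X_{2n+1}=b_0+\sum_{k=1}^pb_kX_{[n/2^{k-1}]}+\varepsilon_{2n+1},$$ with real parameters $a_0,\dots,a_p,b_0,\dots,b_p$. The initial states satisfy $\mathbb{E}[X_k^8]<\infty$ for $1\le k\le2^p-1$. For $n\ge2^{p-1}$, $\mathbb{X}_n=(X_n,X_{[n/2]},\dots,X_{[n/2^{p-1}]})^t\in\mathbb{R}^p$. $A$ (resp. $B$) is the $p\times p$ companion matrix with first row $(a_1,\dots,a_p)$ (resp. $(b_1,\dots,b_p)$), ones on the subdiagonal and zeros elsewhere. It is assumed that $\beta=\max\{\|A\|,\|B\|\}<1$, where $\|A\|=\sup\{\|Au\|:u\in\mathbb{R}^p,\|u\|=1\}$ is the operator norm induced by a norm on $\mathbb{R}^p$. $\mathcal{F}_n=\sigma\{X_k:k\in\mathbb{T}_n\}$.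 $Y_n=(1,\mathbb{X}_n^t)^t\in\mathbb{R}^{p+1}$, $Z_n=(X_{2n},X_{2n+1})^t$ and, for $n\ge p-1$, $S_n=\sum_{k\in\mathbb{T}_{n,p-1}}Y_kY_k^t$, with the convention that when $S_n$ is not invertible it is replaced by $S_n+I_{p+1}$. The parameter is $\theta=(a_0,\dots,a_p,b_0,\dots,b_p)^t\in\mathbb{R}^{2(p+1)}$ and the least squares estimator is, for $n\ge p$, $\widehat\theta_n=\mathrm{vec}\big(S_{n-1}^{-1}\sum_{k\in\mathbb{T}_{n-1,p-1}}Y_kZ_k^t\big)\in\mathbb{R}^{2(p+1)}$ (vec stacks columns). $\otimes$ is the Kronecker product and $\|\cdot\|$ in the claim is the Euclidean norm. $L=\begin{pmatrix}1&\lambda^t\\ \lambda&\ell\end{pmatrix}$, where, with $e_1=(1,0,\dots,0)^t\in\mathbb{R}^p$, $\overline a=(a_0+b_0)/2$, $\overline{a^2}=(a_0^2+b_0^2)/2$, $\overline A=(A+B)/2$, one sets $\lambda=\overline a(I_p-\overline A)^{-1}e_1$ and $\ell$ is the unique solution of $\ell=T+\frac12(A\ell A^t+B\ell B^t)$ with $$T=(\sigma^2+\overline{a^2})e_1e_1^t+\tfrac12\big(a_0(A\lambda e_1^t+e_1\lambda^tA^t)+b_0(B\lambda e_1^t+e_1\lambda^tB^t)\big).$$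
   Formalization: In (ii), conditional independence of non-sisters is taken jointly: given F_n, the sister pairs (ε_{2i}, ε_{2i+1}), i in G_n, form an independent family. With independence only for two variables at a time, the quadratic strong law can fail. *)

theory Defs
  imports
    "HOL-Probability.Probability"
    "HOL-Library.Landau_Symbols"
    "Jordan_Normal_Form.Matrix"
    "Jordan_Normal_Form.Gauss_Jordan_Elimination"
begin

section \<open>The binary tree\<close>

definition generation :: "nat \<Rightarrow> nat set" where
  "generation n = {2 ^ n .. 2 ^ (n + 1) - 1}"

definition tree :: "nat \<Rightarrow> nat set" where
  "tree n = (\<Union>k\<le>n. generation k)"

definition tree_from :: "nat \<Rightarrow> nat \<Rightarrow> nat set" where
  "tree_from n q = {k \<in> tree n. 2 ^ q \<le> k}"

section \<open>Vectors and matrices\<close>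

text \<open>
  The order p of the process occurs in index arithmetic on the tree, so vectors and matrices
  have their dimensions as explicit natural numbers. Rows and columns are counted from 0.
\<close>

definition outer_prod :: "real vec \<Rightarrow> real vec \<Rightarrow> real mat" where
  "outer_prod u v = Matrix.mat (dim_vec u) (dim_vec v) (\<lambda>(i, j). vec_index u i * vec_index v j)"

definition kronecker_prod :: "real mat \<Rightarrow> real mat \<Rightarrow> real mat" where
  "kronecker_prod P Q = Matrix.mat (dim_row P * dim_row Q) (dim_col P * dim_col Q)
     (\<lambda>(i, j). P $$ (i div dim_row Q, j div dim_col Q) * Q $$ (i mod dim_row Q, j mod dim_col Q))"

text \<open>Stacking of the columns of a matrix into a vector.\<close>
definition vec_stack :: "real mat \<Rightarrow> real vec" where
  "vec_stack P = Matrix.vec (dim_row P * dim_col P) (\<lambda>i. P $$ (i mod dim_row P, i div dim_row P))"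

text \<open>Only meaningful for invertible matrices.\<close>
definition inv_mat :: "real mat \<Rightarrow> real mat" where
  "inv_mat P = the (mat_inverse P)"

definition euclidean_norm :: "real vec \<Rightarrow> real" where
  "euclidean_norm v = sqrt (scalar_prod v v)"

definition is_norm :: "nat \<Rightarrow> (real vec \<Rightarrow> real) \<Rightarrow> bool" where
  "is_norm p N \<longleftrightarrow>
     (\<forall>u \<in> carrier_vec p. 0 \<le> N u \<and> (N u = 0 \<longleftrightarrow> u = 0\<^sub>v p)) \<and>
     (\<forall>c. \<forall>u \<in> carrier_vec p. N (c \<cdot>\<^sub>v u) = \<bar>c\<bar> * N u) \<and>
     (\<forall>u \<in> carrier_vec p. \<forall>v \<in> carrier_vec p. N (u + v) \<le> N u + N v)"

definition operator_norm :: "nat \<Rightarrow> (real vec \<Rightarrow> real) \<Rightarrow> real mat \<Rightarrow> real" where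
  "operator_norm p N P = Sup {N (P *\<^sub>v u) | u. u \<in> carrier_vec p \<and> N u = 1}"

section \<open>Conditioning\<close>

definition natural_filtration :: "'a measure \<Rightarrow> (nat \<Rightarrow> 'a \<Rightarrow> real) \<Rightarrow> nat \<Rightarrow> 'a measure" where
  "natural_filtration M X n =
     sigma (space M) {X k -` S \<inter> space M | k S. k \<in> tree n \<and> S \<in> sets borel}"

text \<open>
  Conditional independence given F of a finite family of random variables. Subfamilies are
  covered by taking S i to be the whole space.
\<close>
definition cond_indep_vars ::
  "'a measure \<Rightarrow> 'a measure \<Rightarrow> 'b measure \<Rightarrow> ('i \<Rightarrow> 'a \<Rightarrow> 'b) \<Rightarrow> 'i set \<Rightarrow> bool" where
  "cond_indep_vars M F M' U I \<longleftrightarrow>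
     (\<forall>S. (\<forall>i\<in>I. S i \<in> sets M') \<longrightarrow>
        (AE \<omega> in M.
           real_cond_exp M F (\<lambda>\<omega>. \<Prod>i\<in>I. indicator (S i) (U i \<omega>)) \<omega> =
           (\<Prod>i\<in>I. real_cond_exp M F (\<lambda>\<omega>. indicator (S i) (U i \<omega>)) \<omega>)))"

text \<open>
  The cells 2i and 2i + 1 are the two daughters of i. Noise variables of non-sisters of one
  generation are conditionally independent in the joint sense: the sister pairs form a
  conditionally independent family. Independence of any two non-sisters alone would not suffice
  for the asymptotics. For example let p = 1, let all parameters and X 1 be 0, and let the noise
  variables of the N even (likewise, independently, of the N odd) cells of a generation be
  exchangeable signs whose sum is 0 with probability 1 - 1/N and N or -N with probability 1/(2N)
  each, independently over the generations. These are pairwise independent, but almost surely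
  all but finitely many of these sums vanish, and the limit in the quadratic strong law is 2
  instead of 4.
\<close>
definition sister_noise :: "(nat \<Rightarrow> 'a \<Rightarrow> real) \<Rightarrow> nat \<Rightarrow> 'a \<Rightarrow> real \<times> real" where
  "sister_noise eps i \<omega> = (eps (2 * i) \<omega>, eps (2 * i + 1) \<omega>)"

section \<open>The process and the least squares estimator\<close>

definition state_vec :: "nat \<Rightarrow> (nat \<Rightarrow> 'a \<Rightarrow> real) \<Rightarrow> nat \<Rightarrow> 'a \<Rightarrow> real vec" where
  "state_vec p X n \<omega> = Matrix.vec p (\<lambda>i. X (n div 2 ^ i) \<omega>)"

definition Y_vec :: "nat \<Rightarrow> (nat \<Rightarrow> 'a \<Rightarrow> real) \<Rightarrow> nat \<Rightarrow> 'a \<Rightarrow> real vec" where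
  "Y_vec p X n \<omega> = vCons 1 (state_vec p X n \<omega>)"

definition Z_vec :: "(nat \<Rightarrow> 'a \<Rightarrow> real) \<Rightarrow> nat \<Rightarrow> 'a \<Rightarrow> real vec" where
  "Z_vec X n \<omega> = vec_of_list [X (2 * n) \<omega>, X (2 * n + 1) \<omega>]"

definition S_sum :: "nat \<Rightarrow> (nat \<Rightarrow> 'a \<Rightarrow> real) \<Rightarrow> nat \<Rightarrow> 'a \<Rightarrow> real mat" where
  "S_sum p X n \<omega> = Matrix.mat (p + 1) (p + 1)
     (\<lambda>ij. \<Sum>k \<in> tree_from n (p - 1). outer_prod (Y_vec p X k \<omega>) (Y_vec p X k \<omega>) $$ ij)"

definition S_mat :: "nat \<Rightarrow> (nat \<Rightarrow> 'a \<Rightarrow> real) \<Rightarrow> nat \<Rightarrow> 'a \<Rightarrow> real mat" where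
  "S_mat p X n \<omega> =
     (if invertible_mat (S_sum p X n \<omega>) then S_sum p X n \<omega>
      else S_sum p X n \<omega> + 1\<^sub>m (p + 1))"

definition YZ_sum :: "nat \<Rightarrow> (nat \<Rightarrow> 'a \<Rightarrow> real) \<Rightarrow> nat \<Rightarrow> 'a \<Rightarrow> real mat" where
  "YZ_sum p X n \<omega> = Matrix.mat (p + 1) 2
     (\<lambda>ij. \<Sum>k \<in> tree_from n (p - 1). outer_prod (Y_vec p X k \<omega>) (Z_vec X k \<omega>) $$ ij)"

definition theta_hat :: "nat \<Rightarrow> (nat \<Rightarrow> 'a \<Rightarrow> real) \<Rightarrow> nat \<Rightarrow> 'a \<Rightarrow> real vec" where
  "theta_hat p X n \<omega> = vec_stack (inv_mat (S_mat p X (n - 1) \<omega>) * YZ_sum p X (n - 1) \<omega>)"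

text \<open>The parameters are sequences of which only the entries 0 to p are used.\<close>
definition theta :: "nat \<Rightarrow> (nat \<Rightarrow> real) \<Rightarrow> (nat \<Rightarrow> real) \<Rightarrow> real vec" where
  "theta p a b = Matrix.vec (p + 1) a @\<^sub>v Matrix.vec (p + 1) b"

section \<open>The limiting matrices\<close>

definition companion :: "nat \<Rightarrow> (nat \<Rightarrow> real) \<Rightarrow> real mat" where
  "companion p a = Matrix.mat p p
     (\<lambda>(i, j). if i = 0 then a (j + 1) else if i = j + 1 then 1 else 0)"

definition lambda_vec :: "nat \<Rightarrow> (nat \<Rightarrow> real) \<Rightarrow> (nat \<Rightarrow> real) \<Rightarrow> real vec" where
  "lambda_vec p a b =
     ((a 0 + b 0) / 2) \<cdot>\<^sub>v
       (inv_mat (1\<^sub>m p - (1 / 2) \<cdot>\<^sub>m (companion p a + companion p b)) *\<^sub>v unit_vec p 0)"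

definition T_mat :: "nat \<Rightarrow> (nat \<Rightarrow> real) \<Rightarrow> (nat \<Rightarrow> real) \<Rightarrow> real \<Rightarrow> real mat" where
  "T_mat p a b \<sigma> =
     (let A = companion p a; B = companion p b; l = lambda_vec p a b; e = unit_vec p 0
      in (\<sigma>\<^sup>2 + ((a 0)\<^sup>2 + (b 0)\<^sup>2) / 2) \<cdot>\<^sub>m outer_prod e e
         + (1 / 2) \<cdot>\<^sub>m
           (a 0 \<cdot>\<^sub>m (outer_prod (A *\<^sub>v l) e + outer_prod e l * transpose_mat A)
            + b 0 \<cdot>\<^sub>m (outer_prod (B *\<^sub>v l) e + outer_prod e l * transpose_mat B)))"

definition ell_mat :: "nat \<Rightarrow> (nat \<Rightarrow> real) \<Rightarrow> (nat \<Rightarrow> real) \<Rightarrow> real \<Rightarrow> real mat" where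
  "ell_mat p a b \<sigma> =
     (THE l. l \<in> carrier_mat p p \<and>
        l = T_mat p a b \<sigma> + (1 / 2) \<cdot>\<^sub>m
              (companion p a * l * transpose_mat (companion p a)
               + companion p b * l * transpose_mat (companion p b)))"

definition L_mat :: "nat \<Rightarrow> (nat \<Rightarrow> real) \<Rightarrow> (nat \<Rightarrow> real) \<Rightarrow> real \<Rightarrow> real mat" where
  "L_mat p a b \<sigma> =
     four_block_mat (1\<^sub>m 1) (mat_of_rows p [lambda_vec p a b])
       (mat_of_cols p [lambda_vec p a b]) (ell_mat p a b \<sigma>)"

definition Lambda_mat :: "nat \<Rightarrow> (nat \<Rightarrow> real) \<Rightarrow> (nat \<Rightarrow> real) \<Rightarrow> real \<Rightarrow> real mat" where
  "Lambda_mat p a b \<sigma> = kronecker_prod (1\<^sub>m 2) (L_mat p a b \<sigma>)"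

end

theory Submission
  imports
    Defs
    "HOL-Library.Discrete_Functions"
    "Jordan_Normal_Form.Determinant"
begin

text \<open>
  Write \<open>Y k\<close> for the regressor of cell \<open>k\<close> and, for a fixed daughter type, \<open>W n\<close> for the sum of
  \<open>\<epsilon> Y\<close> over generation \<open>n\<close> and \<open>U n\<close> for the sum of the earlier \<open>W\<close>. The estimation error solves
  \<open>S v = U\<close>, so the quadratic strong law amounts to the convergence of \<open>2\<^sup>-\<^sup>k U k (U k)\<^sup>t\<close> to
  \<open>\<sigma>\<^sup>2 L\<close> in the Cesaro sense. Since \<open>U (k + 1) = U k + W k\<close>, the matrices \<open>2\<^sup>-\<^sup>k U k (U k)\<^sup>t\<close> satisfy a
  recursion with factor 1/2 whose forcing terms are the cross products \<open>U k (W k)\<^sup>t\<close> and \<open>W k (W k)\<^sup>t\<close>;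
  centred, these are orthogonal and bounded in \<open>L\<^sup>2\<close>, so that no martingale convergence theorem
  is needed. As the terms of the quadratic strong law are nonnegative, it yields the rate of convergence.

  The size of a generation grows geometrically, so the law of large numbers for \<open>Y Y\<^sup>t\<close> follows from
  summability of second moments and the contraction by the companion matrices. Conditional fourth
  moments of the noise are only bounded by a random constant; all moment estimates are made on the
  predictable event that this constant has not yet exceeded a level \<open>K\<close>.
\<close>

section \<open>Means of sequences and a strong law for orthogonal variables\<close>

text \<open>Since Lambda is block diagonal, the two daughter types separate. Each contributes the
  trace of L^-1 (sigma^2 L), which is (p+1) sigma^2, and the limit is the sum of the two. For a
  fixed type, the joint conditional independence of the sister pairs turns the noise of one
  generation into a conditionally independent family; this removes the mixed terms in fourth
  moments. One generation is as large as all earlier ones together, so each new \<open>W\<close> is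
  of the same order as \<open>U\<close>. The matrices 2^-k U U^t are therefore controlled only in
  mean, and the L^2 bounds for the forcing terms need fourth moments of \<open>W\<close> and
  \<open>U\<close> of order 4^k. Probability ends once finitely many families of almost sure limits
  are known; the rest is deterministic, path by path. It needs L to be invertible, which its
  defining equations do not show. This is obtained by reading the form of L as a limit of averages
  of squares and passing from one generation to the next.\<close>

lemma perturbed_contraction_tendsto_0:
  fixes z d :: "nat \<Rightarrow> real"
  assumes b: "0 \<le> b" "b < 1" and pos: "\<And>n. 0 \<le> z n"
    and rec: "\<And>n. n \<ge> m \<Longrightarrow> z (Suc n) \<le> b * z n + d n" and d: "d \<longlonglongrightarrow> 0"
  shows "z \<longlonglongrightarrow> 0"
proof (rule LIMSEQ_I)
  fix e :: real assume e: "e > 0"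
  \<comment> \<open>The number e/2 is the fixed point of x -> b x + e (1 - b) / 2, so perturbations
    below this size leave e/2 plus a geometrically decaying term.\<close>
  have "e * (1 - b) / 2 > 0" using e b by simp
  then have "\<forall>\<^sub>F n in sequentially. d n < e * (1 - b) / 2"
    using d by (rule order_tendstoD(2)[rotated])
  then obtain N1 where N1: "\<And>n. n \<ge> N1 \<Longrightarrow> d n < e * (1 - b) / 2"
    by (auto simp: eventually_sequentially)
  define N where "N = max N1 m"
  have bound: "z (N + k) \<le> e / 2 + b ^ k * z N" for k
  proof (induction k)
    case 0 then show ?case using e by simp
  next
    case (Suc k)
    have "z (N + Suc k) \<le> b * z (N + k) + d (N + k)" using rec[of "N + k"] by (simp add: N_def)
    also have "\<dots> \<le> b * (e / 2 + b ^ k * z N) + e * (1 - b) / 2"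
      using Suc.IH b less_imp_le[OF N1[of "N + k"]] by (intro add_mono mult_left_mono) (auto simp: N_def)
    also have "\<dots> = e / 2 + b ^ Suc k * z N" by (simp add: field_simps)
    finally show ?case .
  qed
  have "(\<lambda>k. b ^ k * z N) \<longlonglongrightarrow> 0 * z N" using b by (intro tendsto_intros LIMSEQ_power_zero) auto
  then have "\<forall>\<^sub>F k in sequentially. b ^ k * z N < e / 2"
    using e by (intro order_tendstoD(2)) auto
  then obtain k0 where k0: "\<And>k. k \<ge> k0 \<Longrightarrow> b ^ k * z N < e / 2"
    by (auto simp: eventually_sequentially)
  have "norm (z n - 0) < e" if "n \<ge> N + k0" for n
  proof -
    have "z n \<le> e / 2 + b ^ (n - N) * z N" using bound[of "n - N"] that by simp
    moreover have "b ^ (n - N) * z N < e / 2" using that by (intro k0) simp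
    ultimately show ?thesis using pos[of n] by simp
  qed
  then show "\<exists>no. \<forall>n\<ge>no. norm (z n - 0) < e" by blast
qed

text \<open>A Cesaro argument in which the weights \<open>q\<close> need not be bounded: a linear
  bound on their partial sums is enough. It absorbs errors that are small relative to a quantity
  controlled only in mean.\<close>

lemma mean_vanishing_weights:
  fixes d q :: "nat \<Rightarrow> real"
  assumes d: "d \<longlonglongrightarrow> 0" and q: "\<And>k. 0 \<le> q k" and C: "\<And>n. (\<Sum>k<n. q k) \<le> C * real n"
  shows "(\<lambda>n. (\<Sum>k<n. d k * q k) / real n) \<longlonglongrightarrow> 0"
proof (rule LIMSEQ_I)
  fix e :: real assume e: "e > 0"
  have C0: "C \<ge> 0" using C[of 1] q[of 0] by simp
  define h where "h = e / (2 * (C + 1))"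
  have h: "h > 0" "h * C < e / 2" using e C0 by (auto simp: h_def field_simps)
  obtain N where N: "\<And>k. k \<ge> N \<Longrightarrow> \<bar>d k\<bar> < h"
    using LIMSEQ_D[OF d h(1)] by auto
  define A where "A = (\<Sum>k<N. \<bar>d k\<bar> * q k)"
  have A: "(\<lambda>n. A / real n) \<longlonglongrightarrow> 0" by (rule lim_const_over_n)
  obtain N2 where N2: "\<And>n. n \<ge> N2 \<Longrightarrow> \<bar>A / real n\<bar> < e / 2"
    using LIMSEQ_D[OF A, of "e/2"] e by auto
  have "norm ((\<Sum>k<n. d k * q k) / real n - 0) < e" if n: "n \<ge> Suc (max N N2)" for n
  proof -
    have "\<bar>\<Sum>k<n. d k * q k\<bar> \<le> (\<Sum>k<n. \<bar>d k\<bar> * q k)"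
      by (rule order_trans[OF sum_abs]) (auto intro!: sum_mono simp: abs_mult q)
    also have "\<dots> = A + (\<Sum>k\<in>{N..<n}. \<bar>d k\<bar> * q k)"
      unfolding A_def using n by (subst sum.union_disjoint[symmetric]) (auto intro!: sum.cong)
    also have "(\<Sum>k\<in>{N..<n}. \<bar>d k\<bar> * q k) \<le> (\<Sum>k\<in>{N..<n}. h * q k)"
      using N q by (intro sum_mono mult_right_mono) (auto intro: less_imp_le)
    also have "\<dots> \<le> (\<Sum>k<n. h * q k)" using h q by (intro sum_mono2) auto
    also have "\<dots> \<le> h * (C * n)" using C[of n] h by (simp add: sum_distrib_left[symmetric])
    finally have "\<bar>\<Sum>k<n. d k * q k\<bar> / n \<le> (A + h * (C * n)) / n" by (simp add: divide_right_mono)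
    also have "\<dots> = A / n + h * C" using n by (simp add: field_simps)
    also have "\<dots> < e" using N2[of n] n h(2) by linarith
    finally show ?thesis by simp
  qed
  then show "\<exists>no. \<forall>n\<ge>no. norm ((\<Sum>k<n. d k * q k) / real n - 0) < e" by blast
qed

lemma mean_tendsto:
  fixes x :: "nat \<Rightarrow> real"
  assumes "x \<longlonglongrightarrow> l"
  shows "(\<lambda>n. (\<Sum>k<n. x k) / real n) \<longlonglongrightarrow> l"
proof -
  have "(\<lambda>n. (\<Sum>k<n. (x k - l) * 1) / real n) \<longlonglongrightarrow> 0"
    by (rule mean_vanishing_weights[where C = 1]) (use assms LIM_zero in auto)
  then have "(\<lambda>n. (\<Sum>k<n. (x k - l) * 1) / real n + l) \<longlonglongrightarrow> 0 + l" by (intro tendsto_intros)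
  moreover have "\<forall>\<^sub>F n in sequentially. (\<Sum>k<n. (x k - l) * 1) / real n + l = (\<Sum>k<n. x k) / real n"
    using eventually_gt_at_top[of 0] by eventually_elim (simp add: sum_subtractf field_simps)
  ultimately show ?thesis by (simp add: filterlim_cong)
qed

lemma mean_bounded:
  fixes q :: "nat \<Rightarrow> real"
  assumes "(\<lambda>n. (\<Sum>k<n. q k) / real n) \<longlonglongrightarrow> c"
  obtains C where "\<And>n. (\<Sum>k<n. q k) \<le> C * real n"
proof -
  have "Bseq (\<lambda>n. (\<Sum>k<n. q k) / real n)" using assms by (intro convergent_imp_Bseq convergentI)
  then obtain C where C: "\<And>n. norm ((\<Sum>k<n. q k) / real n) \<le> C" unfolding Bseq_def by blast
  have "(\<Sum>k<n. q k) \<le> C * real n" for n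
  proof (cases "n = 0")
    case False
    then show ?thesis using C[of n] by (simp add: field_simps abs_le_iff)
  qed simp
  then show ?thesis by (rule that)
qed

text \<open>Summing the recursion relates consecutive means of \<open>Q\<close>. Their limit has to
  solve x = x / 2 + c, and the factor 1/2 makes the centred means a perturbed contraction.\<close>

lemma halving_recursion_mean:
  fixes Q J :: "nat \<Rightarrow> real"
  assumes rec: "\<And>k. Q (Suc k) = Q k / 2 + J k"
    and J: "(\<lambda>n. (\<Sum>k<n. J k) / real n) \<longlonglongrightarrow> c"
  shows "(\<lambda>n. (\<Sum>k<n. Q k) / real n) \<longlonglongrightarrow> 2 * c"
proof -
  define z where "z n = (\<Sum>k<n. Q k) / real n - 2 * c" for n
  \<comment> \<open>This collects all that is left after (1/2) (n / (n+1)) \<open>z n\<close> is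
    split off; its limit is 0 + c - 2c + c = 0.\<close>
  define w where "w n = Q 0 / real (Suc n) + (\<Sum>k<n. J k) / real n * (real n / real (Suc n))
      - 2 * c + c * (real n / real (Suc n))" for n
  have one: "(\<lambda>n. real n / real (Suc n)) \<longlonglongrightarrow> 1" by (rule LIMSEQ_n_over_Suc_n)
  have q0: "(\<lambda>n. Q 0 / real (Suc n)) \<longlonglongrightarrow> 0"
    by (rule LIMSEQ_Suc[OF lim_const_over_n])
  have "w \<longlonglongrightarrow> 0 + c * 1 - 2 * c + c * 1"
    unfolding w_def by (intro tendsto_add tendsto_diff tendsto_mult tendsto_const one q0 J)
  then have w: "w \<longlonglongrightarrow> 0" by simp
  have "\<bar>z (Suc n)\<bar> \<le> 1/2 * \<bar>z n\<bar> + \<bar>w n\<bar>" if "n \<ge> 1" for n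
  proof -
    have "(\<Sum>k<Suc n. Q k) = Q 0 + (\<Sum>k<n. Q (Suc k))" by (simp only: sum.lessThan_Suc_shift)
    also have "(\<Sum>k<n. Q (Suc k)) = (\<Sum>k<n. Q k) / 2 + (\<Sum>k<n. J k)"
      by (simp add: rec sum.distrib sum_divide_distrib)
    finally have eq: "(\<Sum>k<Suc n. Q k) = Q 0 + (\<Sum>k<n. Q k) / 2 + (\<Sum>k<n. J k)" by simp
    have n: "real n > 0" "real (Suc n) > 0" using that by auto
    have "z (Suc n) = 1/2 * (real n / real (Suc n)) * z n + w n"
    proof -
      have a: "x / real n * (real n / real (Suc n)) = x / real (Suc n)" for x using n by simp
      have e: "1/2 * u * (r - 2 * c) = r * u / 2 - c * u" for u r :: real by (simp add: algebra_simps)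
      have "z (Suc n) = Q 0 / real (Suc n) + (\<Sum>k<n. Q k) / real (Suc n) / 2
          + (\<Sum>k<n. J k) / real (Suc n) - 2 * c"
        unfolding z_def eq add_divide_distrib by (simp only: divide_divide_eq_left mult.commute)
      moreover have "1/2 * (real n / real (Suc n)) * z n = (\<Sum>k<n. Q k) / real (Suc n) / 2 - c * (real n / real (Suc n))"
        unfolding z_def e a ..
      moreover have "w n = Q 0 / real (Suc n) + (\<Sum>k<n. J k) / real (Suc n) - 2 * c + c * (real n / real (Suc n))"
        unfolding w_def a ..
      ultimately show ?thesis by linarith
    qed
    then have "\<bar>z (Suc n)\<bar> \<le> \<bar>1/2 * (real n / real (Suc n)) * z n\<bar> + \<bar>w n\<bar>"
      by (simp only: abs_triangle_ineq)
    also have "\<bar>1/2 * (real n / real (Suc n)) * z n\<bar> = 1/2 * (real n / real (Suc n)) * \<bar>z n\<bar>"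
      unfolding abs_mult by (simp only: abs_of_nonneg divide_nonneg_nonneg of_nat_0_le_iff zero_le_one zero_le_numeral)
    also have "\<dots> \<le> 1/2 * \<bar>z n\<bar>"
      using n by (intro mult_right_mono) auto
    finally show ?thesis by simp
  qed
  then have rec: "\<bar>z (Suc n)\<bar> \<le> 1/2 * \<bar>z n\<bar> + \<bar>w n\<bar>" if "n \<ge> 1" for n using that .
  have "(\<lambda>n. \<bar>z n\<bar>) \<longlonglongrightarrow> 0"
  proof (rule perturbed_contraction_tendsto_0)
    show "\<bar>z (Suc n)\<bar> \<le> 1/2 * \<bar>z n\<bar> + \<bar>w n\<bar>" if "n \<ge> 1" for n using rec[OF that] .
    show "(\<lambda>n. \<bar>w n\<bar>) \<longlonglongrightarrow> 0" by (rule tendsto_rabs_zero[OF w])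
  qed auto
  then have "z \<longlonglongrightarrow> 0" by (simp add: tendsto_rabs_zero_iff)
  then show ?thesis unfolding z_def by (simp add: LIM_zero_iff)
qed

section \<open>Almost sure convergence from moments and orthogonality\<close>

context prob_space begin

text \<open>The sum of the series has finite expectation, hence is finite almost surely, and the
  terms of a convergent series vanish in the limit.\<close>

lemma AE_tendsto_0_summable:
  fixes f :: "nat \<Rightarrow> 'a \<Rightarrow> real"
  assumes int: "\<And>n. integrable M (f n)" and pos: "\<And>n x. 0 \<le> f n x"
    and sm: "summable (\<lambda>n. expectation (f n))"
  shows "AE x in M. (\<lambda>n. f n x) \<longlonglongrightarrow> 0"
proof -
  have m [measurable]: "f n \<in> borel_measurable M" for n using int by auto
  have "(\<integral>\<^sup>+ x. (\<Sum>n. ennreal (f n x)) \<partial>M) = (\<Sum>n. \<integral>\<^sup>+ x. ennreal (f n x) \<partial>M)"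
    by (rule nn_integral_suminf) auto
  also have "\<dots> = (\<Sum>n. ennreal (expectation (f n)))"
    using int pos by (simp add: nn_integral_eq_integral)
  also have "\<dots> = ennreal (\<Sum>n. expectation (f n))"
    using sm pos by (intro suminf_ennreal2) auto
  finally have "(\<integral>\<^sup>+ x. (\<Sum>n. ennreal (f n x)) \<partial>M) \<noteq> \<infinity>" by simp
  then have "AE x in M. (\<Sum>n. ennreal (f n x)) \<noteq> \<infinity>"
    by (intro nn_integral_noteq_infinite) auto
  then show ?thesis
  proof eventually_elim
    case (elim x)
    then have "summable (\<lambda>n. f n x)" using pos by (intro summable_suminf_not_top) auto
    then show ?case by (rule summable_LIMSEQ_zero)
  qed
qed

lemma AE_tendsto_0_power:
  fixes f :: "nat \<Rightarrow> 'a \<Rightarrow> real"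
  assumes int: "\<And>n. integrable M (\<lambda>x. f n x ^ r)" and r: "even r" "r > 0"
    and bd: "\<And>n. expectation (\<lambda>x. f n x ^ r) \<le> B n" and sm: "summable B"
  shows "AE x in M. (\<lambda>n. f n x) \<longlonglongrightarrow> 0"
proof -
  have pos: "0 \<le> f n x ^ r" for n x using r by (simp add: zero_le_even_power)
  have "summable (\<lambda>n. expectation (\<lambda>x. f n x ^ r))"
    by (rule summable_comparison_test'[OF sm, of 0]) (use pos bd in auto)
  then have "AE x in M. (\<lambda>n. f n x ^ r) \<longlonglongrightarrow> 0"
    using AE_tendsto_0_summable[OF int pos] by simp
  then show ?thesis
  proof eventually_elim
    case (elim x)
    have "(\<lambda>n. root r (f n x ^ r)) \<longlonglongrightarrow> root r 0" by (intro tendsto_real_root elim)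
    moreover have "root r (f n x ^ r) = \<bar>f n x\<bar>" for n
      using real_root_power_cancel[of r "\<bar>f n x\<bar>"] r by (simp add: power_even_abs)
    ultimately show ?case by (simp add: tendsto_rabs_zero_iff)
  qed
qed

lemma integrable_mult_squares:
  fixes f g :: "'a \<Rightarrow> real"
  assumes [measurable]: "f \<in> borel_measurable M" "g \<in> borel_measurable M"
    and "integrable M (\<lambda>x. (f x)\<^sup>2)" "integrable M (\<lambda>x. (g x)\<^sup>2)"
  shows "integrable M (\<lambda>x. f x * g x)"
proof (rule Bochner_Integration.integrable_bound[OF Bochner_Integration.integrable_add[OF assms(3,4)]])
  show "AE x in M. norm (f x * g x) \<le> norm ((f x)\<^sup>2 + (g x)\<^sup>2)"
  proof (rule AE_I2)
    fix x
    have "0 \<le> (\<bar>f x\<bar> - \<bar>g x\<bar>)\<^sup>2" "0 \<le> \<bar>f x\<bar> * \<bar>g x\<bar>" by auto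
    then have "\<bar>f x\<bar> * \<bar>g x\<bar> \<le> (f x)\<^sup>2 + (g x)\<^sup>2" unfolding power2_diff power2_abs by linarith
    then show "norm (f x * g x) \<le> norm ((f x)\<^sup>2 + (g x)\<^sup>2)" by (simp add: abs_mult)
  qed
qed measurable

lemma integrable_sum_squared:
  fixes f :: "'i \<Rightarrow> 'a \<Rightarrow> real"
  assumes "\<And>i. i \<in> I \<Longrightarrow> f i \<in> borel_measurable M" "\<And>i. i \<in> I \<Longrightarrow> integrable M (\<lambda>x. (f i x)\<^sup>2)"
  shows "integrable M (\<lambda>x. (\<Sum>i\<in>I. f i x)\<^sup>2)"
  unfolding power2_eq_square sum_product
  by (intro Bochner_Integration.integrable_sum integrable_mult_squares assms)

lemma expectation_sum_orthogonal:
  fixes f :: "'i \<Rightarrow> 'a \<Rightarrow> real"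
  assumes "finite I" "\<And>i. i \<in> I \<Longrightarrow> f i \<in> borel_measurable M" "\<And>i. i \<in> I \<Longrightarrow> integrable M (\<lambda>x. (f i x)\<^sup>2)"
    and orth: "\<And>i j. i \<in> I \<Longrightarrow> j \<in> I \<Longrightarrow> i \<noteq> j \<Longrightarrow> expectation (\<lambda>x. f i x * f j x) = 0"
  shows "expectation (\<lambda>x. (\<Sum>i\<in>I. f i x)\<^sup>2) = (\<Sum>i\<in>I. expectation (\<lambda>x. (f i x)\<^sup>2))"
proof -
  have "expectation (\<lambda>x. (\<Sum>i\<in>I. f i x)\<^sup>2) = expectation (\<lambda>x. \<Sum>i\<in>I. \<Sum>j\<in>I. f i x * f j x)"
    by (simp add: power2_eq_square sum_product)
  also have "\<dots> = (\<Sum>i\<in>I. \<Sum>j\<in>I. expectation (\<lambda>x. f i x * f j x))"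
    using assms by (simp add: Bochner_Integration.integral_sum integrable_mult_squares)
  also have "\<dots> = (\<Sum>i\<in>I. \<Sum>j\<in>I. if j = i then expectation (\<lambda>x. f i x * f j x) else 0)"
    using orth by (intro sum.cong) auto
  also have "\<dots> = (\<Sum>i\<in>I. expectation (\<lambda>x. (f i x)\<^sup>2))"
    using assms(1) by (simp add: power2_eq_square)
  finally show ?thesis .
qed

text \<open>
  Convergence along the squares follows from orthogonality and summability; the blocks between
  consecutive squares are short enough to be bounded by the triangle inequality.
\<close>

lemma orthogonal_strong_law:
  fixes f :: "nat \<Rightarrow> 'a \<Rightarrow> real"
  assumes [measurable]: "\<And>k. f k \<in> borel_measurable M" and int: "\<And>k. integrable M (\<lambda>x. (f k x)\<^sup>2)"
    and bd: "\<And>k. expectation (\<lambda>x. (f k x)\<^sup>2) \<le> C"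
    and orth: "\<And>i j. i < j \<Longrightarrow> expectation (\<lambda>x. f i x * f j x) = 0"
  shows "AE x in M. (\<lambda>n. (\<Sum>k<n. f k x) / real n) \<longlonglongrightarrow> 0"
proof -
  have C0: "0 \<le> C" using bd[of 0] by (rule order_trans[rotated]) simp
  have orth': "expectation (\<lambda>x. f i x * f j x) = 0" if "i \<noteq> j" for i j
    using orth[of i j] orth[of j i] that by (cases "i < j") (auto simp: mult.commute)
  \<comment> \<open>The index is shifted so that the squares start at 1 and no denominator is
    0.\<close>
  define S where "S m x = (\<Sum>k<(Suc m)\<^sup>2. f k x) / real ((Suc m)\<^sup>2)" for m x
  define G where "G m x = (\<Sum>k\<in>{(Suc m)\<^sup>2..<(Suc (Suc m))\<^sup>2}. \<bar>f k x\<bar>) / real ((Suc m)\<^sup>2)" for m x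
  have sm: "summable (\<lambda>m. c * (1 / real (Suc m) ^ 2))" for c
    using inverse_power_summable[of 2, where 'a = real] summable_Suc_iff[of "\<lambda>n. inverse (real n ^ 2)"]
    by (intro summable_mult) (simp add: divide_inverse)
  have S: "AE x in M. (\<lambda>m. S m x) \<longlonglongrightarrow> 0"
  proof (rule AE_tendsto_0_power[where r = 2 and B = "\<lambda>m. C * (1 / real (Suc m) ^ 2)"])
    fix m
    have "integrable M (\<lambda>x. (\<Sum>k<(Suc m)\<^sup>2. f k x)\<^sup>2)"
      by (rule integrable_sum_squared) (use int in auto)
    then show "integrable M (\<lambda>x. (S m x)\<^sup>2)" unfolding S_def power_divide by (rule integrable_divide_zero)
    have "expectation (\<lambda>x. (S m x)\<^sup>2) = expectation (\<lambda>x. (\<Sum>k<(Suc m)\<^sup>2. f k x)\<^sup>2) / (real ((Suc m)\<^sup>2))\<^sup>2"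
      unfolding S_def power_divide by (rule integral_divide_zero)
    also have "\<dots> = (\<Sum>k<(Suc m)\<^sup>2. expectation (\<lambda>x. (f k x)\<^sup>2)) / (real ((Suc m)\<^sup>2))\<^sup>2"
      by (subst expectation_sum_orthogonal) (use int orth' in auto)
    also have "\<dots> \<le> (\<Sum>k<(Suc m)\<^sup>2. C) / (real ((Suc m)\<^sup>2))\<^sup>2"
      using bd by (intro divide_right_mono sum_mono) auto
    also have "\<dots> = C * (1 / real (Suc m) ^ 2)"
    proof -
      have "x\<^sup>2 * C / (x\<^sup>2)\<^sup>2 = C * (1 / x\<^sup>2)" for x :: real by (simp add: power2_eq_square)
      then show ?thesis unfolding sum_constant card_lessThan of_nat_power by simp
    qed
    finally show "expectation (\<lambda>x. (S m x)\<^sup>2) \<le> C * (1 / real (Suc m) ^ 2)" .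
  qed (use sm in auto)
  have G: "AE x in M. (\<lambda>m. G m x) \<longlonglongrightarrow> 0"
  \<comment> \<open>The block between consecutive squares has 2m + 3 terms, at most 3 (m + 1).
    Cauchy-Schwarz then bounds the second moment of the block by 9 C (m + 1)^2, and the
    normalization divides by (m + 1)^4.\<close>
  proof (rule AE_tendsto_0_power[where r = 2 and B = "\<lambda>m. (9 * C) * (1 / real (Suc m) ^ 2)"])
    fix m
    let ?I = "{(Suc m)\<^sup>2..<(Suc (Suc m))\<^sup>2}"
    have i1: "integrable M (\<lambda>x. (\<Sum>k\<in>?I. \<bar>f k x\<bar>)\<^sup>2)"
      by (rule integrable_sum_squared) (use int in auto)
    then show "integrable M (\<lambda>x. (G m x)\<^sup>2)" unfolding G_def power_divide by (rule integrable_divide_zero)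
    have card: "card ?I = 2 * m + 3" by (simp add: power2_eq_square)
    have "expectation (\<lambda>x. (\<Sum>k\<in>?I. \<bar>f k x\<bar>)\<^sup>2) \<le> expectation (\<lambda>x. real (card ?I) * (\<Sum>k\<in>?I. (f k x)\<^sup>2))"
    proof (rule integral_mono[OF i1])
      show "integrable M (\<lambda>x. real (card ?I) * (\<Sum>k\<in>?I. (f k x)\<^sup>2))" using int by auto
      fix x
      show "(\<Sum>k\<in>?I. \<bar>f k x\<bar>)\<^sup>2 \<le> real (card ?I) * (\<Sum>k\<in>?I. (f k x)\<^sup>2)"
        using sum_squared_le_sum_of_squares[of "\<lambda>k. \<bar>f k x\<bar>" ?I] by (simp add: mult.commute)
    qed
    also have "\<dots> = real (card ?I) * (\<Sum>k\<in>?I. expectation (\<lambda>x. (f k x)\<^sup>2))"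
      using int by (simp add: Bochner_Integration.integral_sum)
    also have "\<dots> \<le> real (card ?I) * (\<Sum>k\<in>?I. C)" using bd by (intro mult_left_mono sum_mono) auto
    also have "\<dots> = (real (2 * m + 3))\<^sup>2 * C" unfolding sum_constant card by (simp add: power2_eq_square)
    also have "\<dots> \<le> (3 * real (Suc m))\<^sup>2 * C" using C0 by (intro mult_right_mono power_mono) auto
    finally have le: "expectation (\<lambda>x. (\<Sum>k\<in>?I. \<bar>f k x\<bar>)\<^sup>2) \<le> 9 * C * (real (Suc m))\<^sup>2"
      by (simp add: power_mult_distrib mult_ac del: of_nat_Suc)
    have "expectation (\<lambda>x. (G m x)\<^sup>2) = expectation (\<lambda>x. (\<Sum>k\<in>?I. \<bar>f k x\<bar>)\<^sup>2) / (real ((Suc m)\<^sup>2))\<^sup>2"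
      unfolding G_def power_divide by (rule integral_divide_zero)
    also have "\<dots> \<le> (9 * C * (real (Suc m))\<^sup>2) / (real ((Suc m)\<^sup>2))\<^sup>2"
      by (rule divide_right_mono[OF le]) simp
    also have "\<dots> = (9 * C) * (1 / real (Suc m) ^ 2)"
    proof -
      have "9 * C * x\<^sup>2 / (x\<^sup>2)\<^sup>2 = (9 * C) * (1 / x\<^sup>2)" for x :: real by (simp add: power2_eq_square)
      then show ?thesis unfolding of_nat_power by simp
    qed
    finally show "expectation (\<lambda>x. (G m x)\<^sup>2) \<le> (9 * C) * (1 / real (Suc m) ^ 2)" .
  qed (use sm in auto)
  \<comment> \<open>For n > 0 the number m = \<open>floor_sqrt n - 1\<close> is the one with (m+1)^2
    \<le> n < (m+2)^2.\<close>
  have lim: "filterlim (\<lambda>n. floor_sqrt n - 1) sequentially sequentially"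
    unfolding filterlim_at_top
  proof
    fix Z :: nat
    have "Z \<le> floor_sqrt n - 1" if "n \<ge> (Suc Z)\<^sup>2" for n
      using monoD[OF mono_floor_sqrt that] by simp
    then show "\<forall>\<^sub>F n in sequentially. Z \<le> floor_sqrt n - 1"
      unfolding eventually_sequentially by blast
  qed
  show ?thesis using S G
  proof eventually_elim
    case (elim x)
    have "(\<lambda>m. \<bar>S m x\<bar> + G m x) \<longlonglongrightarrow> \<bar>0\<bar> + 0" using elim by (intro tendsto_intros)
    then have t: "(\<lambda>n. \<bar>S (floor_sqrt n - 1) x\<bar> + G (floor_sqrt n - 1) x) \<longlonglongrightarrow> 0"
      using filterlim_compose[OF _ lim] by auto
    have "\<forall>\<^sub>F n in sequentially. norm ((\<Sum>k<n. f k x) / real n) \<le> \<bar>S (floor_sqrt n - 1) x\<bar> + G (floor_sqrt n - 1) x"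
      using eventually_gt_at_top[of 0]
    proof eventually_elim
      case (elim n)
      define m where "m = floor_sqrt n - 1"
      have pos: "floor_sqrt n > 0" using elim by simp
      then have sm: "Suc m = floor_sqrt n" by (simp add: m_def)
      have le: "(Suc m)\<^sup>2 \<le> n" "n < (Suc (Suc m))\<^sup>2"
        unfolding sm by (auto simp: Suc_floor_sqrt_power2_gt)
      have "(\<Sum>k<n. f k x) = (\<Sum>k<(Suc m)\<^sup>2. f k x) + (\<Sum>k\<in>{(Suc m)\<^sup>2..<n}. f k x)"
        using le by (subst sum.union_disjoint[symmetric]) (auto intro!: sum.cong)
      then have "\<bar>\<Sum>k<n. f k x\<bar> \<le> \<bar>\<Sum>k<(Suc m)\<^sup>2. f k x\<bar> + \<bar>\<Sum>k\<in>{(Suc m)\<^sup>2..<n}. f k x\<bar>" by simp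
      also have "\<bar>\<Sum>k\<in>{(Suc m)\<^sup>2..<n}. f k x\<bar> \<le> (\<Sum>k\<in>{(Suc m)\<^sup>2..<n}. \<bar>f k x\<bar>)" by (rule sum_abs)
      also have "\<dots> \<le> (\<Sum>k\<in>{(Suc m)\<^sup>2..<(Suc (Suc m))\<^sup>2}. \<bar>f k x\<bar>)" using le by (intro sum_mono2) auto
      finally have "\<bar>\<Sum>k<n. f k x\<bar> / real n \<le> (\<bar>\<Sum>k<(Suc m)\<^sup>2. f k x\<bar> + (\<Sum>k\<in>{(Suc m)\<^sup>2..<(Suc (Suc m))\<^sup>2}. \<bar>f k x\<bar>)) / real ((Suc m)\<^sup>2)"
        using le by (intro frac_le of_nat_mono) (auto intro!: add_nonneg_nonneg sum_nonneg)
      then show ?case unfolding m_def[symmetric]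
        by (simp add: S_def G_def add_divide_distrib del: of_nat_Suc of_nat_power)
    qed
    then show ?case using t by (rule Lim_null_comparison)
  qed
qed

end

section \<open>Conditional independence and conditional expectation\<close>

text \<open>The sigma-algebra generated by \<open>F\<close> and the variables indexed by
  \<open>J\<close>. The generators are chosen stable under intersection, so that integrals have to
  be compared on them only.\<close>

definition cylinder_algebra ::
  "'a measure \<Rightarrow> 'a measure \<Rightarrow> ('i \<Rightarrow> 'a \<Rightarrow> real) \<Rightarrow> 'i set \<Rightarrow> 'a measure" where
  "cylinder_algebra M F U J = sigma (space M)
     {B \<inter> {x \<in> space M. \<forall>i\<in>J. U i x \<in> S i} | B S. B \<in> sets F \<and> (\<forall>i. S i \<in> sets borel)}"

lemma
  fixes U :: "'i \<Rightarrow> 'a \<Rightarrow> real"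
  assumes F: "subalgebra M F" and J: "finite J" and U: "\<And>i. i \<in> J \<Longrightarrow> U i \<in> borel_measurable M"
  shows subalgebra_cylinder_algebra: "subalgebra M (cylinder_algebra M F U J)"
    and cylinder_algebra_base: "subalgebra (cylinder_algebra M F U J) F"
    and cylinder_algebra_measurable: "\<And>i. i \<in> J \<Longrightarrow> U i \<in> borel_measurable (cylinder_algebra M F U J)"
    and sets_cylinder_algebra: "sets (cylinder_algebra M F U J) = sigma_sets (space M)
      {B \<inter> {x \<in> space M. \<forall>i\<in>J. U i x \<in> S i} | B S. B \<in> sets F \<and> (\<forall>i. S i \<in> sets borel)}"
proof -
  let ?G = "{B \<inter> {x \<in> space M. \<forall>i\<in>J. U i x \<in> S i} | B S. B \<in> sets F \<and> (\<forall>i. S i \<in> sets borel)}"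
  let ?H = "cylinder_algebra M F U J"
  have FM: "sets F \<subseteq> sets M" "space F = space M" using F by (auto simp: subalgebra_def)
  have GM: "?G \<subseteq> sets M"
  proof safe
    fix B and S :: "'i \<Rightarrow> real set" assume B: "B \<in> sets F" and S: "\<forall>i. S i \<in> sets borel"
    have "{x \<in> space M. \<forall>i\<in>J. U i x \<in> S i} \<in> sets M"
    proof (rule sets.sets_Collect_finite_All[OF _ J])
      fix i assume "i \<in> J"
      then have "U i -` S i \<inter> space M \<in> sets M" using U S by (auto intro: measurable_sets)
      then show "{x \<in> space M. U i x \<in> S i} \<in> sets M" by (simp add: vimage_def Int_def conj_commute)
    qed
    then show "B \<inter> {x \<in> space M. \<forall>i\<in>J. U i x \<in> S i} \<in> sets M" using B FM by auto
  qed
  then have Gp: "?G \<subseteq> Pow (space M)" using sets.sets_into_space by blast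
  show sets: "sets ?H = sigma_sets (space M) ?G"
    unfolding cylinder_algebra_def by (rule sets_measure_of[OF Gp])
  have sp: "space ?H = space M" unfolding cylinder_algebra_def by (rule space_measure_of[OF Gp])
  show "subalgebra M ?H" unfolding subalgebra_def sets sp using GM by (auto simp: sets.sigma_sets_subset)
  have "B \<in> sets ?H" if B: "B \<in> sets F" for B
  proof -
    have "B = B \<inter> {x \<in> space M. \<forall>i\<in>J. U i x \<in> (UNIV :: real set)}"
      using FM sets.sets_into_space[OF B] by auto
    then have "B \<in> ?G" using B by (intro CollectI exI[of _ B] exI[of _ "\<lambda>_. UNIV"]) auto
    then show ?thesis unfolding sets by blast
  qed
  then show "subalgebra ?H F" unfolding subalgebra_def sp using FM by auto
  fix i assume i: "i \<in> J"
  show "U i \<in> borel_measurable ?H"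
  proof (rule measurableI)
    fix A :: "real set" assume A: "A \<in> sets borel"
    have "U i -` A \<inter> space ?H = space M \<inter> {x \<in> space M. \<forall>k\<in>J. U k x \<in> (if k = i then A else UNIV)}"
      using i unfolding sp by auto
    also have "\<dots> \<in> ?G"
      using A FM sets.top[of F] by (intro CollectI exI[of _ "space M"] exI[of _ "\<lambda>k. if k = i then A else UNIV"]) auto
    finally show "U i -` A \<inter> space ?H \<in> sets ?H" unfolding sets by blast
  qed auto
qed

text \<open>The product formula for indicators is turned into a statement about conditioning: given
  the past, the other variables carry no further information on \<open>U j\<close>. The two
  conditional expectations are compared by integrals over the generating sets and then over the
  whole sigma-algebra by a Dynkin argument.\<close>

lemma cond_indep_vars_cond_exp:
  fixes U :: "'i \<Rightarrow> 'a \<Rightarrow> real" and f :: "real \<Rightarrow> real"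
  assumes M: "prob_space M" and F: "subalgebra M F" and I: "finite I" and j: "j \<in> I"
    and U: "\<And>i. i \<in> I \<Longrightarrow> U i \<in> borel_measurable M"
    and ind: "cond_indep_vars M F borel U I"
    and f [measurable]: "f \<in> borel_measurable borel" and int: "integrable M (\<lambda>x. f (U j x))"
  shows "AE x in M. real_cond_exp M (cylinder_algebra M F U (I - {j})) (\<lambda>x. f (U j x)) x
    = real_cond_exp M F (\<lambda>x. f (U j x)) x"
proof -
  interpret prob_space M by fact
  interpret F: finite_measure_subalgebra M F using F by unfold_locales
  define J where "J = I - {j}"
  have J: "finite J" "j \<notin> J" "insert j J = I" "\<And>i. i \<in> J \<Longrightarrow> i \<in> I" using I j by (auto simp: J_def)
  let ?H = "cylinder_algebra M F U J"
  have UJ: "\<And>i. i \<in> J \<Longrightarrow> U i \<in> borel_measurable M" using U J by auto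
  have H: "subalgebra M ?H" by (rule subalgebra_cylinder_algebra[OF F J(1)]) (rule UJ)
  have HF: "subalgebra ?H F" by (rule cylinder_algebra_base[OF F J(1)]) (rule UJ)
  interpret H: finite_measure_subalgebra M ?H using H by unfold_locales
  have [measurable]: "U j \<in> borel_measurable M" using U j .
  have FM: "sets F \<subseteq> sets M" "space F = space M" using F by (auto simp: subalgebra_def)
  define g where "g = real_cond_exp M F (\<lambda>x. f (U j x))"
  have gF [measurable]: "g \<in> borel_measurable F" unfolding g_def by simp
  have gM [measurable]: "g \<in> borel_measurable M" unfolding g_def by simp
  have gint: "integrable M g" unfolding g_def by (rule F.real_cond_exp_int[OF int])
  let ?G = "{B \<inter> {x \<in> space M. \<forall>i\<in>J. U i x \<in> S i} | B S. B \<in> sets F \<and> (\<forall>i. S i \<in> sets borel)}"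
  have sets_H: "sets ?H = sigma_sets (space M) ?G" by (rule sets_cylinder_algebra[OF F J(1)]) (rule UJ)
  have base: "(LINT x:C|M. f (U j x)) = (LINT x:C|M. g x)" if C: "C \<in> ?G" for C
  proof -
    obtain B S where B: "B \<in> sets F" and S: "\<And>i. S i \<in> sets borel"
      and C: "C = B \<inter> {x \<in> space M. \<forall>i\<in>J. U i x \<in> S i}" using C by blast
    have [measurable]: "B \<in> sets F" "B \<in> sets M" using B FM by auto
    have [measurable]: "S i \<in> sets borel" for i by (rule S)
    have ind_meas: "(\<lambda>x. indicator A (U i x) :: real) \<in> borel_measurable M" if "A \<in> sets borel" "i \<in> I" for A i
      using borel_measurable_indicator[OF that(1)] U[OF that(2)] by (rule measurable_compose[rotated])
    \<comment> \<open>On the space, \<open>ph\<close> is the indicator of the generator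
      \<open>C\<close>. Below, \<open>ps\<close> replaces each cylinder factor by its conditional
      expectation given \<open>F\<close>, which makes it \<open>F\<close>-measurable.\<close>
    define ph where "ph x = (indicator B x * (\<Prod>i\<in>J. indicator (S i) (U i x)) :: real)" for x
    define P where "P i = real_cond_exp M F (\<lambda>x. indicator (S i) (U i x))" for i
    define ps where "ps x = indicator B x * (\<Prod>i\<in>J. P i x)" for x
    have ph_C: "indicator C x = ph x" if "x \<in> space M" for x
    proof (cases "\<forall>i\<in>J. U i x \<in> S i")
      case True then show ?thesis using that by (auto simp: ph_def C indicator_def)
    next
      case False
      then have "(\<Prod>i\<in>J. indicator (S i) (U i x)) = (0 :: real)"
        using J(1) by (auto simp: indicator_def intro!: prod_zero)
      then show ?thesis using False by (auto simp: ph_def C indicator_def)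
    qed
    have ph_M [measurable]: "ph \<in> borel_measurable M"
      unfolding ph_def by (intro borel_measurable_times borel_measurable_prod ind_meas) (auto simp: J)
    have ps_F [measurable]: "ps \<in> borel_measurable F" unfolding ps_def P_def by simp
    have ps_M [measurable]: "ps \<in> borel_measurable M" by (rule measurable_from_subalg[OF F ps_F])
    have ph_b: "0 \<le> ph x" "ph x \<le> 1" for x
      unfolding ph_def by (auto intro!: mult_nonneg_nonneg prod_nonneg mult_le_one prod_le_1 simp: indicator_def)
    have "AE x in M. \<forall>i\<in>J. 0 \<le> P i x \<and> P i x \<le> 1"
    proof (rule AE_finite_allI[OF J(1)])
      fix i assume i: "i \<in> J"
      have int: "integrable M (\<lambda>x. indicator (S i) (U i x) :: real)"
        by (rule integrable_const_bound[where B = 1]) (use ind_meas S J(4)[OF i] in auto)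
      have "AE x in M. P i x \<ge> 0" unfolding P_def by (rule F.real_cond_exp_ge_c[OF int]) auto
      moreover have "AE x in M. P i x \<le> 1" unfolding P_def by (rule F.real_cond_exp_le_c[OF int]) auto
      ultimately show "AE x in M. 0 \<le> P i x \<and> P i x \<le> 1" by eventually_elim auto
    qed
    then have ps_b: "AE x in M. 0 \<le> ps x \<and> ps x \<le> 1"
    proof eventually_elim
      case (elim x)
      then show ?case unfolding ps_def
        by (auto intro!: mult_nonneg_nonneg prod_nonneg mult_le_one prod_le_1 simp: indicator_def)
    qed
    have int_b: "integrable M (\<lambda>x. h x * k x)"
      if "integrable M k" "h \<in> borel_measurable M" "AE x in M. 0 \<le> h x \<and> h x \<le> 1" for h k :: "'a \<Rightarrow> real"
    proof (rule Bochner_Integration.integrable_bound[OF that(1)])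
      show "AE x in M. norm (h x * k x) \<le> norm (k x)"
        using that(3) by eventually_elim (auto simp: abs_mult intro: mult_left_le_one_le)
      have "k \<in> borel_measurable M" using that(1) by auto
      then show "(\<lambda>x. h x * k x) \<in> borel_measurable M" using that(2) by simp
    qed
    have prod_b: "AE x in M. (0::real) \<le> (\<Prod>i\<in>A. indicator (S' i) (U i x)) \<and> (\<Prod>i\<in>A. indicator (S' i) (U i x)) \<le> (1::real)" for A S'
      by (rule AE_I2) (auto intro!: prod_nonneg prod_le_1 simp: indicator_def)
    have P_prod: "AE x in M. real_cond_exp M F (\<lambda>x. (\<Prod>i\<in>J. indicator (S i) (U i x)) * indicator S0 (U j x)) x
        = (\<Prod>i\<in>J. P i x) * real_cond_exp M F (\<lambda>x. indicator S0 (U j x)) x"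
      if S0: "S0 \<in> sets borel" for S0
    proof -
      define S' where "S' = S(j := S0)"
      have "\<forall>i\<in>I. S' i \<in> sets borel" using S S0 by (auto simp: S'_def)
      then have "AE x in M. real_cond_exp M F (\<lambda>x. \<Prod>i\<in>I. indicator (S' i) (U i x)) x
          = (\<Prod>i\<in>I. real_cond_exp M F (\<lambda>x. indicator (S' i) (U i x)) x)"
        using ind unfolding cond_indep_vars_def by blast
      moreover have "(\<Prod>i\<in>I. indicator (S' i) (U i x)) = (\<Prod>i\<in>J. indicator (S i) (U i x)) * (indicator S0 (U j x) :: real)" for x
        unfolding J(3)[symmetric] using J(1,2) by (auto simp: S'_def intro!: prod.cong)
      moreover have "(\<Prod>i\<in>I. real_cond_exp M F (\<lambda>x. indicator (S' i) (U i x)) x)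
          = (\<Prod>i\<in>J. P i x) * real_cond_exp M F (\<lambda>x. indicator S0 (U j x)) x" for x
        unfolding J(3)[symmetric] P_def using J(1,2) by (auto simp: S'_def intro!: prod.cong)
      ultimately show ?thesis by simp
    qed
    \<comment> \<open>The factor \<open>indicator B\<close> is \<open>F\<close>-measurable, so
      conditioning on \<open>F\<close> may act on the remaining product, which factorizes;
      conditioning is then undone on the last factor.\<close>
    have key: "expectation (\<lambda>x. ph x * indicator S0 (U j x)) = expectation (\<lambda>x. ps x * indicator S0 (U j x))"
      if S0 [measurable]: "S0 \<in> sets borel" for S0
    proof -
      have i0: "integrable M (\<lambda>x. indicator S0 (U j x) :: real)"
        by (rule integrable_const_bound[where B = 1]) auto
      have i1: "integrable M (\<lambda>x. (\<Prod>i\<in>J. indicator (S i) (U i x)) * indicator S0 (U j x) :: real)"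
        by (rule int_b[OF i0 _ prod_b]) (auto intro!: borel_measurable_prod ind_meas simp: J)
      have i2: "integrable M (\<lambda>x. indicator B x * ((\<Prod>i\<in>J. indicator (S i) (U i x)) * indicator S0 (U j x)) :: real)"
        by (rule int_b[OF i1]) (auto simp: indicator_def)
      have "expectation (\<lambda>x. ph x * indicator S0 (U j x))
          = expectation (\<lambda>x. indicator B x * ((\<Prod>i\<in>J. indicator (S i) (U i x)) * indicator S0 (U j x)))"
        by (simp add: ph_def mult.assoc)
      also have "\<dots> = expectation (\<lambda>x. indicator B x *
          real_cond_exp M F (\<lambda>x. (\<Prod>i\<in>J. indicator (S i) (U i x)) * indicator S0 (U j x)) x)"
        by (rule F.real_cond_exp_intg(2)[OF i2, symmetric]) (use i1 in auto)
      also have "\<dots> = expectation (\<lambda>x. ps x * real_cond_exp M F (\<lambda>x. indicator S0 (U j x)) x)"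
      proof (rule integral_cong_AE)
        show "AE x in M. indicator B x *
          real_cond_exp M F (\<lambda>x. (\<Prod>i\<in>J. indicator (S i) (U i x)) * indicator S0 (U j x)) x
          = ps x * real_cond_exp M F (\<lambda>x. indicator S0 (U j x)) x"
          using P_prod[OF S0] by eventually_elim (simp add: ps_def)
      qed auto
      also have "\<dots> = expectation (\<lambda>x. ps x * indicator S0 (U j x))"
        by (rule F.real_cond_exp_intg(2)) (use int_b[OF i0 ps_M ps_b] in auto)
      finally show ?thesis .
    qed
    \<comment> \<open>By \<open>key\<close>, the laws of \<open>U j\<close> under the densities
      \<open>ph\<close> and \<open>ps\<close> agree on Borel sets. Equal laws integrate
      \<open>f\<close> equally, so no approximation of an unbounded \<open>f\<close> by simple
      functions is needed.\<close>
    let ?m1 = "distr (density M (\<lambda>x. ennreal (ph x))) borel (U j)"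
    let ?m2 = "distr (density M (\<lambda>x. ennreal (ps x))) borel (U j)"
    have em: "emeasure (distr (density M (\<lambda>x. ennreal (h x))) borel (U j)) A = ennreal (expectation (\<lambda>x. h x * indicator A (U j x)))"
      if [measurable]: "A \<in> sets borel" "h \<in> borel_measurable M" and h: "AE x in M. 0 \<le> h x \<and> h x \<le> 1" for A and h :: "'a \<Rightarrow> real"
    proof -
      have i0: "integrable M (\<lambda>x. indicator A (U j x) :: real)"
        by (rule integrable_const_bound[where B = 1]) auto
      have "emeasure (distr (density M (\<lambda>x. ennreal (h x))) borel (U j)) A
          = (\<integral>\<^sup>+x. ennreal (h x) * indicator (U j -` A \<inter> space M) x \<partial>M)"
        by (subst emeasure_distr) (auto simp: emeasure_density)
      also have "\<dots> = (\<integral>\<^sup>+x. ennreal (h x * indicator A (U j x)) \<partial>M)"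
        by (rule nn_integral_cong) (auto simp: indicator_def)
      also have "\<dots> = ennreal (expectation (\<lambda>x. h x * indicator A (U j x)))"
        using h by (intro nn_integral_eq_integral int_b[OF i0]) (auto simp: indicator_def elim!: eventually_mono)
      finally show ?thesis .
    qed
    have ph_b': "AE x in M. 0 \<le> ph x \<and> ph x \<le> 1" using ph_b by simp
    have "?m1 = ?m2"
      by (rule measure_eqI) (simp_all add: em[OF _ ph_M ph_b'] em[OF _ ps_M ps_b] key)
    then have "integral\<^sup>L ?m1 f = integral\<^sup>L ?m2 f" by simp
    moreover have "integral\<^sup>L ?m1 f = expectation (\<lambda>x. ph x * f (U j x))"
      using ph_b' by (subst integral_distr; simp) (subst integral_density; auto elim!: eventually_mono)
    moreover have "integral\<^sup>L ?m2 f = expectation (\<lambda>x. ps x * f (U j x))"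
      using ps_b by (subst integral_distr; simp) (subst integral_density; auto elim!: eventually_mono)
    ultimately have 1: "expectation (\<lambda>x. ph x * f (U j x)) = expectation (\<lambda>x. ps x * f (U j x))" by simp
    have 2: "expectation (\<lambda>x. ps x * f (U j x)) = expectation (\<lambda>x. ps x * g x)"
      unfolding g_def by (rule F.real_cond_exp_intg(2)[symmetric]) (use int_b[OF int ps_M ps_b] in auto)
    have i1: "integrable M (\<lambda>x. (\<Prod>i\<in>J. indicator (S i) (U i x)) * g x :: real)"
      by (rule int_b[OF gint _ prod_b]) (auto intro!: borel_measurable_prod ind_meas simp: J)
    have i2: "integrable M (\<lambda>x. indicator B x * ((\<Prod>i\<in>J. indicator (S i) (U i x)) * g x) :: real)"
      by (rule int_b[OF i1]) (auto simp: indicator_def)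
    \<comment> \<open>Since \<open>g\<close> is \<open>F\<close>-measurable, only the cylinder
      factors are conditioned; the product formula with the whole line at index \<open>j\<close>
      gives their conditional expectation.\<close>
    have "expectation (\<lambda>x. ph x * g x) = expectation (\<lambda>x. (indicator B x * g x) * (\<Prod>i\<in>J. indicator (S i) (U i x)))"
      by (simp add: ph_def mult_ac)
    also have "\<dots> = expectation (\<lambda>x. (indicator B x * g x) * real_cond_exp M F (\<lambda>x. \<Prod>i\<in>J. indicator (S i) (U i x)) x)"
      by (rule F.real_cond_exp_intg(2)[symmetric])
         (use i2 in \<open>auto simp: mult_ac intro!: borel_measurable_prod ind_meas J\<close>)
    also have "\<dots> = expectation (\<lambda>x. ps x * g x)"
    proof (rule integral_cong_AE)
      have "AE x in M. real_cond_exp M F (\<lambda>x. 1) x = 1" by (rule F.real_cond_exp_F_meas) auto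
      then show "AE x in M. (indicator B x * g x) * real_cond_exp M F (\<lambda>x. \<Prod>i\<in>J. indicator (S i) (U i x)) x = ps x * g x"
        using P_prod[of UNIV, simplified] by eventually_elim (simp add: ps_def)
    qed auto
    finally have 3: "expectation (\<lambda>x. ph x * g x) = expectation (\<lambda>x. ps x * g x)" .
    have "(LINT x:C|M. k x) = expectation (\<lambda>x. ph x * k x)" for k :: "'a \<Rightarrow> real"
      unfolding set_lebesgue_integral_def by (rule Bochner_Integration.integral_cong) (auto simp: ph_C)
    then show ?thesis using 1 2 3 by simp
  qed
  have "(LINT x:A|M. f (U j x)) = (LINT x:A|M. g x)" if A: "A \<in> sets ?H" for A
  proof -
    have GM: "A \<in> sets M" if "A \<in> sigma_sets (space M) ?G" for A
      using that H unfolding subalgebra_def sets_H by auto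
    have stable: "Int_stable ?G"
    proof (rule Int_stableI)
      fix a b assume "a \<in> ?G" "b \<in> ?G"
      then obtain B S B' S' where *: "B \<in> sets F" "\<forall>i. S i \<in> sets borel" "B' \<in> sets F" "\<forall>i. S' i \<in> sets borel"
        "a = B \<inter> {x \<in> space M. \<forall>i\<in>J. U i x \<in> S i}" "b = B' \<inter> {x \<in> space M. \<forall>i\<in>J. U i x \<in> S' i}" by blast
      have "a \<inter> b = (B \<inter> B') \<inter> {x \<in> space M. \<forall>i\<in>J. U i x \<in> S i \<inter> S' i}" using * by auto
      then show "a \<inter> b \<in> ?G" using * by (intro CollectI exI[of _ "B \<inter> B'"] exI[of _ "\<lambda>i. S i \<inter> S' i"]) auto
    qed
    have Gp: "?G \<subseteq> Pow (space M)" using FM sets.sets_into_space by blast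
    have top: "space M \<in> ?G"
      using sets.top[of F] FM by (intro CollectI exI[of _ "space M"] exI[of _ "\<lambda>_. UNIV"]) auto
    have total: "expectation (\<lambda>x. f (U j x)) = expectation g"
      using base[OF top] by (simp add: set_integral_space int gint)
    have "A \<in> sigma_sets (space M) ?G" using A sets_H by auto
    then show ?thesis
    proof (induction rule: sigma_sets_induct_disjoint[OF stable Gp, consumes 1, case_names basic empty compl union])
      case (basic A) then show ?case by (rule base)
    next
      case empty then show ?case by (simp add: set_lebesgue_integral_def)
    next
      case (compl A)
      have [measurable]: "A \<in> sets M" using GM compl by auto
      have "(LINT x:(space M - A)|M. k x) = expectation k - (LINT x:A|M. k x)" if k: "integrable M k" for k :: "'a \<Rightarrow> real"
      proof -
        have "(LINT x:(space M - A)|M. k x) = expectation (\<lambda>x. k x - indicator A x * k x)"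
          unfolding set_lebesgue_integral_def
          by (rule Bochner_Integration.integral_cong) (auto simp: indicator_def)
        also have "\<dots> = expectation k - (LINT x:A|M. k x)"
          unfolding set_lebesgue_integral_def using integrable_mult_indicator[OF \<open>A \<in> sets M\<close> k] k by simp
        finally show ?thesis .
      qed
      then show ?case using compl int gint total by simp
    next
      case (union A)
      have AM: "A i \<in> sets M" for i using GM union by auto
      have un: "(LINT x:(\<Union>i. A i)|M. k x) = (\<Sum>i. LINT x:A i|M. k x)" if k: "integrable M k" for k :: "'a \<Rightarrow> real"
      proof (rule lebesgue_integral_countable_add[OF AM])
        show "A i \<inter> A j = {}" if "i \<noteq> j" for i j using union(1) that by (auto simp: disjoint_family_on_def)
        show "set_integrable M (\<Union>i. A i) k" unfolding set_integrable_def
          using AM by (intro integrable_mult_indicator k) auto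
      qed
      show ?case using union un[OF int] un[OF gint] by simp
    qed
  qed
  then have "AE x in M. real_cond_exp M ?H (\<lambda>x. f (U j x)) x = g x"
  proof (rule H.real_cond_exp_charact)
    show "g \<in> borel_measurable ?H"
      using gF HF by (rule measurable_from_subalg[rotated])
  qed (use int gint in auto)
  then show ?thesis unfolding g_def J_def .
qed

section \<open>Moments of noise sums\<close>

text \<open>The product is not known to be integrable beforehand, so \<open>f\<close> cannot be
  pulled out of the conditional expectation directly. The truncations min f n can, with a bound
  independent of n, and monotone convergence gives both claims.\<close>

lemma (in sigma_finite_subalgebra) integrable_mult_cond_exp_bounded:
  fixes f g :: "'a \<Rightarrow> real"
  assumes g: "integrable M g" "\<And>x. 0 \<le> g x" and f: "integrable M f" "\<And>x. 0 \<le> f x" "f \<in> borel_measurable F"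
    and K: "0 \<le> K" and bd: "AE x in M. f x \<noteq> 0 \<longrightarrow> real_cond_exp M F g x \<le> K"
  shows "integrable M (\<lambda>x. f x * g x)" "(\<integral>x. f x * g x \<partial>M) \<le> K * (\<integral>x. f x \<partial>M)"
proof -
  note [measurable] = f(3)
  have [measurable]: "g \<in> borel_measurable M" "f \<in> borel_measurable M" using g f by auto
  define u where "u n x = min (f x) (real n)" for n x
  have uF [measurable]: "u n \<in> borel_measurable F" for n unfolding u_def by simp
  have uM [measurable]: "u n \<in> borel_measurable M" for n unfolding u_def by simp
  have u: "0 \<le> u n x" "u n x \<le> f x" "u n x \<le> n" for n x using f(2)[of x] by (auto simp: u_def)
  have iug: "integrable M (\<lambda>x. u n x * g x)" for n
  proof (rule Bochner_Integration.integrable_bound)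
    show "integrable M (\<lambda>x. real n * g x)" using g by simp
    show "AE x in M. norm (u n x * g x) \<le> norm (real n * g x)"
      using u g(2) by (auto simp: abs_mult intro!: mult_right_mono)
  qed simp
  have iu: "integrable M (u n)" for n
    by (rule Bochner_Integration.integrable_bound[OF f(1)]) (use u f(2) in auto)
  have le: "(\<integral>x. u n x * g x \<partial>M) \<le> K * (\<integral>x. f x \<partial>M)" for n
  proof -
    have "(\<integral>x. u n x * g x \<partial>M) = (\<integral>x. u n x * real_cond_exp M F g x \<partial>M)"
      by (rule real_cond_exp_intg(2)[symmetric]) (use iug in auto)
    also have "\<dots> \<le> (\<integral>x. K * f x \<partial>M)"
    proof (rule integral_mono_AE)
      show "integrable M (\<lambda>x. u n x * real_cond_exp M F g x)" by (rule real_cond_exp_intg(1)) (use iug in auto)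
      show "AE x in M. u n x * real_cond_exp M F g x \<le> K * f x" using bd
      proof eventually_elim
        case (elim x)
        show ?case
        proof (cases "f x = 0")
          case True then show ?thesis using u[of n x] by simp
        next
          case False
          then have "u n x * real_cond_exp M F g x \<le> u n x * K" using elim u by (intro mult_left_mono) auto
          also have "\<dots> \<le> K * f x" using u[of n x] K by (simp add: mult.commute mult_left_mono)
          finally show ?thesis .
        qed
      qed
    qed (use f in auto)
    finally show ?thesis by simp
  qed
  have "(\<lambda>n. \<integral>\<^sup>+x. ennreal (u n x * g x) \<partial>M) \<longlonglongrightarrow> (\<integral>\<^sup>+x. ennreal (f x * g x) \<partial>M)"
  proof (rule nn_integral_LIMSEQ)
    show "incseq (\<lambda>n x. ennreal (u n x * g x))"
      unfolding incseq_def le_fun_def u_def using g(2) by (auto intro!: ennreal_leI mult_right_mono)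
    fix x
    have "u n x = f x" if "n \<ge> nat \<lceil>f x\<rceil>" for n using that unfolding u_def by linarith
    then have "\<forall>\<^sub>F n in sequentially. ennreal (u n x * g x) = ennreal (f x * g x)"
      unfolding eventually_sequentially by (intro exI[of _ "nat \<lceil>f x\<rceil>"]) auto
    then show "(\<lambda>n. ennreal (u n x * g x)) \<longlonglongrightarrow> ennreal (f x * g x)" by (rule tendsto_eventually)
  qed auto
  moreover have "(\<integral>\<^sup>+x. ennreal (u n x * g x) \<partial>M) \<le> ennreal (K * (\<integral>x. f x \<partial>M))" for n
    using le[of n] iug[of n] u(1) g(2) by (subst nn_integral_eq_integral) (auto intro!: ennreal_leI)
  ultimately have nn: "(\<integral>\<^sup>+x. ennreal (f x * g x) \<partial>M) \<le> ennreal (K * (\<integral>x. f x \<partial>M))"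
    by (intro LIMSEQ_le_const2) auto
  show "integrable M (\<lambda>x. f x * g x)"
    using nn f(2) g(2) by (intro integrableI_nonneg) (auto simp: top_unique less_top[symmetric])
  then have "ennreal (\<integral>x. f x * g x \<partial>M) \<le> ennreal (K * (\<integral>x. f x \<partial>M))"
    using nn f(2) g(2) by (subst (asm) nn_integral_eq_integral) auto
  then show "(\<integral>x. f x * g x \<partial>M) \<le> K * (\<integral>x. f x \<partial>M)"
    using K f by (subst (asm) ennreal_le_iff) auto
qed

lemma sum_power_four_le: "(x + y) ^ 4 \<le> 8 * (x ^ 4 + y ^ 4)" for x y :: real
proof -
  have sq: "(u + v)\<^sup>2 \<le> 2 * (u\<^sup>2 + v\<^sup>2)" for u v :: real
    using zero_le_power2[of "u - v"] by (simp add: power2_sum power2_diff)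
  have "(x + y) ^ 4 = ((x + y)\<^sup>2)\<^sup>2" by (simp add: power_mult[symmetric])
  also have "\<dots> \<le> (2 * (x\<^sup>2 + y\<^sup>2))\<^sup>2" by (intro power_mono sq) auto
  also have "\<dots> = 4 * (x\<^sup>2 + y\<^sup>2)\<^sup>2" unfolding power_mult_distrib by simp
  also have "\<dots> \<le> 4 * (2 * ((x\<^sup>2)\<^sup>2 + (y\<^sup>2)\<^sup>2))" by (intro mult_left_mono sq) auto
  also have "\<dots> = 8 * (x ^ 4 + y ^ 4)" by (simp add: power_mult[symmetric])
  finally show ?thesis .
qed

section \<open>Integrability of products and fourth powers\<close>

context prob_space begin

lemma integrable_square_of_fourth:
  fixes f :: "'a \<Rightarrow> real"
  assumes [measurable]: "f \<in> borel_measurable M" and "integrable M (\<lambda>x. f x ^ 4)"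
  shows "integrable M (\<lambda>x. (f x)\<^sup>2)"
  using integrable_mult_squares[of "\<lambda>x. 1" "\<lambda>x. (f x)\<^sup>2"] assms by (simp add: power_mult[symmetric])

lemma integrable_of_square:
  fixes f :: "'a \<Rightarrow> real"
  assumes [measurable]: "f \<in> borel_measurable M" and "integrable M (\<lambda>x. (f x)\<^sup>2)"
  shows "integrable M f"
  using integrable_mult_squares[of "\<lambda>x. 1" f] assms by simp

lemma integrable_square_mult:
  fixes f g :: "'a \<Rightarrow> real"
  assumes [measurable]: "f \<in> borel_measurable M" "g \<in> borel_measurable M"
    and "integrable M (\<lambda>x. f x ^ 4)" "integrable M (\<lambda>x. g x ^ 4)"
  shows "integrable M (\<lambda>x. (f x * g x)\<^sup>2)"
  using integrable_mult_squares[of "\<lambda>x. (f x)\<^sup>2" "\<lambda>x. (g x)\<^sup>2"] assms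
  by (simp add: power_mult[symmetric] power_mult_distrib)

lemma integrable_fourth_add:
  fixes f g :: "'a \<Rightarrow> real"
  assumes [measurable]: "f \<in> borel_measurable M" "g \<in> borel_measurable M"
    and "integrable M (\<lambda>x. f x ^ 4)" "integrable M (\<lambda>x. g x ^ 4)"
  shows "integrable M (\<lambda>x. (f x + g x) ^ 4)"
proof (rule Bochner_Integration.integrable_bound)
  show "integrable M (\<lambda>x. 8 * (f x ^ 4 + g x ^ 4))" using assms by auto
  show "AE x in M. norm ((f x + g x) ^ 4) \<le> norm (8 * (f x ^ 4 + g x ^ 4))"
    using sum_power_four_le by (simp add: zero_le_even_power)
qed simp

lemma integrable_fourth_sum:
  fixes f :: "'i \<Rightarrow> 'a \<Rightarrow> real"
  assumes "\<And>i. i \<in> I \<Longrightarrow> f i \<in> borel_measurable M" "\<And>i. i \<in> I \<Longrightarrow> integrable M (\<lambda>x. f i x ^ 4)"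
  shows "integrable M (\<lambda>x. (\<Sum>i\<in>I. f i x) ^ 4)"
  using assms
  by (induction I rule: infinite_finite_induct)
     (simp_all add: integrable_fourth_add borel_measurable_sum)

end

text \<open>
  \<open>V\<close> is the noise of one generation and \<open>F\<close> the past; the weights multiplying the noise are
  \<open>F\<close>-measurable and supported where the conditional fourth moments are at most \<open>K\<close>.
\<close>

locale noise_block = prob_space M for M :: "'a measure" +
  fixes F :: "'a measure" and V :: "'i \<Rightarrow> 'a \<Rightarrow> real" and I :: "'i set" and s K :: real
  assumes subalg: "subalgebra M F" and finite_I: "finite I"
    and V_meas: "\<And>i. i \<in> I \<Longrightarrow> V i \<in> borel_measurable M"
    and V_indep: "cond_indep_vars M F borel V I"
    and V_fourth: "\<And>i. i \<in> I \<Longrightarrow> integrable M (\<lambda>x. V i x ^ 4)"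
    and V_mean: "\<And>i. i \<in> I \<Longrightarrow> AE x in M. real_cond_exp M F (V i) x = 0"
    and V_var: "\<And>i. i \<in> I \<Longrightarrow> AE x in M. real_cond_exp M F (\<lambda>x. (V i x)\<^sup>2) x = s"
    and s_pos: "0 < s" and K_nonneg: "0 \<le> K"
begin

text \<open>The past together with all noise variables of the block except number \<open>j\<close>.
  Moments of \<open>V j\<close> given this larger sigma-algebra are the same as given
  \<open>F\<close>.\<close>

definition H :: "'i \<Rightarrow> 'a measure" where "H j = cylinder_algebra M F V (I - {j})"

definition weight :: "'i \<Rightarrow> ('a \<Rightarrow> real) \<Rightarrow> bool" where
  "weight i c \<longleftrightarrow> c \<in> borel_measurable F \<and> integrable M (\<lambda>x. c x ^ 4) \<and>
     (AE x in M. c x \<noteq> 0 \<longrightarrow> real_cond_exp M F (\<lambda>x. V i x ^ 4) x \<le> K)"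

lemma F_to_M: "f \<in> borel_measurable F \<Longrightarrow> f \<in> borel_measurable M" for f :: "'a \<Rightarrow> real"
  by (rule measurable_from_subalg[OF subalg])

lemma weightD:
  assumes "weight i c"
  shows "c \<in> borel_measurable F" "c \<in> borel_measurable M" "integrable M (\<lambda>x. c x ^ 4)"
  using assms F_to_M[of c] unfolding weight_def by blast+

lemma H_subalg: "subalgebra M (H j)"
  unfolding H_def by (rule subalgebra_cylinder_algebra[OF subalg]) (use finite_I V_meas in auto)

lemma F_to_H: "f \<in> borel_measurable F \<Longrightarrow> f \<in> borel_measurable (H j)" for f :: "'a \<Rightarrow> real"
  unfolding H_def
  by (rule measurable_from_subalg[OF cylinder_algebra_base[OF subalg]]) (use finite_I V_meas in auto)

lemma V_H: "i \<in> I \<Longrightarrow> i \<noteq> j \<Longrightarrow> V i \<in> borel_measurable (H j)"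
  unfolding H_def by (rule cylinder_algebra_measurable[OF subalg]) (use finite_I V_meas in auto)

lemma H_to_M: "f \<in> borel_measurable (H j) \<Longrightarrow> f \<in> borel_measurable M" for f :: "'a \<Rightarrow> real"
  by (rule measurable_from_subalg[OF H_subalg])

lemma H_finite: "finite_measure_subalgebra M (H j)"
  by (simp add: finite_measure_subalgebra_def finite_measure_subalgebra_axioms_def H_subalg finite_measure_axioms)

lemma F_finite: "finite_measure_subalgebra M F"
  by (simp add: finite_measure_subalgebra_def finite_measure_subalgebra_axioms_def subalg finite_measure_axioms)

sublocale F: finite_measure_subalgebra M F by (rule F_finite)

lemma V_int: assumes "i \<in> I" shows "integrable M (V i)" "integrable M (\<lambda>x. (V i x)\<^sup>2)"
  using integrable_square_of_fourth[OF V_meas V_fourth] integrable_of_square[OF V_meas] assms by auto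

lemma H_cond_exp:
  assumes "j \<in> I" "f \<in> borel_measurable borel" "integrable M (\<lambda>x. f (V j x))"
  shows "AE x in M. real_cond_exp M (H j) (\<lambda>x. f (V j x)) x = real_cond_exp M F (\<lambda>x. f (V j x)) x"
  unfolding H_def
  by (rule cond_indep_vars_cond_exp[OF prob_space_axioms subalg finite_I _ _ V_indep]) (use assms V_meas in auto)

text \<open>A function of \<open>V j\<close> whose conditional expectation given \<open>F\<close> is
  constant decouples from everything measurable with respect to \<open>H j\<close>. Integrability is
  required of the product alone; that of \<open>c * h\<close> is a conclusion.\<close>

lemma expectation_mult_const_cond_exp:
  fixes f :: "real \<Rightarrow> real"
  assumes j: "j \<in> I" and f: "f \<in> borel_measurable borel" "integrable M (\<lambda>x. f (V j x))"
    and c: "AE x in M. real_cond_exp M F (\<lambda>x. f (V j x)) x = c"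
    and h: "h \<in> borel_measurable (H j)" and int: "integrable M (\<lambda>x. f (V j x) * h x)"
  shows "integrable M (\<lambda>x. c * h x)" "expectation (\<lambda>x. f (V j x) * h x) = c * expectation h"
proof -
  interpret H: finite_measure_subalgebra M "H j" by (rule H_finite)
  have hM [measurable]: "h \<in> borel_measurable M" using h by (rule H_to_M)
  have [measurable]: "V j \<in> borel_measurable M" using V_meas j by auto
  note [measurable] = f(1)
  have int': "integrable M (\<lambda>x. h x * f (V j x))" using int by (simp add: mult.commute)
  have AE: "AE x in M. h x * real_cond_exp M (H j) (\<lambda>x. f (V j x)) x = c * h x"
    using H_cond_exp[OF j f] c by eventually_elim simp
  have "integrable M (\<lambda>x. h x * real_cond_exp M (H j) (\<lambda>x. f (V j x)) x)"
    by (rule H.real_cond_exp_intg(1)[OF int' h]) simp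
  then show "integrable M (\<lambda>x. c * h x)"
    by (rule integrable_cong_AE_imp) (use AE in auto)
  have "expectation (\<lambda>x. f (V j x) * h x) = expectation (\<lambda>x. h x * real_cond_exp M (H j) (\<lambda>x. f (V j x)) x)"
    by (subst H.real_cond_exp_intg(2)[OF int' h]) (auto simp: mult.commute)
  also have "\<dots> = expectation (\<lambda>x. c * h x)" using AE by (intro integral_cong_AE) auto
  finally show "expectation (\<lambda>x. f (V j x) * h x) = c * expectation h" by simp
qed

lemma expectation_V_mult:
  assumes "j \<in> I" "h \<in> borel_measurable (H j)" "integrable M (\<lambda>x. V j x * h x)"
  shows "expectation (\<lambda>x. V j x * h x) = 0"
  using expectation_mult_const_cond_exp(2)[of j "\<lambda>x. x" 0 h] assms V_mean V_int by simp

text \<open>As s > 0, integrability of s h, which the decoupling provides, yields that of h.\<close>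

lemma expectation_V_square_mult:
  assumes "j \<in> I" "h \<in> borel_measurable (H j)" "integrable M (\<lambda>x. (V j x)\<^sup>2 * h x)"
  shows "integrable M h" "expectation (\<lambda>x. (V j x)\<^sup>2 * h x) = s * expectation h"
  using expectation_mult_const_cond_exp[of j "\<lambda>x. x\<^sup>2" s h] assms V_var V_int s_pos
  by simp_all

lemma weight_fourth:
  assumes j: "j \<in> I" and c: "weight j c"
  shows "integrable M (\<lambda>x. (V j x * c x) ^ 4)"
    "expectation (\<lambda>x. (V j x * c x) ^ 4) \<le> K * expectation (\<lambda>x. c x ^ 4)"
proof -
  have "(\<lambda>x. c x ^ 4) \<in> borel_measurable F" using weightD(1)[OF c] by simp
  then show "integrable M (\<lambda>x. (V j x * c x) ^ 4)"
    "expectation (\<lambda>x. (V j x * c x) ^ 4) \<le> K * expectation (\<lambda>x. c x ^ 4)"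
    using F.integrable_mult_cond_exp_bounded[where g = "\<lambda>x. V j x ^ 4" and f = "\<lambda>x. c x ^ 4" and K = K]
      V_fourth[OF j] c K_nonneg
    by (simp_all add: weight_def power_mult_distrib mult.commute zero_le_even_power)
qed

lemma expectation_sum_square:
  fixes f :: "real \<Rightarrow> real"
  assumes J: "J \<subseteq> I" and f [measurable]: "f \<in> borel_measurable borel"
    and int: "\<And>j. j \<in> J \<Longrightarrow> integrable M (\<lambda>x. f (V j x))"
    and mean: "\<And>j. j \<in> J \<Longrightarrow> AE x in M. real_cond_exp M F (\<lambda>x. f (V j x)) x = 0"
    and c: "\<And>j. j \<in> J \<Longrightarrow> c j \<in> borel_measurable F"
    and sq: "\<And>j. j \<in> J \<Longrightarrow> integrable M (\<lambda>x. (f (V j x) * c j x)\<^sup>2)"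
  shows "integrable M (\<lambda>x. (\<Sum>j\<in>J. f (V j x) * c j x)\<^sup>2)"
    "expectation (\<lambda>x. (\<Sum>j\<in>J. f (V j x) * c j x)\<^sup>2) = (\<Sum>j\<in>J. expectation (\<lambda>x. (f (V j x) * c j x)\<^sup>2))"
proof -
  have VM: "V j \<in> borel_measurable M" if "j \<in> J" for j using V_meas J that by auto
  have m: "(\<lambda>x. f (V j x) * c j x) \<in> borel_measurable M" if "j \<in> J" for j
    using measurable_compose[OF VM[OF that] f] F_to_M[OF c[OF that]] by simp
  show "integrable M (\<lambda>x. (\<Sum>j\<in>J. f (V j x) * c j x)\<^sup>2)"
    by (rule integrable_sum_squared) (use m sq in auto)
  show "expectation (\<lambda>x. (\<Sum>j\<in>J. f (V j x) * c j x)\<^sup>2) = (\<Sum>j\<in>J. expectation (\<lambda>x. (f (V j x) * c j x)\<^sup>2))"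
  proof (rule expectation_sum_orthogonal)
    show "finite J" using J finite_I by (rule finite_subset)
    fix i j assume ij: "i \<in> J" "j \<in> J" "i \<noteq> j"
    let ?h = "\<lambda>x. c j x * (f (V i x) * c i x)"
    have h: "?h \<in> borel_measurable (H j)"
      using F_to_H[OF c[OF ij(1)]] F_to_H[OF c[OF ij(2)]] measurable_compose[OF V_H[of i j] f] ij J by auto
    have "integrable M (\<lambda>x. (f (V i x) * c i x) * (f (V j x) * c j x))"
      by (rule integrable_mult_squares) (use m sq ij in auto)
    then have i: "integrable M (\<lambda>x. f (V j x) * ?h x)" by (simp add: mult_ac)
    have "expectation (\<lambda>x. (f (V i x) * c i x) * (f (V j x) * c j x)) = expectation (\<lambda>x. f (V j x) * ?h x)"
      by (simp add: mult_ac)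
    also have "\<dots> = 0"
      using expectation_mult_const_cond_exp(2)[OF _ f int[OF ij(2)] mean[OF ij(2)] h i] ij J by auto
    finally show "expectation (\<lambda>x. (f (V i x) * c i x) * (f (V j x) * c j x)) = 0" .
  qed (use m sq in auto)
qed

text \<open>Induction on the number of terms, adding y = V c to the sum S of the others. The term
  S^3 y has mean 0, S^2 y^2 contributes at most s^2 C per earlier summand and y^4 at most K C; a
  linear increment gives the quadratic growth in the number of terms.\<close>

lemma expectation_sum_fourth:
  assumes J: "J \<subseteq> I" and c: "\<And>j. j \<in> J \<Longrightarrow> weight j (c j)"
    and C: "\<And>j. j \<in> J \<Longrightarrow> expectation (\<lambda>x. c j x ^ 4) \<le> C" "0 \<le> C"
  shows "integrable M (\<lambda>x. (\<Sum>j\<in>J. V j x * c j x) ^ 4)"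
    "expectation (\<lambda>x. (\<Sum>j\<in>J. V j x * c j x) ^ 4) \<le> (8 * s\<^sup>2 + 3 * K) * C * (real (card J))\<^sup>2"
proof -
  have VM: "V j \<in> borel_measurable M" if "j \<in> J" for j using V_meas J that by auto
  have m: "(\<lambda>x. V j x * c j x) \<in> borel_measurable M" if "j \<in> J" for j
    using VM[OF that] weightD(2)[OF c[OF that]] by simp
  show "integrable M (\<lambda>x. (\<Sum>j\<in>J. V j x * c j x) ^ 4)"
    by (rule integrable_fourth_sum) (use m weight_fourth c J in auto)
  have "finite J" using J finite_I by (rule finite_subset)
  then show "expectation (\<lambda>x. (\<Sum>j\<in>J. V j x * c j x) ^ 4) \<le> (8 * s\<^sup>2 + 3 * K) * C * (real (card J))\<^sup>2"
    using J c C(1)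
  proof (induction J)
    case empty then show ?case by simp
  next
    case (insert j J)
    have j: "j \<in> I" "J \<subseteq> I" "j \<notin> J" using insert by auto
    have w: "weight i (c i)" if "i \<in> J" for i using insert that by auto
    have wj: "weight j (c j)" using insert by auto
    have mM: "(\<lambda>x. V i x * c i x) \<in> borel_measurable M" if "i \<in> insert j J" for i
      using V_meas[of i] weightD(2)[of i "c i"] insert that by auto
    define S where "S x = (\<Sum>i\<in>J. V i x * c i x)" for x
    define y where "y x = V j x * c j x" for x
    have SH: "S \<in> borel_measurable (H j)" unfolding S_def
    proof (rule borel_measurable_sum)
      fix i assume i: "i \<in> J"
      then have "V i \<in> borel_measurable (H j)" using j by (intro V_H) auto
      moreover have "c i \<in> borel_measurable (H j)" using weightD(1)[OF w[OF i]] by (rule F_to_H)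
      ultimately show "(\<lambda>x. V i x * c i x) \<in> borel_measurable (H j)" by simp
    qed
    have cH: "c j \<in> borel_measurable (H j)" using weightD(1)[OF wj] by (rule F_to_H)
    have [measurable]: "S \<in> borel_measurable M" using SH by (rule H_to_M)
    have [measurable]: "y \<in> borel_measurable M" unfolding y_def using mM by auto
    have S4: "integrable M (\<lambda>x. S x ^ 4)" unfolding S_def
      by (rule integrable_fourth_sum) (use mM w weight_fourth j in auto)
    have y4: "integrable M (\<lambda>x. y x ^ 4)" unfolding y_def using weight_fourth(1)[OF j(1) wj] .
    have S2y2: "integrable M (\<lambda>x. (S x * y x)\<^sup>2)" by (rule integrable_square_mult) (use S4 y4 in auto)
    have S2: "integrable M (\<lambda>x. (S x)\<^sup>2)" by (rule integrable_square_of_fourth) (use S4 in auto)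
    have SS4: "integrable M (\<lambda>x. ((S x)\<^sup>2)\<^sup>2)" using S4 by (simp add: power_mult[symmetric])
    have S3y: "integrable M (\<lambda>x. (S x)\<^sup>2 * (S x * y x))"
      by (rule integrable_mult_squares) (use SS4 S2y2 in auto)
    \<comment> \<open>The factor S^3 c of \<open>V j\<close> involves only the other noise variables
      and the past.\<close>
    have z: "expectation (\<lambda>x. (S x)\<^sup>2 * (S x * y x)) = 0"
    proof -
      have "expectation (\<lambda>x. V j x * ((S x) ^ 3 * c j x)) = 0"
      proof (rule expectation_V_mult[OF j(1)])
        show "integrable M (\<lambda>x. V j x * ((S x) ^ 3 * c j x))"
          using S3y by (simp add: y_def power2_eq_square power3_eq_cube mult_ac)
      qed (use SH cH in auto)
      then show ?thesis by (simp add: y_def power2_eq_square power3_eq_cube mult_ac)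
    qed
    \<comment> \<open>Two uses of the conditional variance: one takes \<open>V j\<close> out, the
      other takes out each \<open>V i\<close> after the square of the sum has been reduced to its
      diagonal. The remaining (c_i c_j)^2 is at most the mean of the fourth powers.\<close>
    have cross: "expectation (\<lambda>x. (S x * y x)\<^sup>2) \<le> s\<^sup>2 * real (card J) * C"
    proof -
      have cM: "c i \<in> borel_measurable M" "integrable M (\<lambda>x. c i x ^ 4)" if "i \<in> insert j J" for i
        using weightD[of i "c i"] insert that by auto
      have "expectation (\<lambda>x. (S x * y x)\<^sup>2) = expectation (\<lambda>x. (V j x)\<^sup>2 * (S x * c j x)\<^sup>2)"
        by (simp add: y_def power_mult_distrib mult_ac)
      also have "\<dots> = s * expectation (\<lambda>x. (S x * c j x)\<^sup>2)"
        using S2y2 SH cH by (intro expectation_V_square_mult(2) j) (auto simp: y_def power_mult_distrib mult_ac)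
      also have "expectation (\<lambda>x. (S x * c j x)\<^sup>2) = expectation (\<lambda>x. (\<Sum>i\<in>J. V i x * (c i x * c j x))\<^sup>2)"
        unfolding S_def by (simp add: sum_distrib_right mult.assoc)
      also have "\<dots> = (\<Sum>i\<in>J. expectation (\<lambda>x. (V i x * (c i x * c j x))\<^sup>2))"
      proof (rule expectation_sum_square(2)[where f = "\<lambda>x. x"])
        fix i assume i: "i \<in> J"
        then have iI: "i \<in> I" using j by auto
        show "integrable M (V i)" using V_int iI by auto
        show "AE x in M. real_cond_exp M F (V i) x = 0" using V_mean iI by auto
        show "(\<lambda>x. c i x * c j x) \<in> borel_measurable F" using weightD(1)[OF w[OF i]] weightD(1)[OF wj] by simp
        have "integrable M (\<lambda>x. (V i x * c i x * c j x)\<^sup>2)"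
          by (rule integrable_square_mult) (use cM mM i wj weight_fourth(1)[OF iI w[OF i]] in auto)
        then show "integrable M (\<lambda>x. (V i x * (c i x * c j x))\<^sup>2)" by (simp add: mult.assoc)
      qed (use j in auto)
      also have "\<dots> \<le> (\<Sum>i\<in>J. s * C)"
      proof (rule sum_mono)
        fix i assume i: "i \<in> J"
        then have iI: "i \<in> I" using j by auto
        have int: "integrable M (\<lambda>x. (c i x * c j x)\<^sup>2)"
          by (rule integrable_square_mult) (use cM i in auto)
        have "integrable M (\<lambda>x. (V i x * c i x * c j x)\<^sup>2)"
          by (rule integrable_square_mult) (use cM mM i wj weight_fourth(1)[OF iI w[OF i]] in auto)
        then have "expectation (\<lambda>x. (V i x * (c i x * c j x))\<^sup>2) = s * expectation (\<lambda>x. (c i x * c j x)\<^sup>2)"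
          using expectation_V_square_mult(2)[OF iI, of "\<lambda>x. (c i x * c j x)\<^sup>2"] F_to_H[OF weightD(1)[OF w[OF i]]]
            F_to_H[OF weightD(1)[OF wj]] by (simp add: power_mult_distrib mult_ac)
        also have "expectation (\<lambda>x. (c i x * c j x)\<^sup>2) \<le> expectation (\<lambda>x. (c i x ^ 4 + c j x ^ 4) / 2)"
        proof (rule integral_mono[OF int])
          fix x
          show "(c i x * c j x)\<^sup>2 \<le> (c i x ^ 4 + c j x ^ 4) / 2"
            using zero_le_power2[of "(c i x)\<^sup>2 - (c j x)\<^sup>2"]
            by (simp add: power2_diff power_mult[symmetric] power_mult_distrib)
        qed (use cM i in auto)
        also have "\<dots> = (expectation (\<lambda>x. c i x ^ 4) + expectation (\<lambda>x. c j x ^ 4)) / 2"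
          using cM i by simp
        also have "\<dots> \<le> C" using insert.prems(3)[of i] insert.prems(3)[of j] i by simp
        finally show "expectation (\<lambda>x. (V i x * (c i x * c j x))\<^sup>2) \<le> s * C" using s_pos by simp
      qed
      finally show ?thesis using s_pos by (simp add: power2_eq_square mult_ac)
    qed
    have ey4: "expectation (\<lambda>x. y x ^ 4) \<le> K * C"
      unfolding y_def using weight_fourth(2)[OF j(1) wj] insert.prems(3)[of j] K_nonneg
      by (meson insertI1 mult_left_mono order_trans)
    have "expectation (\<lambda>x. (\<Sum>i\<in>insert j J. V i x * c i x) ^ 4) = expectation (\<lambda>x. (S x + y x) ^ 4)"
      using insert by (simp add: S_def y_def add.commute)
    \<comment> \<open>The term 4 S y^3 is absorbed by 2 S^2 y^2 + 2 y^4, the slack being 2 (S y -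
      y^2)^2; this turns the binomial coefficients 6 and 1 into 8 and 3.\<close>
    also have "\<dots> \<le> expectation (\<lambda>x. S x ^ 4 + 4 * ((S x)\<^sup>2 * (S x * y x)) + 8 * (S x * y x)\<^sup>2 + 3 * y x ^ 4)"
    proof (rule integral_mono)
      show "integrable M (\<lambda>x. (S x + y x) ^ 4)" by (rule integrable_fourth_add) (use S4 y4 in auto)
      fix x
      have "(S x + y x) ^ 4 = S x ^ 4 + 4 * ((S x)\<^sup>2 * (S x * y x)) + 8 * (S x * y x)\<^sup>2 + 3 * y x ^ 4
          - 2 * (S x * y x - (y x)\<^sup>2)\<^sup>2"
        by (simp add: power4_eq_xxxx power2_eq_square algebra_simps)
      then show "(S x + y x) ^ 4 \<le> S x ^ 4 + 4 * ((S x)\<^sup>2 * (S x * y x)) + 8 * (S x * y x)\<^sup>2 + 3 * y x ^ 4"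
        using zero_le_power2[of "S x * y x - (y x)\<^sup>2"] by linarith
    qed (use S4 S3y S2y2 y4 in auto)
    also have "\<dots> = expectation (\<lambda>x. S x ^ 4) + 8 * expectation (\<lambda>x. (S x * y x)\<^sup>2) + 3 * expectation (\<lambda>x. y x ^ 4)"
      using S4 S3y S2y2 y4 z by simp
    also have "\<dots> \<le> (8 * s\<^sup>2 + 3 * K) * C * (real (card J))\<^sup>2 + 8 * (s\<^sup>2 * real (card J) * C) + 3 * (K * C)"
      using insert.IH[OF j(2) w insert.prems(3)] cross ey4 unfolding S_def[symmetric]
      by (intro add_mono mult_left_mono) auto
    also have "\<dots> \<le> (8 * s\<^sup>2 + 3 * K) * C * (real (card J) + 1)\<^sup>2"
    proof -
      have "0 \<le> s\<^sup>2 * (C * real (card J))" "0 \<le> K * (C * real (card J))" "0 \<le> s\<^sup>2 * C"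
        using K_nonneg C(2) s_pos by auto
      then show ?thesis by (simp add: power2_sum algebra_simps)
    qed
    finally show ?case using insert by (simp add: add.commute)
  qed
qed

text \<open>Conditionally on \<open>F\<close>, the mixed products of two weighted noise sums vanish
  and the diagonal leaves s times the sum of the products of weights. Testing with an
  \<open>F\<close>-measurable \<open>g\<close> expresses this without forming the conditional
  expectation of the product.\<close>

lemma expectation_product_mult:
  assumes c: "\<And>j. j \<in> I \<Longrightarrow> weight j (c j)" and d: "\<And>j. j \<in> I \<Longrightarrow> weight j (d j)"
    and g: "g \<in> borel_measurable F" "integrable M (\<lambda>x. (g x)\<^sup>2)"
  shows "expectation (\<lambda>x. ((\<Sum>j\<in>I. V j x * c j x) * (\<Sum>j\<in>I. V j x * d j x) - s * (\<Sum>j\<in>I. c j x * d j x)) * g x) = 0"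
proof -
  have m: "(\<lambda>x. V j x * c j x) \<in> borel_measurable M" "(\<lambda>x. V j x * d j x) \<in> borel_measurable M" if "j \<in> I" for j
    using V_meas[OF that] weightD(2)[OF c[OF that]] weightD(2)[OF d[OF that]] by auto
  have gM: "g \<in> borel_measurable M" using g by (intro F_to_M)
  have i1: "integrable M (\<lambda>x. (V i x * c i x) * (V j x * d j x) * g x)" if "i \<in> I" "j \<in> I" for i j
    by (rule integrable_mult_squares[OF _ gM])
       (use that m g weight_fourth c d in \<open>auto intro!: integrable_square_mult\<close>)
  have i2: "integrable M (\<lambda>x. c j x * d j x * g x)" if "j \<in> I" for j
    by (rule integrable_mult_squares[OF _ gM])
       (use that m g weightD(2,3)[OF c[OF that]] weightD(2,3)[OF d[OF that]] in \<open>auto intro!: integrable_square_mult\<close>)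
  have e1: "expectation (\<lambda>x. (V i x * c i x) * (V j x * d j x) * g x)
      = (if i = j then s * expectation (\<lambda>x. c j x * d j x * g x) else 0)" if ij: "i \<in> I" "j \<in> I" for i j
  proof (cases "i = j")
    case True
    have eq: "(\<lambda>x. (V i x * c i x) * (V j x * d j x) * g x) = (\<lambda>x. (V j x)\<^sup>2 * (c j x * d j x * g x))"
      unfolding True power2_eq_square by (simp only: mult_ac)
    have "(\<lambda>x. c j x * d j x * g x) \<in> borel_measurable (H j)"
      using F_to_H[OF weightD(1)[OF c[OF ij(2)]]] F_to_H[OF weightD(1)[OF d[OF ij(2)]]] F_to_H[OF g(1)] by simp
    then show ?thesis
      unfolding eq using True expectation_V_square_mult(2)[OF ij(2)] i1[OF ij] unfolding eq by simp
  next
    case False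
    have "expectation (\<lambda>x. V j x * (V i x * c i x * d j x * g x)) = 0"
    proof (rule expectation_V_mult)
      show "(\<lambda>x. V i x * c i x * d j x * g x) \<in> borel_measurable (H j)"
        using V_H[of i j] F_to_H[OF weightD(1)[OF c[OF ij(1)]]] F_to_H[OF weightD(1)[OF d[OF ij(2)]]] F_to_H[OF g(1)] ij False
        by simp
    qed (use ij i1[OF ij] in \<open>auto simp: mult_ac\<close>)
    then show ?thesis using False by (simp add: mult_ac)
  qed
  have "expectation (\<lambda>x. ((\<Sum>j\<in>I. V j x * c j x) * (\<Sum>j\<in>I. V j x * d j x) - s * (\<Sum>j\<in>I. c j x * d j x)) * g x)
      = expectation (\<lambda>x. (\<Sum>i\<in>I. \<Sum>j\<in>I. (V i x * c i x) * (V j x * d j x) * g x) - s * (\<Sum>j\<in>I. c j x * d j x * g x))"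
  proof (rule arg_cong[where f = expectation], rule ext)
    fix x
    have "(\<Sum>j\<in>I. V j x * c j x) * (\<Sum>j\<in>I. V j x * d j x) * g x = (\<Sum>i\<in>I. \<Sum>j\<in>I. V i x * c i x * (V j x * d j x) * g x)"
      unfolding sum_product by (simp only: sum_distrib_right)
    moreover have "(\<Sum>j\<in>I. c j x * d j x) * g x = (\<Sum>j\<in>I. c j x * d j x * g x)" by (simp only: sum_distrib_right)
    ultimately show "((\<Sum>j\<in>I. V j x * c j x) * (\<Sum>j\<in>I. V j x * d j x) - s * (\<Sum>j\<in>I. c j x * d j x)) * g x
        = (\<Sum>i\<in>I. \<Sum>j\<in>I. V i x * c i x * (V j x * d j x) * g x) - s * (\<Sum>j\<in>I. c j x * d j x * g x)"
      by (simp only: left_diff_distrib mult.assoc[of s])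
  qed
  also have "\<dots> = expectation (\<lambda>x. \<Sum>i\<in>I. \<Sum>j\<in>I. (V i x * c i x) * (V j x * d j x) * g x)
      - expectation (\<lambda>x. s * (\<Sum>j\<in>I. c j x * d j x * g x))"
    by (intro Bochner_Integration.integral_diff integrable_mult_right Bochner_Integration.integrable_sum i1 i2)
  also have "expectation (\<lambda>x. s * (\<Sum>j\<in>I. c j x * d j x * g x)) = s * (\<Sum>j\<in>I. expectation (\<lambda>x. c j x * d j x * g x))"
    by (subst integral_mult_right_zero, subst Bochner_Integration.integral_sum[OF i2]) simp_all
  also have "expectation (\<lambda>x. \<Sum>i\<in>I. \<Sum>j\<in>I. (V i x * c i x) * (V j x * d j x) * g x)
      = (\<Sum>i\<in>I. \<Sum>j\<in>I. expectation (\<lambda>x. (V i x * c i x) * (V j x * d j x) * g x))"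
    by (subst Bochner_Integration.integral_sum, intro Bochner_Integration.integrable_sum i1, assumption+,
        rule sum.cong[OF refl], rule Bochner_Integration.integral_sum, rule i1)
  also have "\<dots> = (\<Sum>i\<in>I. \<Sum>j\<in>I. if i = j then s * expectation (\<lambda>x. c j x * d j x * g x) else 0)"
    by (intro sum.cong refl e1)
  also have "\<dots> = s * (\<Sum>j\<in>I. expectation (\<lambda>x. c j x * d j x * g x))"
    using finite_I by (simp add: sum_distrib_left)
  finally show ?thesis by simp
qed

text \<open>Integrability is asked of the summands multiplied by \<open>g\<close> and not of
  \<open>g\<close> squared, because \<open>g\<close> will be the product of a function with fourth
  moments and one with second moments only.\<close>

lemma expectation_sum_mult:
  assumes c: "\<And>j. j \<in> I \<Longrightarrow> c j \<in> borel_measurable F" and g: "g \<in> borel_measurable F"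
    and int: "\<And>j. j \<in> I \<Longrightarrow> integrable M (\<lambda>x. V j x * c j x * g x)"
  shows "expectation (\<lambda>x. (\<Sum>j\<in>I. V j x * c j x) * g x) = 0"
proof -
  have i1: "integrable M (\<lambda>x. V j x * (c j x * g x))" if j: "j \<in> I" for j
    using int[OF j] by (simp add: mult.assoc)
  have e: "expectation (\<lambda>x. V j x * (c j x * g x)) = 0" if j: "j \<in> I" for j
    by (rule expectation_V_mult[OF j F_to_H i1[OF j]]) (use c[OF j] g in auto)
  have "expectation (\<lambda>x. (\<Sum>j\<in>I. V j x * c j x) * g x) = (\<Sum>j\<in>I. expectation (\<lambda>x. V j x * (c j x * g x)))"
    using i1 by (simp add: sum_distrib_right Bochner_Integration.integral_sum mult.assoc)
  then show ?thesis using e by simp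
qed

text \<open>The variables V^2 - s are again conditionally centred and independent. For a weight with
  values 0 and 1, their weighted squares are at most (V w)^4 + s^2, so the localized fourth moments
  suffice.\<close>

lemma expectation_square_deviation:
  assumes w: "\<And>j. j \<in> I \<Longrightarrow> weight j w" and w01: "\<And>x. w x = 0 \<or> w x = 1"
  shows "integrable M (\<lambda>x. (\<Sum>j\<in>I. ((V j x)\<^sup>2 - s) * w x)\<^sup>2)"
    "expectation (\<lambda>x. (\<Sum>j\<in>I. ((V j x)\<^sup>2 - s) * w x)\<^sup>2) \<le> (K + s\<^sup>2) * real (card I)"
proof -
  let ?f = "\<lambda>v::real. v\<^sup>2 - s"
  have f: "?f \<in> borel_measurable borel" by simp
  have int: "integrable M (\<lambda>x. ?f (V j x))" if "j \<in> I" for j using V_int[OF that] by simp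
  have mean: "AE x in M. real_cond_exp M F (\<lambda>x. ?f (V j x)) x = 0" if j: "j \<in> I" for j
  proof -
    have "AE x in M. real_cond_exp M F (\<lambda>x. s) x = s" by (rule F.real_cond_exp_F_meas) auto
    moreover have "AE x in M. real_cond_exp M F (\<lambda>x. ?f (V j x)) x
        = real_cond_exp M F (\<lambda>x. (V j x)\<^sup>2) x - real_cond_exp M F (\<lambda>x. s) x"
      by (rule F.real_cond_exp_diff[OF V_int(2)[OF j]]) simp
    ultimately show ?thesis using V_var[OF j] by eventually_elim simp
  qed
  have bd: "(?f v * w x)\<^sup>2 \<le> (v * w x) ^ 4 + s\<^sup>2" for v x
    using w01[of x] s_pos by (auto simp: power2_diff power_mult[symmetric])
  have i4: "integrable M (\<lambda>x. (V j x * w x) ^ 4 + s\<^sup>2)" if "j \<in> I" for j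
    using weight_fourth(1)[OF that w[OF that]] by simp
  have m: "(\<lambda>x. (?f (V j x) * w x)\<^sup>2) \<in> borel_measurable M" if "j \<in> I" for j
    using V_meas[OF that] weightD(2)[OF w[OF that]] by simp
  have sq: "integrable M (\<lambda>x. (?f (V j x) * w x)\<^sup>2)" if "j \<in> I" for j
    by (rule Bochner_Integration.integrable_bound[OF i4[OF that] m[OF that]]) (use bd in \<open>auto simp: zero_le_even_power\<close>)
  note * = expectation_sum_square[OF order_refl f int mean weightD(1)[OF w] sq]
  show "integrable M (\<lambda>x. (\<Sum>j\<in>I. ((V j x)\<^sup>2 - s) * w x)\<^sup>2)" using *(1) by simp
  have "expectation (\<lambda>x. (?f (V j x) * w x)\<^sup>2) \<le> K + s\<^sup>2" if j: "j \<in> I" for j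
  proof -
    have "expectation (\<lambda>x. (?f (V j x) * w x)\<^sup>2) \<le> expectation (\<lambda>x. (V j x * w x) ^ 4 + s\<^sup>2)"
      by (rule integral_mono[OF sq[OF j] i4[OF j]]) (rule bd)
    also have "\<dots> \<le> K * expectation (\<lambda>x. w x ^ 4) + s\<^sup>2"
      using weight_fourth[OF j w[OF j]] by (simp add: prob_space)
    also have "expectation (\<lambda>x. w x ^ 4) \<le> expectation (\<lambda>x. 1)"
    proof (rule integral_mono)
      show "w x ^ 4 \<le> 1" for x using w01[of x] by auto
    qed (use weightD[OF w[OF j]] in auto)
    finally show ?thesis using K_nonneg by (simp add: prob_space mult_left_mono)
  qed
  then have "(\<Sum>j\<in>I. expectation (\<lambda>x. (?f (V j x) * w x)\<^sup>2)) \<le> (\<Sum>j\<in>I. K + s\<^sup>2)" by (rule sum_mono)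
  then show "expectation (\<lambda>x. (\<Sum>j\<in>I. ((V j x)\<^sup>2 - s) * w x)\<^sup>2) \<le> (K + s\<^sup>2) * real (card I)"
    using *(2) by (simp add: mult.commute)
qed

end

section \<open>Contracting pairs of matrices\<close>

lemma lincomb_sum_swap:
  fixes g x :: "nat \<Rightarrow> real"
  shows "(\<Sum>j<p. g j * (\<Sum>k<p. A j k * x k)) = (\<Sum>k<p. (\<Sum>j<p. A j k * g j) * x k)"
proof -
  have "(\<Sum>j<p. g j * (\<Sum>k<p. A j k * x k)) = (\<Sum>j<p. \<Sum>k<p. A j k * g j * x k)"
    by (simp add: sum_distrib_left mult_ac)
  also have "\<dots> = (\<Sum>k<p. \<Sum>j<p. A j k * g j * x k)" by (rule sum.swap)
  finally show ?thesis by (simp add: sum_distrib_right)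
qed

locale vec_norm =
  fixes p :: nat and N :: "real Matrix.vec \<Rightarrow> real"
  assumes p_pos: "1 \<le> p" and N: "is_norm p N"
begin

text \<open>The norm is moved to functions on the naturals, of which only the coordinates below
  \<open>p\<close> matter. Matrix products become finite sums, and compactness and measurability can
  be taken from the product topology.\<close>

definition nrm :: "(nat \<Rightarrow> real) \<Rightarrow> real" where "nrm x = N (Matrix.vec p x)"

lemma nrm_cong: "(\<And>i. i < p \<Longrightarrow> x i = y i) \<Longrightarrow> nrm x = nrm y"
  unfolding nrm_def by (rule arg_cong[where f = N]) (rule eq_vecI, auto)

lemma nrm_nonneg: "0 \<le> nrm x"
  using N by (auto simp: is_norm_def nrm_def)

lemma nrm_eq_0: "nrm x = 0 \<Longrightarrow> i < p \<Longrightarrow> x i = 0"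
proof -
  assume "nrm x = 0" "i < p"
  then have "Matrix.vec p x = 0\<^sub>v p" using N by (auto simp: is_norm_def nrm_def)
  then have "vec_index (Matrix.vec p x) i = vec_index (0\<^sub>v p) i" by simp
  then show "x i = 0" using \<open>i < p\<close> by simp
qed

lemma nrm_add: "nrm (\<lambda>i. x i + y i) \<le> nrm x + nrm y"
proof -
  have "Matrix.vec p (\<lambda>i. x i + y i) = Matrix.vec p x + Matrix.vec p y" by (rule eq_vecI) auto
  then show ?thesis using N by (auto simp: is_norm_def nrm_def)
qed

lemma nrm_scale: "nrm (\<lambda>i. c * x i) = \<bar>c\<bar> * nrm x"
proof -
  have "Matrix.vec p (\<lambda>i. c * x i) = c \<cdot>\<^sub>v Matrix.vec p x" by (rule eq_vecI) auto
  then show ?thesis using N by (auto simp: is_norm_def nrm_def)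
qed

definition unit_nrm :: "nat \<Rightarrow> real" where "unit_nrm i = nrm (\<lambda>j. if j = i then 1 else 0)"

lemma unit_nrm_nonneg: "0 \<le> unit_nrm i"
  unfolding unit_nrm_def by (rule nrm_nonneg)

lemma nrm_le_sum: "nrm x \<le> (\<Sum>i<p. \<bar>x i\<bar> * unit_nrm i)"
proof -
  have *: "nrm (\<lambda>i. if i \<in> J then x i else 0) \<le> (\<Sum>i\<in>J. \<bar>x i\<bar> * unit_nrm i)" if "finite J" for J
    using that
  proof (induction J)
    case empty
    show ?case using nrm_scale[of 0 "\<lambda>_. 0"] by simp
  next
    case (insert j J)
    have "nrm (\<lambda>i. if i \<in> insert j J then x i else 0)
        = nrm (\<lambda>i. x j * (if i = j then 1 else 0) + (if i \<in> J then x i else 0))"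
      using insert by (intro nrm_cong) auto
    also have "\<dots> \<le> \<bar>x j\<bar> * unit_nrm j + (\<Sum>i\<in>J. \<bar>x i\<bar> * unit_nrm i)"
      unfolding unit_nrm_def nrm_scale[symmetric]
      by (rule order_trans[OF nrm_add]) (use insert in \<open>simp add: unit_nrm_def nrm_scale\<close>)
    finally show ?case using insert by simp
  qed
  have "nrm x = nrm (\<lambda>i. if i \<in> {..<p} then x i else 0)" by (rule nrm_cong) auto
  then show ?thesis using *[of "{..<p}"] by simp
qed

lemma nrm_diff_le: "\<bar>nrm x - nrm y\<bar> \<le> nrm (\<lambda>i. x i - y i)"
proof -
  have "nrm x \<le> nrm (\<lambda>i. x i - y i) + nrm y" using nrm_add[of "\<lambda>i. x i - y i" y] by simp
  moreover have "nrm y \<le> nrm (\<lambda>i. y i - x i) + nrm x" using nrm_add[of "\<lambda>i. y i - x i" x] by simp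
  moreover have "nrm (\<lambda>i. y i - x i) = nrm (\<lambda>i. x i - y i)" using nrm_scale[of "-1" "\<lambda>i. x i - y i"] by simp
  ultimately show ?thesis by linarith
qed

lemma continuous_nrm: "continuous_on UNIV nrm"
proof -
  have "(nrm \<longlongrightarrow> nrm y) (at y)" for y
  proof -
    have le: "norm (nrm x - nrm y) \<le> (\<Sum>i<p. \<bar>x i - y i\<bar> * unit_nrm i)" for x
      using nrm_diff_le[of x y] nrm_le_sum[of "\<lambda>i. x i - y i"] by simp
    have c: "((\<lambda>x. x i) \<longlongrightarrow> y i) (at y)" for i
    proof -
      have "continuous_on UNIV (\<lambda>x :: nat \<Rightarrow> real. x i)" by (rule continuous_on_product_coordinates)
      then show ?thesis by (simp add: continuous_on_def)
    qed
    have "((\<lambda>x. \<Sum>i<p. \<bar>x i - y i\<bar> * unit_nrm i) \<longlongrightarrow> (\<Sum>i<p. \<bar>y i - y i\<bar> * unit_nrm i)) (at y)"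
      by (intro tendsto_sum tendsto_mult tendsto_rabs tendsto_diff tendsto_const c)
    then have "((\<lambda>x. \<Sum>i<p. \<bar>x i - y i\<bar> * unit_nrm i) \<longlongrightarrow> 0) (at y)" by simp
    then have "((\<lambda>x. nrm x - nrm y) \<longlongrightarrow> 0) (at y)"
      by (rule Lim_null_comparison[rotated]) (rule always_eventually, rule allI, rule le)
    then show ?thesis by (rule LIM_zero_cancel)
  qed
  then show ?thesis by (simp add: continuous_on_def)
qed

text \<open>\<open>N\<close> is an arbitrary norm, with no measurability given; it comes from
  continuity, after the irrelevant coordinates have been set to 0.\<close>

lemma nrm_measurable [measurable (raw)]:
  assumes "\<And>i. i < p \<Longrightarrow> (\<lambda>x. f x i) \<in> borel_measurable M"
  shows "(\<lambda>x. nrm (f x)) \<in> borel_measurable M"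
proof -
  have "(\<lambda>x i. if i < p then f x i else 0) \<in> borel_measurable M"
  proof (rule measurable_coordinatewise_then_product)
    show "(\<lambda>x. if i < p then f x i else 0) \<in> borel_measurable M" for i by (cases "i < p") (use assms in auto)
  qed
  then have "(\<lambda>x. nrm (\<lambda>i. if i < p then f x i else 0)) \<in> borel_measurable M"
    by (rule measurable_compose) (rule borel_measurable_continuous_onI[OF continuous_nrm])
  moreover have "nrm (\<lambda>i. if i < p then f x i else 0) = nrm (f x)" for x by (rule nrm_cong) auto
  ultimately show ?thesis by simp
qed

text \<open>Norm equivalence: a continuous function attains its minimum on the compact l1 unit
  sphere, and there the norm is nonzero. Coordinates from \<open>p\<close> on are pinned to 0 to
  place this sphere in a compact product of intervals.\<close>

lemma nrm_lower_bound:
  obtains m where "0 < m" "\<And>x. m * (\<Sum>i<p. \<bar>x i\<bar>) \<le> nrm x"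
proof -
  define D where "D i = (if i < p then {-1..1} else {0 :: real})" for i :: nat
  have "compactin (product_topology (\<lambda>_. euclidean) UNIV) (Pi\<^sub>E (UNIV :: nat set) D)"
    unfolding compactin_PiE by (auto simp: D_def)
  then have D: "compact (Pi\<^sub>E UNIV D)" by (simp add: euclidean_product_topology compactin_euclidean_iff)
  have cl: "closed {x :: nat \<Rightarrow> real. (\<Sum>i<p. \<bar>x i\<bar>) = 1}"
    by (intro closed_Collect_eq continuous_intros continuous_on_product_coordinates)
  define S where "S = Pi\<^sub>E UNIV D \<inter> {x. (\<Sum>i<p. \<bar>x i\<bar>) = 1}"
  have "compact S" unfolding S_def by (rule compact_Int_closed[OF D cl])
  moreover have "S \<noteq> {}"
  proof -
    have "(\<lambda>i. if i = 0 then 1 else 0) \<in> S" using p_pos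
      by (auto simp: S_def D_def if_distrib[of abs] cong: if_cong)
    then show ?thesis by blast
  qed
  ultimately obtain x0 where x0: "x0 \<in> S" "\<And>x. x \<in> S \<Longrightarrow> nrm x0 \<le> nrm x"
    using continuous_attains_inf[of S nrm] continuous_on_subset[OF continuous_nrm] by auto
  have "nrm x0 \<noteq> 0"
  proof
    assume "nrm x0 = 0"
    then have "(\<Sum>i<p. \<bar>x0 i\<bar>) = 0" using nrm_eq_0 by (intro sum.neutral) auto
    then show False using x0(1) by (simp add: S_def)
  qed
  then have pos: "nrm x0 > 0" using nrm_nonneg[of x0] by simp
  have "nrm x0 * (\<Sum>i<p. \<bar>x i\<bar>) \<le> nrm x" for x
  proof (cases "(\<Sum>i<p. \<bar>x i\<bar>) = 0")
    case True then show ?thesis using nrm_nonneg[of x] by simp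
  next
    case False
    define t where "t = (\<Sum>i<p. \<bar>x i\<bar>)"
    have t: "t > 0" using False unfolding t_def by (simp add: order_less_le sum_nonneg)
    have le: "\<bar>x i\<bar> \<le> t" if "i < p" for i
      unfolding t_def by (rule member_le_sum) (use that in auto)
    let ?y = "\<lambda>i. if i < p then inverse t * x i else 0"
    have "?y \<in> S"
    proof -
      have "\<bar>inverse t * x i\<bar> \<le> 1" if "i < p" for i using le[OF that] t by (simp add: abs_mult field_simps)
      then have "?y \<in> Pi\<^sub>E UNIV D" by (auto simp: D_def abs_le_iff)
      moreover have "(\<Sum>i<p. \<bar>?y i\<bar>) = inverse t * t"
        unfolding t_def sum_distrib_left using t by (intro sum.cong) (auto simp: abs_mult t_def)
      ultimately show ?thesis using t by (simp add: S_def)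
    qed
    then have "nrm x0 \<le> nrm ?y" by (rule x0(2))
    also have "nrm ?y = nrm (\<lambda>i. inverse t * x i)" by (rule nrm_cong) auto
    also have "\<dots> = inverse t * nrm x" unfolding nrm_scale using t by simp
    finally show ?thesis using t unfolding t_def[symmetric] by (simp add: field_simps)
  qed
  with pos show ?thesis by (rule that)
qed

text \<open>The operator norm is a real supremum, which is an upper bound only of a set that is
  bounded above. Boundedness comes from norm equivalence, which limits the coordinates of unit
  vectors.\<close>

lemma nrm_mult_le_operator_norm:
  assumes A: "A \<in> carrier_mat p p"
  shows "nrm (\<lambda>i. \<Sum>j<p. A $$ (i, j) * x j) \<le> operator_norm p N A * nrm x"
proof (cases "nrm x = 0")
  case True
  have "nrm (\<lambda>i. \<Sum>j<p. A $$ (i, j) * x j) = nrm (\<lambda>i. 0 * x i)"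
    using nrm_eq_0[OF True] by (intro nrm_cong) (auto intro!: sum.neutral)
  then show ?thesis unfolding nrm_scale using True by simp
next
  case False
  obtain m where m: "0 < m" "\<And>x. m * (\<Sum>i<p. \<bar>x i\<bar>) \<le> nrm x" using nrm_lower_bound by blast
  let ?mv = "\<lambda>x i. \<Sum>j<p. A $$ (i, j) * x j"
  have eq: "N (A *\<^sub>v u) = nrm (?mv (\<lambda>j. vec_index u j))" if "u \<in> carrier_vec p" for u
    unfolding nrm_def using that A
    by (intro arg_cong[where f = N] eq_vecI) (auto simp: scalar_prod_def atLeast0LessThan intro!: sum.cong)
  define B where "B = (\<Sum>i<p. (\<Sum>j<p. \<bar>A $$ (i, j)\<bar> * inverse m) * unit_nrm i)"
  have bd: "nrm (?mv y) \<le> B" if y: "nrm y = 1" for y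
  proof -
    have y1: "\<bar>y j\<bar> \<le> inverse m" if "j < p" for j
    proof -
      have "\<bar>y j\<bar> \<le> (\<Sum>i<p. \<bar>y i\<bar>)" by (rule member_le_sum) (use that in auto)
      then have "m * \<bar>y j\<bar> \<le> m * (\<Sum>i<p. \<bar>y i\<bar>)" using m(1) by (intro mult_left_mono) auto
      also have "\<dots> \<le> 1" using m(2)[of y] y by simp
      finally show ?thesis using m(1) by (simp add: field_simps)
    qed
    have "nrm (?mv y) \<le> (\<Sum>i<p. \<bar>?mv y i\<bar> * unit_nrm i)" by (rule nrm_le_sum)
    also have "\<dots> \<le> B" unfolding B_def
      by (intro sum_mono mult_right_mono unit_nrm_nonneg order_trans[OF sum_abs])
         (auto simp: abs_mult intro!: mult_left_mono y1)
    finally show ?thesis .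
  qed
  have "bdd_above {N (A *\<^sub>v u) | u. u \<in> carrier_vec p \<and> N u = 1}"
  proof (rule bdd_aboveI, clarify)
    fix u assume u: "u \<in> carrier_vec p" "N u = 1"
    have "Matrix.vec p (\<lambda>j. vec_index u j) = u" using u by (intro eq_vecI) auto
    then have "nrm (\<lambda>j. vec_index u j) = 1" using u by (simp add: nrm_def)
    then show "N (A *\<^sub>v u) \<le> B" using bd eq[OF u(1)] by simp
  qed
  define y where "y = (\<lambda>i. inverse (nrm x) * x i)"
  have y: "nrm y = 1" unfolding y_def nrm_scale using False nrm_nonneg[of x] by simp
  have "N (A *\<^sub>v Matrix.vec p y) \<le> operator_norm p N A"
    unfolding operator_norm_def
    by (rule cSup_upper) (use y \<open>bdd_above _\<close> in \<open>auto simp: nrm_def\<close>)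
  moreover have "N (A *\<^sub>v Matrix.vec p y) = nrm (?mv y)"
    using eq[of "Matrix.vec p y"] by (auto intro!: nrm_cong)
  moreover have "nrm (?mv y) = inverse (nrm x) * nrm (?mv x)"
  proof -
    have "?mv y = (\<lambda>i. inverse (nrm x) * ?mv x i)" by (auto simp: y_def sum_distrib_left mult_ac)
    then show ?thesis using nrm_scale[of "inverse (nrm x)" "?mv x"] nrm_nonneg[of x] by simp
  qed
  ultimately have le: "inverse (nrm x) * nrm (?mv x) \<le> operator_norm p N A" by simp
  have "nrm x > 0" using False nrm_nonneg[of x] by simp
  then have "nrm (?mv x) = nrm x * (inverse (nrm x) * nrm (?mv x))" by simp
  also have "\<dots> \<le> nrm x * operator_norm p N A" by (rule mult_left_mono[OF le nrm_nonneg])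
  finally show ?thesis by (simp only: mult.commute)
qed

lemma tendsto_0_of_nrm:
  assumes "(\<lambda>n. nrm (h n)) \<longlonglongrightarrow> 0" "i < p"
  shows "(\<lambda>n. h n i) \<longlonglongrightarrow> 0"
proof -
  obtain m where m: "0 < m" "\<And>x. m * (\<Sum>i<p. \<bar>x i\<bar>) \<le> nrm x" using nrm_lower_bound by blast
  have le: "norm (h n i) \<le> inverse m * nrm (h n)" for n
  proof -
    have "\<bar>h n i\<bar> \<le> (\<Sum>i<p. \<bar>h n i\<bar>)" by (rule member_le_sum) (use assms in auto)
    then have "m * \<bar>h n i\<bar> \<le> m * (\<Sum>i<p. \<bar>h n i\<bar>)" using m(1) by (intro mult_left_mono) auto
    also have "\<dots> \<le> nrm (h n)" by (rule m(2))
    finally show ?thesis using m(1) by (simp add: field_simps)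
  qed
  have "(\<lambda>n. inverse m * nrm (h n)) \<longlonglongrightarrow> 0" by (rule tendsto_mult_right_zero[OF assms(1)])
  then show ?thesis by (rule Lim_null_comparison[OF always_eventually[OF allI[OF le]]])
qed

lemma nrm_tendsto_0:
  assumes "\<And>i. i < p \<Longrightarrow> (\<lambda>n. r n i) \<longlonglongrightarrow> 0"
  shows "(\<lambda>n. nrm (r n)) \<longlonglongrightarrow> 0"
proof (rule Lim_null_comparison[OF always_eventually[OF allI]])
  show "norm (nrm (r n)) \<le> (\<Sum>i<p. \<bar>r n i\<bar> * unit_nrm i)" for n using nrm_nonneg nrm_le_sum by simp
  have "(\<lambda>n. \<Sum>i<p. \<bar>r n i\<bar> * unit_nrm i) \<longlonglongrightarrow> (\<Sum>i<p. \<bar>0\<bar> * unit_nrm i)"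
    by (intro tendsto_intros) (use assms in auto)
  then show "(\<lambda>n. \<Sum>i<p. \<bar>r n i\<bar> * unit_nrm i) \<longlonglongrightarrow> 0" by simp
qed

end

section \<open>Stability of the recursions for first and second moments\<close>

locale contracting_pair = vec_norm +
  fixes A B :: "nat \<Rightarrow> nat \<Rightarrow> real" and \<beta> :: real
  assumes beta: "0 < \<beta>" "\<beta> < 1"
    and contr_A: "\<And>x. nrm (\<lambda>i. \<Sum>j<p. A i j * x j) \<le> \<beta> * nrm x"
    and contr_B: "\<And>x. nrm (\<lambda>i. \<Sum>j<p. B i j * x j) \<le> \<beta> * nrm x"
begin

definition mean_op :: "(nat \<Rightarrow> real) \<Rightarrow> nat \<Rightarrow> real" where
  "mean_op x i = ((\<Sum>j<p. A i j * x j) + (\<Sum>j<p. B i j * x j)) / 2"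

text \<open>This is the map E -> (A E A^t + B E B^t) / 2 of the equation for ell; on empirical
  second moments it describes the passage to the next generation.\<close>

definition congr_op :: "(nat \<Rightarrow> nat \<Rightarrow> real) \<Rightarrow> nat \<Rightarrow> nat \<Rightarrow> real" where
  "congr_op E i j = ((\<Sum>k<p. \<Sum>m<p. A i k * E k m * A j m) + (\<Sum>k<p. \<Sum>m<p. B i k * E k m * B j m)) / 2"

lemma nrm_mean_op: "nrm (mean_op x) \<le> \<beta> * nrm x"
proof -
  have "mean_op x = (\<lambda>i. (1/2) * ((\<Sum>j<p. A i j * x j) + (\<Sum>j<p. B i j * x j)))"
    by (rule ext) (simp add: mean_op_def)
  then have "nrm (mean_op x) = (1/2) * nrm (\<lambda>i. (\<Sum>j<p. A i j * x j) + (\<Sum>j<p. B i j * x j))"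
    using nrm_scale[of "1/2"] by simp
  also have "\<dots> \<le> (1/2) * (\<beta> * nrm x + \<beta> * nrm x)"
    by (intro mult_left_mono order_trans[OF nrm_add] add_mono contr_A contr_B) auto
  finally show ?thesis by simp
qed

lemma mean_op_recursion_tendsto_0:
  assumes rec: "\<And>n i. n \<ge> m \<Longrightarrow> i < p \<Longrightarrow> h (Suc n) i = mean_op (h n) i + r n i"
    and r: "\<And>i. i < p \<Longrightarrow> (\<lambda>n. r n i) \<longlonglongrightarrow> 0" and i: "i < p"
  shows "(\<lambda>n. h n i) \<longlonglongrightarrow> 0"
proof (rule tendsto_0_of_nrm[OF perturbed_contraction_tendsto_0 i])
  show "0 \<le> \<beta>" "\<beta> < 1" using beta by auto
  show "nrm (h (Suc n)) \<le> \<beta> * nrm (h n) + nrm (r n)" if "n \<ge> m" for n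
  proof -
    have "nrm (h (Suc n)) = nrm (\<lambda>i. mean_op (h n) i + r n i)" using rec that by (intro nrm_cong) auto
    also have "\<dots> \<le> \<beta> * nrm (h n) + nrm (r n)" by (rule order_trans[OF nrm_add]) (simp add: nrm_mean_op)
    finally show ?thesis .
  qed
  show "(\<lambda>n. nrm (r n)) \<longlonglongrightarrow> 0" by (rule nrm_tendsto_0[OF r])
qed (rule nrm_nonneg)

lemma mean_op_fixed_0:
  assumes "\<And>i. i < p \<Longrightarrow> x i = mean_op x i" "i < p"
  shows "x i = 0"
proof -
  have "nrm x = nrm (mean_op x)" by (rule nrm_cong) (use assms in auto)
  then have "nrm x \<le> \<beta> * nrm x" using nrm_mean_op[of x] by simp
  then have "(1 - \<beta>) * nrm x \<le> 0" by (simp add: algebra_simps)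
  then have "nrm x \<le> 0" using beta by (simp add: mult_le_0_iff)
  then have "nrm x = 0" using nrm_nonneg[of x] by simp
  then show ?thesis using assms(2) by (rule nrm_eq_0)
qed

text \<open>
  A matrix is measured by its norm as an operator from the dual of \<open>(\<real>\<^sup>p, N)\<close> to \<open>(\<real>\<^sup>p, N)\<close>; for this
  norm the map \<open>E \<mapsto> A E A\<^sup>t\<close> contracts by \<open>\<beta>\<^sup>2\<close>.
\<close>

definition dual_ball :: "(nat \<Rightarrow> real) set" where
  "dual_ball = {g. \<forall>x. \<bar>\<Sum>j<p. g j * x j\<bar> \<le> nrm x}"

definition mat_bound :: "(nat \<Rightarrow> nat \<Rightarrow> real) \<Rightarrow> real \<Rightarrow> bool" where
  "mat_bound E t \<longleftrightarrow> (\<forall>g\<in>dual_ball. nrm (\<lambda>i. \<Sum>j<p. E i j * g j) \<le> t)"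

lemma dual_ball_coord: "g \<in> dual_ball \<Longrightarrow> j < p \<Longrightarrow> \<bar>g j\<bar> \<le> unit_nrm j"
proof -
  assume g: "g \<in> dual_ball" and j: "j < p"
  have "\<forall>x. \<bar>\<Sum>i<p. g i * x i\<bar> \<le> nrm x" using g by (simp add: dual_ball_def)
  from this[rule_format, of "\<lambda>i. if i = j then 1 else 0"]
  have "\<bar>\<Sum>i<p. g i * (if i = j then 1 else 0)\<bar> \<le> unit_nrm j" by (simp only: unit_nrm_def)
  then show ?thesis using j by (simp add: if_distrib[of "\<lambda>x. _ * x"] cong: if_cong)
qed

lemma mat_bound_entries: "mat_bound E (\<Sum>i<p. (\<Sum>j<p. \<bar>E i j\<bar> * unit_nrm j) * unit_nrm i)"
  unfolding mat_bound_def
proof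
  fix g assume g: "g \<in> dual_ball"
  have "nrm (\<lambda>i. \<Sum>j<p. E i j * g j) \<le> (\<Sum>i<p. \<bar>\<Sum>j<p. E i j * g j\<bar> * unit_nrm i)" by (rule nrm_le_sum)
  also have "\<dots> \<le> (\<Sum>i<p. (\<Sum>j<p. \<bar>E i j\<bar> * unit_nrm j) * unit_nrm i)"
    by (intro sum_mono mult_right_mono unit_nrm_nonneg order_trans[OF sum_abs])
       (auto simp: abs_mult intro!: mult_left_mono dual_ball_coord[OF g])
  finally show "nrm (\<lambda>i. \<Sum>j<p. E i j * g j) \<le> (\<Sum>i<p. (\<Sum>j<p. \<bar>E i j\<bar> * unit_nrm j) * unit_nrm i)" .
qed

lemma mat_bound_add:
  assumes "mat_bound E s" "mat_bound R t" shows "mat_bound (\<lambda>i j. E i j + R i j) (s + t)"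
  unfolding mat_bound_def
proof
  fix g assume g: "g \<in> dual_ball"
  have "nrm (\<lambda>i. \<Sum>j<p. (E i j + R i j) * g j) = nrm (\<lambda>i. (\<Sum>j<p. E i j * g j) + (\<Sum>j<p. R i j * g j))"
    by (simp add: distrib_right sum.distrib)
  also have "\<dots> \<le> s + t"
    using assms g unfolding mat_bound_def by (intro order_trans[OF nrm_add] add_mono) auto
  finally show "nrm (\<lambda>i. \<Sum>j<p. (E i j + R i j) * g j) \<le> s + t" .
qed

text \<open>If g lies in the dual unit ball, so does C^t g / \<beta>. One factor \<beta> comes from
  this rescaling and the other from applying C to the result, which is why \<beta> has to be
  positive.\<close>

lemma mat_bound_conjugate:
  assumes C: "\<And>x. nrm (\<lambda>i. \<Sum>j<p. C i j * x j) \<le> \<beta> * nrm x" and E: "mat_bound E t"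
  shows "mat_bound (\<lambda>i j. \<Sum>k<p. \<Sum>m<p. C i k * E k m * C j m) (\<beta>\<^sup>2 * t)"
  unfolding mat_bound_def
proof
  fix g assume g: "g \<in> dual_ball"
  define g' where "g' m = inverse \<beta> * (\<Sum>j<p. C j m * g j)" for m
  have g': "g' \<in> dual_ball" unfolding dual_ball_def
  proof (intro CollectI allI)
    fix x
    have "(\<Sum>m<p. g' m * x m) = inverse \<beta> * (\<Sum>m<p. (\<Sum>j<p. C j m * g j) * x m)"
      unfolding g'_def by (simp only: sum_distrib_left[symmetric] mult.assoc)
    also have "\<dots> = inverse \<beta> * (\<Sum>j<p. g j * (\<Sum>k<p. C j k * x k))" by (simp only: lincomb_sum_swap)
    finally have "\<bar>\<Sum>m<p. g' m * x m\<bar> = inverse \<beta> * \<bar>\<Sum>j<p. g j * (\<Sum>k<p. C j k * x k)\<bar>"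
      using beta by (simp add: abs_mult)
    also have "\<dots> \<le> inverse \<beta> * (\<beta> * nrm x)"
      using beta g C[of x] unfolding dual_ball_def by (intro mult_left_mono) (auto intro: order_trans)
    also have "\<dots> = nrm x" using beta by simp
    finally show "\<bar>\<Sum>m<p. g' m * x m\<bar> \<le> nrm x" .
  qed
  have eq: "(\<Sum>j<p. (\<Sum>k<p. \<Sum>m<p. C i k * E k m * C j m) * g j) = (\<Sum>k<p. C i k * (\<beta> * (\<Sum>m<p. E k m * g' m)))" for i
  proof -
    have "(\<Sum>j<p. (\<Sum>k<p. \<Sum>m<p. C i k * E k m * C j m) * g j) = (\<Sum>j<p. \<Sum>k<p. \<Sum>m<p. C i k * (E k m * (C j m * g j)))"
      by (simp only: sum_distrib_right mult.assoc)
    also have "\<dots> = (\<Sum>k<p. \<Sum>m<p. \<Sum>j<p. C i k * (E k m * (C j m * g j)))"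
      by (subst sum.swap, rule sum.cong[OF refl], rule sum.swap)
    also have "\<dots> = (\<Sum>k<p. C i k * (\<beta> * (\<Sum>m<p. E k m * g' m)))"
    proof -
      have gg: "\<beta> * g' m = (\<Sum>j<p. C j m * g j)" for m using beta by (simp add: g'_def)
      have "\<beta> * (\<Sum>m<p. E k m * g' m) = (\<Sum>m<p. E k m * (\<Sum>j<p. C j m * g j))" for k
        unfolding gg[symmetric] by (simp add: sum_distrib_left mult_ac)
      then show ?thesis by (simp add: sum_distrib_left)
    qed
    finally show ?thesis .
  qed
  have "nrm (\<lambda>i. \<Sum>j<p. (\<Sum>k<p. \<Sum>m<p. C i k * E k m * C j m) * g j)
      \<le> \<beta> * nrm (\<lambda>k. \<beta> * (\<Sum>m<p. E k m * g' m))"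
    unfolding eq by (rule C)
  also have "\<dots> = \<beta> * (\<beta> * nrm (\<lambda>k. \<Sum>m<p. E k m * g' m))" unfolding nrm_scale using beta by simp
  also have "\<dots> \<le> \<beta> * (\<beta> * t)" using E g' beta unfolding mat_bound_def by (intro mult_left_mono) auto
  finally show "nrm (\<lambda>i. \<Sum>j<p. (\<Sum>k<p. \<Sum>m<p. C i k * E k m * C j m) * g j) \<le> \<beta>\<^sup>2 * t"
    by (simp add: power2_eq_square)
qed

lemma mat_bound_scale: "mat_bound E t \<Longrightarrow> mat_bound (\<lambda>i j. c * E i j) (\<bar>c\<bar> * t)"
  unfolding mat_bound_def
  by (simp add: mult.assoc sum_distrib_left[symmetric] nrm_scale mult_left_mono)

lemma mat_bound_congr_op: "mat_bound E t \<Longrightarrow> mat_bound (congr_op E) (\<beta>\<^sup>2 * t)"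
  using mat_bound_scale[OF mat_bound_add[OF mat_bound_conjugate[OF contr_A] mat_bound_conjugate[OF contr_B]], of E t E t "1/2"]
  by (simp add: congr_op_def[abs_def] mult.commute)

lemma mat_bound_cong:
  assumes "mat_bound E t" "\<And>i j. i < p \<Longrightarrow> j < p \<Longrightarrow> E i j = R i j" shows "mat_bound R t"
proof -
  have "nrm (\<lambda>i. \<Sum>j<p. E i j * g j) = nrm (\<lambda>i. \<Sum>j<p. R i j * g j)" for g
    using assms(2) by (intro nrm_cong sum.cong) auto
  then show ?thesis using assms(1) by (simp add: mat_bound_def)
qed

text \<open>By norm equivalence, m times a coordinate functional lies in the dual ball. Testing with
  it isolates a column of E, and the same constant m bounds a coordinate of that column.\<close>

lemma mat_bound_entry:
  obtains c where "0 < c" "\<And>E t i j. mat_bound E t \<Longrightarrow> i < p \<Longrightarrow> j < p \<Longrightarrow> \<bar>E i j\<bar> \<le> c * t"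
proof -
  obtain m where m: "0 < m" "\<And>x. m * (\<Sum>i<p. \<bar>x i\<bar>) \<le> nrm x" using nrm_lower_bound by blast
  have m1: "m * \<bar>x j\<bar> \<le> nrm x" if "j < p" for x j
  proof -
    have "\<bar>x j\<bar> \<le> (\<Sum>i<p. \<bar>x i\<bar>)" by (rule member_le_sum) (use that in auto)
    then have "m * \<bar>x j\<bar> \<le> m * (\<Sum>i<p. \<bar>x i\<bar>)" using m(1) by (intro mult_left_mono) auto
    then show ?thesis using m(2)[of x] by linarith
  qed
  have "\<bar>E i j\<bar> \<le> inverse (m\<^sup>2) * t" if E: "mat_bound E t" and ij: "i < p" "j < p" for E t i j
  proof -
    let ?g = "\<lambda>k. if k = j then m else 0"
    have "(\<Sum>k<p. ?g k * x k) = m * x j" for x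
      using ij by (simp add: if_distrib[of "\<lambda>y. y * _"] cong: if_cong)
    then have "?g \<in> dual_ball"
      unfolding dual_ball_def using m1[OF ij(2)] m(1) by (simp add: abs_mult)
    then have "nrm (\<lambda>i. \<Sum>k<p. E i k * ?g k) \<le> t" using E by (auto simp: mat_bound_def)
    moreover have "(\<lambda>i. \<Sum>k<p. E i k * ?g k) = (\<lambda>i. E i j * m)"
      using ij by (simp add: if_distrib[of "\<lambda>y. _ * y"] cong: if_cong)
    ultimately have "m * \<bar>E i j * m\<bar> \<le> t" using m1[OF ij(1), of "\<lambda>i. E i j * m"] by simp
    then have "m\<^sup>2 * \<bar>E i j\<bar> \<le> t" using m(1) by (simp add: abs_mult power2_eq_square mult_ac)
    then show ?thesis using m(1) by (simp add: field_simps)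
  qed
  moreover have "0 < inverse (m\<^sup>2)" using m(1) by simp
  ultimately show ?thesis using that by blast
qed

text \<open>No supremum over the dual ball is formed: a scalar sequence \<open>t\<close> of
  admissible bounds is carried along instead. It obeys a perturbed contraction with factor
  \<beta>^2, and bounds that tend to 0 force the entries to 0.\<close>

lemma congr_op_recursion_tendsto_0:
  assumes rec: "\<And>n i j. n \<ge> n0 \<Longrightarrow> i < p \<Longrightarrow> j < p \<Longrightarrow> E (Suc n) i j = congr_op (E n) i j + R n i j"
    and R: "\<And>i j. i < p \<Longrightarrow> j < p \<Longrightarrow> (\<lambda>n. R n i j) \<longlonglongrightarrow> 0" and ij: "i < p" "j < p"
  shows "(\<lambda>n. E n i j) \<longlonglongrightarrow> 0"
proof -
  define b where "b E = (\<Sum>i<p. (\<Sum>j<p. \<bar>E i j\<bar> * unit_nrm j) * unit_nrm i)" for E :: "nat \<Rightarrow> nat \<Rightarrow> real"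
  define t where "t = rec_nat (b (E n0)) (\<lambda>n x. \<beta>\<^sup>2 * x + b (R (n0 + n)))"
  have t0: "t 0 = b (E n0)" and tS: "t (Suc n) = \<beta>\<^sup>2 * t n + b (R (n0 + n))" for n
    by (simp_all add: t_def)
  have b0: "0 \<le> b E" for E unfolding b_def by (intro sum_nonneg mult_nonneg_nonneg unit_nrm_nonneg) auto
  have tpos: "0 \<le> t n" for n by (induction n) (auto simp: t0 tS b0)
  have bR: "(\<lambda>n. b (R n)) \<longlonglongrightarrow> 0"
  proof -
    have "(\<lambda>n. b (R n)) \<longlonglongrightarrow> (\<Sum>i<p. (\<Sum>j<p. \<bar>0\<bar> * unit_nrm j) * unit_nrm i)"
      unfolding b_def by (intro tendsto_intros) (use R in auto)
    then show ?thesis by simp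
  qed
  have t: "t \<longlonglongrightarrow> 0"
  proof (rule perturbed_contraction_tendsto_0)
    show "0 \<le> \<beta>\<^sup>2" "\<beta>\<^sup>2 < 1" using beta by (auto simp: power_less_one_iff abs_square_less_1)
    show "t (Suc n) \<le> \<beta>\<^sup>2 * t n + b (R (n0 + n))" if "n \<ge> 0" for n by (simp add: tS)
    show "(\<lambda>n. b (R (n0 + n))) \<longlonglongrightarrow> 0"
      using LIMSEQ_ignore_initial_segment[OF bR, of n0] by (simp add: add.commute)
  qed (rule tpos)
  have bound: "mat_bound (E (n0 + n)) (t n)" for n
  proof (induction n)
    case 0 show ?case using mat_bound_entries[of "E n0"] by (simp add: t0 b_def)
  next
    case (Suc n)
    have "mat_bound (R (n0 + n)) (b (R (n0 + n)))" unfolding b_def by (rule mat_bound_entries)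
    then have "mat_bound (\<lambda>i j. congr_op (E (n0 + n)) i j + R (n0 + n) i j) (t (Suc n))"
      unfolding tS by (intro mat_bound_add mat_bound_congr_op Suc)
    then show ?case by (rule mat_bound_cong) (simp add: rec)
  qed
  obtain c where c: "0 < c" "\<And>E t i j. mat_bound E t \<Longrightarrow> i < p \<Longrightarrow> j < p \<Longrightarrow> \<bar>E i j\<bar> \<le> c * t"
    using mat_bound_entry by blast
  have le: "norm (E (n0 + n) i j) \<le> c * t n" for n using c(2)[OF bound ij] by simp
  have "(\<lambda>n. c * t n) \<longlonglongrightarrow> 0" by (rule tendsto_mult_right_zero[OF t])
  then have "(\<lambda>n. E (n0 + n) i j) \<longlonglongrightarrow> 0"
    by (rule Lim_null_comparison[OF always_eventually[OF allI[OF le]]])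
  then show ?thesis using LIMSEQ_offset[of "\<lambda>n. E n i j" n0 0] by (simp add: add.commute)
qed

text \<open>A fixed point, taken as a constant sequence, satisfies the unperturbed recursion and
  therefore tends to 0.\<close>

lemma congr_op_fixed_0:
  assumes "\<And>i j. i < p \<Longrightarrow> j < p \<Longrightarrow> E i j = congr_op E i j" "i < p" "j < p"
  shows "E i j = 0"
proof -
  have "(\<lambda>n::nat. E i j) \<longlonglongrightarrow> 0"
    using congr_op_recursion_tendsto_0[of 0 "\<lambda>_. E" "\<lambda>_ _ _. 0"] assms by auto
  then show ?thesis by (simp add: LIMSEQ_const_iff)
qed

lemma congr_op_cong: "(\<And>i j. i < p \<Longrightarrow> j < p \<Longrightarrow> E i j = R i j) \<Longrightarrow> congr_op E = congr_op R"
  unfolding congr_op_def by (intro ext arg_cong2[where f = "\<lambda>x y. (x + y) / 2"] sum.cong) auto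

lemma congr_op_diff: "congr_op (\<lambda>i j. E i j - R i j) i j = congr_op E i j - congr_op R i j"
  unfolding congr_op_def
  by (simp add: right_diff_distrib left_diff_distrib sum_subtractf add_divide_distrib diff_divide_distrib)

text \<open>Picard iteration from 0: the increments \<open>d\<close> shrink like \<beta>^2 to the n,
  so the iterates converge entrywise, and the limit solves the equation by continuity of the finite
  sums.\<close>

lemma congr_op_affine_fixed_point:
  obtains l where "\<And>i j. i < p \<Longrightarrow> j < p \<Longrightarrow> l i j = T i j + congr_op l i j"
proof -
  define l where "l = rec_nat (\<lambda>_ _. 0) (\<lambda>_ x i j. T i j + congr_op x i j)"
  have lS: "l (Suc n) i j = T i j + congr_op (l n) i j" for n i j by (simp add: l_def)
  define d where "d n i j = l (Suc n) i j - l n i j" for n i j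
  have dS: "d (Suc n) i j = congr_op (d n) i j" for n i j
    unfolding d_def congr_op_diff by (simp add: lS)
  define t where "t = (\<Sum>i<p. (\<Sum>j<p. \<bar>d 0 i j\<bar> * unit_nrm j) * unit_nrm i)"
  have bound: "mat_bound (d n) ((\<beta>\<^sup>2) ^ n * t)" for n
  proof (induction n)
    case 0 show ?case using mat_bound_entries[of "d 0"] by (simp add: t_def)
  next
    case (Suc n)
    have "mat_bound (congr_op (d n)) ((\<beta>\<^sup>2) ^ Suc n * t)" using mat_bound_congr_op[OF Suc] by (simp add: mult_ac)
    then show ?case by (rule mat_bound_cong) (simp add: dS)
  qed
  obtain c where c: "0 < c" "\<And>E t i j. mat_bound E t \<Longrightarrow> i < p \<Longrightarrow> j < p \<Longrightarrow> \<bar>E i j\<bar> \<le> c * t"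
    using mat_bound_entry by blast
  have "norm (\<beta>\<^sup>2) < 1" using beta by (simp add: abs_square_less_1)
  then have "summable (\<lambda>n. c * ((\<beta>\<^sup>2) ^ n * t))"
    by (intro summable_mult summable_mult2 summable_geometric)
  then have sm: "summable (\<lambda>n. d n i j)" if "i < p" "j < p" for i j
  proof (rule summable_comparison_test')
    show "norm (d n i j) \<le> c * ((\<beta>\<^sup>2) ^ n * t)" if "n \<ge> 0" for n using c(2)[OF bound] \<open>i < p\<close> \<open>j < p\<close> by simp
  qed
  have tele: "(\<Sum>k<n. d k i j) = l n i j" for n i j
    by (induction n) (simp_all add: d_def l_def)
  define L where "L i j = (\<Sum>n. d n i j)" for i j
  have lim: "(\<lambda>n. l n i j) \<longlonglongrightarrow> L i j" if "i < p" "j < p" for i j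
    using summable_LIMSEQ[OF sm[OF that]] by (simp add: tele L_def)
  have "L i j = T i j + congr_op L i j" if ij: "i < p" "j < p" for i j
  proof (rule LIMSEQ_unique)
    show "(\<lambda>n. l (Suc n) i j) \<longlonglongrightarrow> L i j" by (rule LIMSEQ_Suc[OF lim[OF ij]])
    show "(\<lambda>n. l (Suc n) i j) \<longlonglongrightarrow> T i j + congr_op L i j"
      unfolding lS congr_op_def by (intro tendsto_intros lim) auto
  qed
  then show ?thesis by (rule that)
qed

end

section \<open>Empirical covariances along a path\<close>

lemma generation_iff: "k \<in> generation n \<longleftrightarrow> 2 ^ n \<le> k \<and> k < 2 ^ (n + 1)"
proof -
  have "k \<le> m - 1 \<longleftrightarrow> k < m" if "0 < m" for m :: nat using that by auto
  then show ?thesis unfolding generation_def by simp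
qed

lemma finite_generation [simp]: "finite (generation n)" by (simp add: generation_def)

lemma card_generation [simp]: "card (generation n) = 2 ^ n"
  by (simp add: generation_def)

lemma generation_ge: "k \<in> generation n \<Longrightarrow> n \<ge> q \<Longrightarrow> k \<ge> 2 ^ q"
  unfolding generation_iff by (meson order_trans one_le_numeral power_increasing)

lemma generation_Suc: "generation (Suc n) = (\<lambda>k. 2 * k) ` generation n \<union> (\<lambda>k. 2 * k + 1) ` generation n"
proof (intro equalityI subsetI)
  fix k assume "k \<in> generation (Suc n)"
  then have "k div 2 \<in> generation n" by (auto simp: generation_iff)
  moreover have "k = 2 * (k div 2) \<or> k = 2 * (k div 2) + 1" by presburger
  ultimately show "k \<in> (\<lambda>k. 2 * k) ` generation n \<union> (\<lambda>k. 2 * k + 1) ` generation n" by blast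
qed (auto simp: generation_iff)

lemma sum_generation_Suc:
  "(\<Sum>k\<in>generation (Suc n). f k) = (\<Sum>k\<in>generation n. f (2 * k)) + (\<Sum>k\<in>generation n. f (2 * k + 1))"
  for f :: "nat \<Rightarrow> real"
proof -
  have "(\<lambda>k. 2 * k) ` generation n \<inter> (\<lambda>k. 2 * k + 1) ` generation n = {}"
    by (auto, presburger)
  then show ?thesis unfolding generation_Suc
    by (subst sum.union_disjoint) (simp_all add: sum.reindex inj_on_def)
qed

definition avg :: "nat \<Rightarrow> (nat \<Rightarrow> real) \<Rightarrow> real" where
  "avg n f = (\<Sum>k\<in>generation n. f k) / 2 ^ n"

lemma avg_Suc: "avg (Suc n) f = (avg n (\<lambda>k. f (2 * k)) + avg n (\<lambda>k. f (2 * k + 1))) / 2"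
  unfolding avg_def sum_generation_Suc by (simp add: add_divide_distrib)

lemma avg_add: "avg n (\<lambda>k. f k + g k) = avg n f + avg n g"
  by (simp add: avg_def sum.distrib add_divide_distrib)

lemma avg_cmult: "avg n (\<lambda>k. c * f k) = c * avg n f"
  by (simp add: avg_def sum_distrib_left)

lemma avg_sum: "avg n (\<lambda>k. \<Sum>i\<in>I. f i k) = (\<Sum>i\<in>I. avg n (f i))"
  unfolding avg_def by (subst sum.swap) (simp add: sum_divide_distrib)

lemma avg_const: "avg n (\<lambda>k. c) = c"
  by (simp add: avg_def)

lemma avg_cong: "(\<And>k. k \<in> generation n \<Longrightarrow> f k = g k) \<Longrightarrow> avg n f = avg n g"
  by (simp add: avg_def cong: sum.cong)

definition companion_fn :: "(nat \<Rightarrow> real) \<Rightarrow> nat \<Rightarrow> nat \<Rightarrow> real" where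
  "companion_fn a i j = (if i = 0 then a (Suc j) else if i = Suc j then 1 else 0)"

definition regressor :: "(nat \<Rightarrow> real) \<Rightarrow> nat \<Rightarrow> nat \<Rightarrow> real" where
  "regressor x k i = (case i of 0 \<Rightarrow> 1 | Suc j \<Rightarrow> x (k div 2 ^ j))"

lemma regressor_simps [simp]: "regressor x k 0 = 1" "regressor x k (Suc j) = x (k div 2 ^ j)"
  by (simp_all add: regressor_def)

text \<open>The entries of L, with index 0 belonging to the constant regressor and index i + 1 to
  coordinate i of the state.\<close>

definition block_limit :: "(nat \<Rightarrow> real) \<Rightarrow> (nat \<Rightarrow> nat \<Rightarrow> real) \<Rightarrow> nat \<Rightarrow> nat \<Rightarrow> real" where
  "block_limit l m i j = (case i of 0 \<Rightarrow> (case j of 0 \<Rightarrow> 1 | Suc j' \<Rightarrow> l j')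
     | Suc i' \<Rightarrow> (case j of 0 \<Rightarrow> l i' | Suc j' \<Rightarrow> m i' j'))"

locale bar_recursion = contracting_pair p N "companion_fn a" "companion_fn b" \<beta>
  for p N a b \<beta> +
  fixes x e :: "nat \<Rightarrow> real"
  assumes x_even: "\<And>k. k \<ge> 2 ^ (p - 1) \<Longrightarrow> x (2 * k) = a 0 + (\<Sum>j = 1..p. a j * x (k div 2 ^ (j - 1))) + e (2 * k)"
    and x_odd: "\<And>k. k \<ge> 2 ^ (p - 1) \<Longrightarrow> x (2 * k + 1) = b 0 + (\<Sum>j = 1..p. b j * x (k div 2 ^ (j - 1))) + e (2 * k + 1)"
begin

abbreviation "y \<equiv> regressor x"

lemma companion_sum:
  "j < p \<Longrightarrow> (\<Sum>k<p. companion_fn c j k * z k) = (if j = 0 then \<Sum>k<p. c (Suc k) * z k else z (j - 1))"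
proof (cases j)
  case 0 then show ?thesis by (simp add: companion_fn_def)
next
  case (Suc i)
  assume "j < p"
  have "(\<Sum>k<p. companion_fn c j k * z k) = (\<Sum>k<p. if k = i then z k else 0)"
    using Suc by (intro sum.cong) (auto simp: companion_fn_def)
  then show ?thesis using Suc \<open>j < p\<close> by simp
qed

lemma y_even:
  assumes "k \<ge> 2 ^ (p - 1)" "i < p"
  shows "y (2 * k) (Suc i) = (\<Sum>j<p. companion_fn a i j * y k (Suc j)) + (if i = 0 then a 0 + e (2 * k) else 0)"
proof (cases i)
  case 0
  have "(\<Sum>j = 1..p. a j * x (k div 2 ^ (j - 1))) = (\<Sum>j<p. a (Suc j) * x (k div 2 ^ j))"
    by (simp add: sum.atLeast1_atMost_eq)
  then show ?thesis using 0 assms x_even[OF assms(1)] by (simp add: companion_sum)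
next
  case (Suc j)
  have "2 * k div 2 ^ Suc j = k div 2 ^ j" by (simp add: div_mult2_eq)
  then show ?thesis using Suc assms by (simp add: companion_sum)
qed

lemma y_odd:
  assumes "k \<ge> 2 ^ (p - 1)" "i < p"
  shows "y (2 * k + 1) (Suc i) = (\<Sum>j<p. companion_fn b i j * y k (Suc j)) + (if i = 0 then b 0 + e (2 * k + 1) else 0)"
proof (cases i)
  case 0
  have "(\<Sum>j = 1..p. b j * x (k div 2 ^ (j - 1))) = (\<Sum>j<p. b (Suc j) * x (k div 2 ^ j))"
    by (simp add: sum.atLeast1_atMost_eq)
  then show ?thesis using 0 assms x_odd[OF assms(1)] by (simp add: companion_sum)
next
  case (Suc j)
  have "(2 * k + 1) div 2 ^ Suc j = k div 2 ^ j" by (simp add: div_mult2_eq)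
  then show ?thesis using Suc assms by (simp add: companion_sum)
qed

end

text \<open>A single path, without probability: the noise enters through limits of generation
  averages. Nothing else is asked of \<open>l\<close> and \<open>m\<close> than the equations of
  lambda and ell written in coordinates.\<close>

locale bar_path = bar_recursion +
  fixes s :: real and l :: "nat \<Rightarrow> real" and m :: "nat \<Rightarrow> nat \<Rightarrow> real"
  assumes s_pos: "0 < s"
    and noise_regressor: "\<And>i r. i \<le> p \<Longrightarrow> r < 2 \<Longrightarrow> (\<lambda>n. avg n (\<lambda>k. e (2 * k + r) * regressor x k i)) \<longlonglongrightarrow> 0"
    and noise_square: "\<And>r. r < 2 \<Longrightarrow> (\<lambda>n. avg n (\<lambda>k. (e (2 * k + r))\<^sup>2)) \<longlonglongrightarrow> s"
    and l_eq: "\<And>i. i < p \<Longrightarrow> l i = mean_op l i + (if i = 0 then (a 0 + b 0) / 2 else 0)"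
    and m_eq: "\<And>i j. i < p \<Longrightarrow> j < p \<Longrightarrow> m i j = congr_op m i j
      + (if i = 0 \<and> j = 0 then s + ((a 0)\<^sup>2 + (b 0)\<^sup>2) / 2 else 0)
      + (a 0 * ((if j = 0 then \<Sum>k<p. companion_fn a i k * l k else 0) + (if i = 0 then \<Sum>k<p. companion_fn a j k * l k else 0))
       + b 0 * ((if j = 0 then \<Sum>k<p. companion_fn b i k * l k else 0) + (if i = 0 then \<Sum>k<p. companion_fn b j k * l k else 0))) / 2"
begin

lemma noise_mean: "r < 2 \<Longrightarrow> (\<lambda>n. avg n (\<lambda>k. e (2 * k + r))) \<longlonglongrightarrow> 0"
  using noise_regressor[of 0 r] by simp

text \<open>Averaging the recursion over one generation maps the vector of averages by the mean of
  the two companion matrices. Subtracting the equation for \<open>l\<close> leaves averaged noise as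
  the only perturbation.\<close>

lemma avg_mean_tendsto:
  assumes i: "i < p"
  shows "(\<lambda>n. avg n (\<lambda>k. y k (Suc i))) \<longlonglongrightarrow> l i"
proof -
  define h where "h n i = avg n (\<lambda>k. y k (Suc i)) - l i" for n i
  define r where "r n i = (if i = 0 then (avg n (\<lambda>k. e (2 * k)) + avg n (\<lambda>k. e (2 * k + 1))) / 2 else 0)" for n and i :: nat
  have "(\<lambda>n. h n i) \<longlonglongrightarrow> 0"
  proof (rule mean_op_recursion_tendsto_0[OF _ _ i])
    fix n i assume n: "n \<ge> p - 1" and i: "i < p"
    have 1: "avg n (\<lambda>k. y (2 * k) (Suc i)) = (\<Sum>j<p. companion_fn a i j * avg n (\<lambda>k. y k (Suc j)))
        + (if i = 0 then a 0 + avg n (\<lambda>k. e (2 * k)) else 0)"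
    proof -
      have "avg n (\<lambda>k. y (2 * k) (Suc i)) = avg n (\<lambda>k. (\<Sum>j<p. companion_fn a i j * y k (Suc j)) + (if i = 0 then a 0 + e (2 * k) else 0))"
        using y_even[OF generation_ge[OF _ n] i] by (rule avg_cong)
      also have "\<dots> = (\<Sum>j<p. companion_fn a i j * avg n (\<lambda>k. y k (Suc j))) + avg n (\<lambda>k. if i = 0 then a 0 + e (2 * k) else 0)"
        unfolding avg_add avg_sum avg_cmult ..
      finally show ?thesis by (simp add: avg_add avg_const)
    qed
    have 2: "avg n (\<lambda>k. y (2 * k + 1) (Suc i)) = (\<Sum>j<p. companion_fn b i j * avg n (\<lambda>k. y k (Suc j)))
        + (if i = 0 then b 0 + avg n (\<lambda>k. e (2 * k + 1)) else 0)"
    proof -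
      have "avg n (\<lambda>k. y (2 * k + 1) (Suc i)) = avg n (\<lambda>k. (\<Sum>j<p. companion_fn b i j * y k (Suc j)) + (if i = 0 then b 0 + e (2 * k + 1) else 0))"
        using y_odd[OF generation_ge[OF _ n] i] by (rule avg_cong)
      also have "\<dots> = (\<Sum>j<p. companion_fn b i j * avg n (\<lambda>k. y k (Suc j))) + avg n (\<lambda>k. if i = 0 then b 0 + e (2 * k + 1) else 0)"
        unfolding avg_add avg_sum avg_cmult ..
      finally show ?thesis by (simp add: avg_add avg_const)
    qed
    have "mean_op (h n) i = mean_op (\<lambda>i. avg n (\<lambda>k. y k (Suc i))) i - mean_op l i"
      by (simp only: mean_op_def h_def right_diff_distrib sum_subtractf) (simp add: field_simps)
    moreover have "mean_op (\<lambda>i. avg n (\<lambda>k. y k (Suc i))) i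
        = ((\<Sum>j<p. companion_fn a i j * avg n (\<lambda>k. y k (Suc j))) + (\<Sum>j<p. companion_fn b i j * avg n (\<lambda>k. y k (Suc j)))) / 2"
      by (simp only: mean_op_def)
    ultimately show "h (Suc n) i = mean_op (h n) i + r n i"
      unfolding h_def[of "Suc n"] avg_Suc 1 2 using l_eq[OF i]
      by (cases "i = 0") (simp_all add: r_def add_divide_distrib)
  next
    fix i
    have "(\<lambda>n. (avg n (\<lambda>k. e (2 * k)) + avg n (\<lambda>k. e (2 * k + 1))) / 2) \<longlonglongrightarrow> (0 + 0) / 2"
      using noise_mean[of 0] noise_mean[of 1] by (intro tendsto_intros) auto
    then show "(\<lambda>n. r n i) \<longlonglongrightarrow> 0" by (cases "i = 0") (simp_all add: r_def)
  qed
  then show ?thesis unfolding h_def by (simp add: LIM_zero_iff)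
qed

text \<open>The daughter regressor is C y plus c + g in the first coordinate. The product expands
  into the congruence term, two mixed terms present only in row or column 0, and a corner
  term.\<close>

lemma avg_product_split:
  assumes "\<And>k. k \<in> generation n \<Longrightarrow> f k i = (\<Sum>j<p. C i j * y k (Suc j)) + (if i = 0 then c + g k else 0)"
    and "\<And>k. k \<in> generation n \<Longrightarrow> f k j = (\<Sum>k'<p. C j k' * y k (Suc k')) + (if j = 0 then c + g k else (0::real))"
  shows "avg n (\<lambda>k. f k i * f k j) = (\<Sum>u<p. \<Sum>v<p. C i u * avg n (\<lambda>k. y k (Suc u) * y k (Suc v)) * C j v)
    + (if j = 0 then (\<Sum>u<p. C i u * (c * avg n (\<lambda>k. y k (Suc u)) + avg n (\<lambda>k. g k * y k (Suc u)))) else 0)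
    + (if i = 0 then (\<Sum>u<p. C j u * (c * avg n (\<lambda>k. y k (Suc u)) + avg n (\<lambda>k. g k * y k (Suc u)))) else 0)
    + (if i = 0 \<and> j = 0 then c\<^sup>2 + 2 * c * avg n g + avg n (\<lambda>k. (g k)\<^sup>2) else 0)"
proof -
  have "avg n (\<lambda>k. f k i * f k j) = avg n (\<lambda>k.
      (\<Sum>u<p. \<Sum>v<p. (C i u * C j v) * (y k (Suc u) * y k (Suc v)))
      + (if j = 0 then 1 else 0) * (\<Sum>u<p. C i u * (c * y k (Suc u) + g k * y k (Suc u)))
      + (if i = 0 then 1 else 0) * (\<Sum>u<p. C j u * (c * y k (Suc u) + g k * y k (Suc u)))
      + (if i = 0 \<and> j = 0 then 1 else 0) * (c\<^sup>2 + 2 * c * g k + (g k)\<^sup>2))"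
  proof (rule avg_cong)
    fix k assume k: "k \<in> generation n"
    define P where "P i = (\<Sum>j<p. C i j * y k (Suc j))" for i
    have PP: "(\<Sum>u<p. \<Sum>v<p. (C i u * C j v) * (y k (Suc u) * y k (Suc v))) = P i * P j"
      unfolding P_def sum_product by (simp add: mult_ac)
    have Pc: "(\<Sum>u<p. C i u * (c * y k (Suc u) + g k * y k (Suc u))) = P i * (c + g k)" for i
      unfolding P_def sum_distrib_right by (simp add: algebra_simps)
    show "f k i * f k j = (\<Sum>u<p. \<Sum>v<p. (C i u * C j v) * (y k (Suc u) * y k (Suc v)))
      + (if j = 0 then 1 else 0) * (\<Sum>u<p. C i u * (c * y k (Suc u) + g k * y k (Suc u)))
      + (if i = 0 then 1 else 0) * (\<Sum>u<p. C j u * (c * y k (Suc u) + g k * y k (Suc u)))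
      + (if i = 0 \<and> j = 0 then 1 else 0) * (c\<^sup>2 + 2 * c * g k + (g k)\<^sup>2)"
      unfolding assms[OF k] PP Pc P_def[symmetric] by (simp add: power2_eq_square algebra_simps)
  qed
  also have "\<dots> = (\<Sum>u<p. \<Sum>v<p. (C i u * C j v) * avg n (\<lambda>k. y k (Suc u) * y k (Suc v)))
      + (if j = 0 then 1 else 0) * (\<Sum>u<p. C i u * (c * avg n (\<lambda>k. y k (Suc u)) + avg n (\<lambda>k. g k * y k (Suc u))))
      + (if i = 0 then 1 else 0) * (\<Sum>u<p. C j u * (c * avg n (\<lambda>k. y k (Suc u)) + avg n (\<lambda>k. g k * y k (Suc u))))
      + (if i = 0 \<and> j = 0 then 1 else 0) * (c\<^sup>2 + 2 * c * avg n g + avg n (\<lambda>k. (g k)\<^sup>2))"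
    unfolding avg_add avg_cmult avg_sum avg_const ..
  finally show ?thesis by (simp add: mult_ac)
qed

lemma avg_product_tendsto_core:
  assumes ij: "i < p" "j < p"
  shows "(\<lambda>n. avg n (\<lambda>k. y k (Suc i) * y k (Suc j))) \<longlonglongrightarrow> m i j"
proof -
  define V where "V n i j = avg n (\<lambda>k. y k (Suc i) * y k (Suc j))" for n i j
  define h where "h n i = avg n (\<lambda>k. y k (Suc i))" for n i
  define q where "q r n i = avg n (\<lambda>k. e (2 * k + r) * y k (Suc i))" for r n i
  define rest where "rest c C r n i j =
      (if j = 0 then \<Sum>u<p. C i u * (c * h n u + q r n u) else 0)
    + (if i = 0 then \<Sum>u<p. C j u * (c * h n u + q r n u) else 0)
    + (if i = 0 \<and> j = 0 then c\<^sup>2 + 2 * c * avg n (\<lambda>k. e (2 * k + r)) + avg n (\<lambda>k. (e (2 * k + r))\<^sup>2) else 0)"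
    for c and C :: "nat \<Rightarrow> nat \<Rightarrow> real" and r n and i j :: nat
  have rest_lim: "(\<lambda>n. rest c C r n i j) \<longlonglongrightarrow>
      (if j = 0 then \<Sum>u<p. C i u * (c * l u) else 0) + (if i = 0 then \<Sum>u<p. C j u * (c * l u) else 0)
      + (if i = 0 \<and> j = 0 then c\<^sup>2 + s else 0)" if r: "r < 2" for c C r i j
  proof -
    have hq: "(\<lambda>n. \<Sum>u<p. C i u * (c * h n u + q r n u)) \<longlonglongrightarrow> (\<Sum>u<p. C i u * (c * l u + 0))" for i
    proof -
      have q0: "(\<lambda>n. q r n u) \<longlonglongrightarrow> 0" if "u < p" for u
        unfolding q_def by (rule noise_regressor[OF _ r]) (use that in simp)
      have h0: "(\<lambda>n. h n u) \<longlonglongrightarrow> l u" if "u < p" for u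
        unfolding h_def by (rule avg_mean_tendsto[OF that])
      show ?thesis by (intro tendsto_sum tendsto_mult tendsto_add tendsto_const h0 q0) auto
    qed
    have "(\<lambda>n. c\<^sup>2 + 2 * c * avg n (\<lambda>k. e (2 * k + r)) + avg n (\<lambda>k. (e (2 * k + r))\<^sup>2)) \<longlonglongrightarrow> c\<^sup>2 + 2 * c * 0 + s"
      by (intro tendsto_add tendsto_mult tendsto_const noise_mean noise_square r)
    then show ?thesis unfolding rest_def using hq by (intro tendsto_add) auto
  qed
  \<comment> \<open>The last term subtracts the forcing that the equation for \<open>m\<close>
    prescribes, so that the remainder tends to 0 exactly because \<open>m_eq\<close> holds.\<close>
  define R where "R n i j = (rest (a 0) (companion_fn a) 0 n i j + rest (b 0) (companion_fn b) 1 n i j) / 2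
      - (m i j - congr_op m i j)" for n i j
  have "(\<lambda>n. V n i j - m i j) \<longlonglongrightarrow> 0"
  proof (rule congr_op_recursion_tendsto_0[OF _ _ ij])
    fix n i j assume n: "n \<ge> p - 1" and ij: "i < p" "j < p"
    have 1: "avg n (\<lambda>k. y (2 * k) (Suc i) * y (2 * k) (Suc j))
        = (\<Sum>u<p. \<Sum>v<p. companion_fn a i u * V n u v * companion_fn a j v) + rest (a 0) (companion_fn a) 0 n i j"
      using avg_product_split[of n "\<lambda>k i. y (2 * k) (Suc i)" i "companion_fn a" "a 0" "\<lambda>k. e (2 * k)" j]
        y_even[OF generation_ge[OF _ n]] ij
      by (simp add: V_def rest_def h_def q_def)
    have 2: "avg n (\<lambda>k. y (2 * k + 1) (Suc i) * y (2 * k + 1) (Suc j))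
        = (\<Sum>u<p. \<Sum>v<p. companion_fn b i u * V n u v * companion_fn b j v) + rest (b 0) (companion_fn b) 1 n i j"
      using avg_product_split[of n "\<lambda>k i. y (2 * k + 1) (Suc i)" i "companion_fn b" "b 0" "\<lambda>k. e (2 * k + 1)" j]
        y_odd[OF generation_ge[OF _ n]] ij
      by (simp add: V_def rest_def h_def q_def)
    have "V (Suc n) i j = congr_op (V n) i j + (rest (a 0) (companion_fn a) 0 n i j + rest (b 0) (companion_fn b) 1 n i j) / 2"
      unfolding V_def[of "Suc n"] avg_Suc 1 2 congr_op_def by (simp add: field_simps)
    then show "V (Suc n) i j - m i j = congr_op (\<lambda>i j. V n i j - m i j) i j + R n i j"
      unfolding congr_op_diff R_def by simp
  next
    fix i j assume ij: "i < p" "j < p"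
    have "(\<lambda>n. R n i j) \<longlonglongrightarrow> (((if j = 0 then \<Sum>u<p. companion_fn a i u * (a 0 * l u) else 0)
        + (if i = 0 then \<Sum>u<p. companion_fn a j u * (a 0 * l u) else 0) + (if i = 0 \<and> j = 0 then (a 0)\<^sup>2 + s else 0))
      + ((if j = 0 then \<Sum>u<p. companion_fn b i u * (b 0 * l u) else 0)
        + (if i = 0 then \<Sum>u<p. companion_fn b j u * (b 0 * l u) else 0) + (if i = 0 \<and> j = 0 then (b 0)\<^sup>2 + s else 0))) / 2
      - (m i j - congr_op m i j)"
      unfolding R_def by (intro tendsto_diff tendsto_divide tendsto_add tendsto_const rest_lim) auto
    moreover have c: "(\<Sum>u<p. C i u * (c * l u)) = c * (\<Sum>u<p. C i u * l u)" for C :: "nat \<Rightarrow> nat \<Rightarrow> real" and c i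
      by (simp add: sum_distrib_left mult_ac)
    ultimately show "(\<lambda>n. R n i j) \<longlonglongrightarrow> 0"
      unfolding c using m_eq[OF ij] by (auto simp: field_simps split: if_splits)
  qed
  then show ?thesis unfolding V_def by (simp add: LIM_zero_iff)
qed

section \<open>The limiting quadratic form and its definiteness\<close>

definition L :: "nat \<Rightarrow> nat \<Rightarrow> real" where "L = block_limit l m"

lemma avg_product_tendsto:
  assumes "i \<le> p" "j \<le> p"
  shows "(\<lambda>n. avg n (\<lambda>k. y k i * y k j)) \<longlonglongrightarrow> L i j"
  using assms avg_mean_tendsto avg_product_tendsto_core
  by (cases i; cases j) (simp_all add: L_def block_limit_def avg_const)

lemma L_sym: "i \<le> p \<Longrightarrow> j \<le> p \<Longrightarrow> L i j = L j i"
  using LIMSEQ_unique[OF avg_product_tendsto[of i j]] avg_product_tendsto[of j i] by (simp add: mult.commute)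

definition qf :: "(nat \<Rightarrow> real) \<Rightarrow> real" where
  "qf u = (\<Sum>i\<le>p. \<Sum>j\<le>p. u i * L i j * u j)"

lemma qf_tendsto: "(\<lambda>n. avg n (\<lambda>k. (\<Sum>i\<le>p. u i * y k i)\<^sup>2)) \<longlonglongrightarrow> qf u"
proof -
  have "(\<Sum>i\<le>p. u i * y k i)\<^sup>2 = (\<Sum>i\<le>p. \<Sum>j\<le>p. (u i * u j) * (y k i * y k j))" for k
    unfolding power2_eq_square sum_product by (simp add: mult_ac)
  then have eq: "avg n (\<lambda>k. (\<Sum>i\<le>p. u i * y k i)\<^sup>2) = (\<Sum>i\<le>p. \<Sum>j\<le>p. (u i * u j) * avg n (\<lambda>k. y k i * y k j))" for n
    by (simp only: avg_sum avg_cmult)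
  have "(\<lambda>n. \<Sum>i\<le>p. \<Sum>j\<le>p. (u i * u j) * avg n (\<lambda>k. y k i * y k j)) \<longlonglongrightarrow> (\<Sum>i\<le>p. \<Sum>j\<le>p. (u i * u j) * L i j)"
    by (intro tendsto_sum tendsto_mult tendsto_const avg_product_tendsto) auto
  then show ?thesis unfolding eq by (simp add: qf_def mult_ac)
qed

lemma qf_nonneg: "0 \<le> qf u"
  by (rule LIMSEQ_le_const[OF qf_tendsto]) (auto simp: avg_def intro!: divide_nonneg_nonneg sum_nonneg)

text \<open>The adjoint of the affine map from a mother's regressor to a daughter's: pairing u with
  the daughter equals pairing \<open>transport c u\<close> with the mother, up to \<open>u 1\<close>
  times the noise.\<close>

definition transport :: "(nat \<Rightarrow> real) \<Rightarrow> (nat \<Rightarrow> real) \<Rightarrow> nat \<Rightarrow> real" where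
  "transport c u j = (case j of 0 \<Rightarrow> u 0 + c 0 * u 1 | Suc j' \<Rightarrow> (\<Sum>i<p. companion_fn c i j' * u (Suc i)))"

lemma transport_y:
  assumes "\<And>i. i < p \<Longrightarrow> z (Suc i) = (\<Sum>j<p. companion_fn c i j * y k (Suc j)) + (if i = 0 then c 0 + w else 0)" "z 0 = 1"
  shows "(\<Sum>i\<le>p. u i * z i) = (\<Sum>i\<le>p. transport c u i * y k i) + u 1 * w"
proof -
  have split: "(\<Sum>i\<le>p. f i) = f 0 + (\<Sum>i<p. f (Suc i))" for f :: "nat \<Rightarrow> real"
    by (simp add: sum.atMost_shift)
  have "(\<Sum>i<p. u (Suc i) * z (Suc i)) = (\<Sum>i<p. u (Suc i) * (\<Sum>j<p. companion_fn c i j * y k (Suc j)))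
      + (\<Sum>i<p. if i = 0 then u 1 * (c 0 + w) else 0)"
    unfolding sum.distrib[symmetric] by (intro sum.cong) (auto simp: assms distrib_left)
  also have "(\<Sum>i<p. if i = 0 then u 1 * (c 0 + w) else 0) = u 1 * (c 0 + w)"
    using p_pos by simp
  also have "(\<Sum>i<p. u (Suc i) * (\<Sum>j<p. companion_fn c i j * y k (Suc j))) = (\<Sum>j<p. transport c u (Suc j) * y k (Suc j))"
    by (subst lincomb_sum_swap) (simp add: transport_def)
  finally show ?thesis unfolding split assms(2) by (simp add: transport_def algebra_simps)
qed

text \<open>Not a computation with the equations for lambda and ell: both sides are limits of
  averages of the squared linear form, the left side over a generation and the right side over its
  mothers. Averages of noise times regressor vanish, and averages of squared noise give
  \<open>s\<close>.\<close>

lemma qf_fixed_point: "qf u = (qf (transport a u) + qf (transport b u)) / 2 + s * (u 1)\<^sup>2"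
proof -
  have half: "(\<lambda>n. avg n (\<lambda>k. (\<Sum>i\<le>p. v i * y k i + 0)\<^sup>2 + (2 * u 1) * (\<Sum>i\<le>p. v i * (e (2 * k + r) * y k i)) + (u 1)\<^sup>2 * (e (2 * k + r))\<^sup>2))
      \<longlonglongrightarrow> qf v + (2 * u 1) * (\<Sum>i\<le>p. v i * 0) + (u 1)\<^sup>2 * s" if "r < 2" for v r
    unfolding avg_add avg_cmult avg_sum add_0_right
    by (intro tendsto_add tendsto_mult tendsto_sum tendsto_const qf_tendsto noise_regressor noise_square that) auto
  have exp: "(z + u 1 * w)\<^sup>2 = z\<^sup>2 + (2 * u 1) * (w * z) + (u 1)\<^sup>2 * w\<^sup>2" for z w
    by (simp add: power2_eq_square algebra_simps)
  have pull: "w * (\<Sum>i\<le>p. v i * y k i) = (\<Sum>i\<le>p. v i * (w * y k i))" for w v k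
    by (simp add: sum_distrib_left mult_ac)
  have ev: "avg n (\<lambda>k. (\<Sum>i\<le>p. u i * y (2 * k) i)\<^sup>2) = avg n (\<lambda>k. (\<Sum>i\<le>p. transport a u i * y k i + 0)\<^sup>2
      + (2 * u 1) * (\<Sum>i\<le>p. transport a u i * (e (2 * k + 0) * y k i)) + (u 1)\<^sup>2 * (e (2 * k + 0))\<^sup>2)"
    if n: "n \<ge> p - 1" for n
  proof (rule avg_cong)
    fix k assume "k \<in> generation n"
    then have k: "k \<ge> 2 ^ (p - 1)" using n by (rule generation_ge)
    have "(\<Sum>i\<le>p. u i * y (2 * k) i) = (\<Sum>i\<le>p. transport a u i * y k i) + u 1 * e (2 * k)"
      by (rule transport_y) (rule y_even[OF k], simp_all)
    then show "(\<Sum>i\<le>p. u i * y (2 * k) i)\<^sup>2 = (\<Sum>i\<le>p. transport a u i * y k i + 0)\<^sup>2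
      + (2 * u 1) * (\<Sum>i\<le>p. transport a u i * (e (2 * k + 0) * y k i)) + (u 1)\<^sup>2 * (e (2 * k + 0))\<^sup>2"
      by (simp only: exp pull add_0_right)
  qed
  have od: "avg n (\<lambda>k. (\<Sum>i\<le>p. u i * y (2 * k + 1) i)\<^sup>2) = avg n (\<lambda>k. (\<Sum>i\<le>p. transport b u i * y k i + 0)\<^sup>2
      + (2 * u 1) * (\<Sum>i\<le>p. transport b u i * (e (2 * k + 1) * y k i)) + (u 1)\<^sup>2 * (e (2 * k + 1))\<^sup>2)"
    if n: "n \<ge> p - 1" for n
  proof (rule avg_cong)
    fix k assume "k \<in> generation n"
    then have k: "k \<ge> 2 ^ (p - 1)" using n by (rule generation_ge)
    have "(\<Sum>i\<le>p. u i * y (2 * k + 1) i) = (\<Sum>i\<le>p. transport b u i * y k i) + u 1 * e (2 * k + 1)"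
      by (rule transport_y) (rule y_odd[OF k], simp_all)
    then show "(\<Sum>i\<le>p. u i * y (2 * k + 1) i)\<^sup>2 = (\<Sum>i\<le>p. transport b u i * y k i + 0)\<^sup>2
      + (2 * u 1) * (\<Sum>i\<le>p. transport b u i * (e (2 * k + 1) * y k i)) + (u 1)\<^sup>2 * (e (2 * k + 1))\<^sup>2"
      by (simp only: exp pull add_0_right)
  qed
  define g where "g n = (avg n (\<lambda>k. (\<Sum>i\<le>p. transport a u i * y k i + 0)\<^sup>2
      + (2 * u 1) * (\<Sum>i\<le>p. transport a u i * (e (2 * k + 0) * y k i)) + (u 1)\<^sup>2 * (e (2 * k + 0))\<^sup>2)
    + avg n (\<lambda>k. (\<Sum>i\<le>p. transport b u i * y k i + 0)\<^sup>2
      + (2 * u 1) * (\<Sum>i\<le>p. transport b u i * (e (2 * k + 1) * y k i)) + (u 1)\<^sup>2 * (e (2 * k + 1))\<^sup>2)) / 2" for n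
  have "g \<longlonglongrightarrow> ((qf (transport a u) + (2 * u 1) * (\<Sum>i\<le>p. transport a u i * 0) + (u 1)\<^sup>2 * s)
      + (qf (transport b u) + (2 * u 1) * (\<Sum>i\<le>p. transport b u i * 0) + (u 1)\<^sup>2 * s)) / 2"
    unfolding g_def by (intro tendsto_divide tendsto_add[OF half half] tendsto_const) auto
  moreover have "\<forall>\<^sub>F n in sequentially. avg (Suc n) (\<lambda>k. (\<Sum>i\<le>p. u i * y k i)\<^sup>2) = g n"
    using eventually_ge_at_top[of "p - 1"] by eventually_elim (simp only: avg_Suc g_def ev od)
  ultimately have "(\<lambda>n. avg (Suc n) (\<lambda>k. (\<Sum>i\<le>p. u i * y k i)\<^sup>2)) \<longlonglongrightarrow>
     ((qf (transport a u) + (2 * u 1) * (\<Sum>i\<le>p. transport a u i * 0) + (u 1)\<^sup>2 * s)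
      + (qf (transport b u) + (2 * u 1) * (\<Sum>i\<le>p. transport b u i * 0) + (u 1)\<^sup>2 * s)) / 2"
    by (simp only: filterlim_cong)
  from LIMSEQ_unique[OF LIMSEQ_Suc[OF qf_tendsto[of u]] this] show ?thesis by (simp add: field_simps)
qed

text \<open>
  A null vector of the form has vanishing second coordinate, and the companion structure shifts the
  other coordinates into that place one at a time.
\<close>

lemma qf_definite:
  assumes "qf u = 0" "i \<le> p"
  shows "u i = 0"
proof -
  \<comment> \<open>Only the first n coordinates after the constant one may still be nonzero. The
    statement quantifies over u because the induction hypothesis is applied to the transported
    vector.\<close>
  have "\<forall>u. qf u = 0 \<and> (\<forall>i. n \<le> i \<and> i < p \<longrightarrow> u (Suc i) = 0) \<longrightarrow> (\<forall>i\<le>p. u i = 0)" for n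
  proof (induction n)
    case 0
    show ?case
    proof (intro allI impI)
      fix u i assume u: "qf u = 0 \<and> (\<forall>i. 0 \<le> i \<and> i < p \<longrightarrow> u (Suc i) = 0)" and i: "i \<le> p"
      have z: "u j = 0" if "j \<le> p" "j \<noteq> 0" for j using u that by (cases j) auto
      \<comment> \<open>With only the constant coordinate left, the form is the square of
        \<open>u 0\<close>, the corner entry of L being 1.\<close>
      have "qf u = (\<Sum>i\<le>p. \<Sum>j\<le>p. if j = 0 then (if i = 0 then (u 0)\<^sup>2 else 0) else 0)"
        unfolding qf_def
        by (intro sum.cong refl) (auto simp: z L_def block_limit_def power2_eq_square)
      also have "\<dots> = (u 0)\<^sup>2" by simp
      finally have "u 0 = 0" using u by simp
      then show "u i = 0" using z[OF i] by (cases "i = 0") auto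
    qed
  next
    case (Suc n)
    show ?case
    proof (intro allI impI)
      fix u i assume u: "qf u = 0 \<and> (\<forall>i. Suc n \<le> i \<and> i < p \<longrightarrow> u (Suc i) = 0)" and i: "i \<le> p"
      have "0 \<le> s * (u 1)\<^sup>2" using s_pos by simp
      moreover have "qf u = 0" using u by blast
      moreover have "X = 0 \<and> Z = 0" if "0 \<le> Z" "W = 0" "W = (X + Y) / 2 + Z" "0 \<le> X" "0 \<le> Y" for W X Y Z :: real
        using that by (simp add: field_simps)
      ultimately have "qf (transport a u) = 0 \<and> s * (u 1)\<^sup>2 = 0"
        using qf_fixed_point[of u] qf_nonneg[of "transport a u"] qf_nonneg[of "transport b u"] by blast
      then have *: "qf (transport a u) = 0" "s * (u 1)\<^sup>2 = 0" by blast+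
      then have u1: "u 1 = 0" using s_pos by simp
      \<comment> \<open>As \<open>u 1\<close> vanishes, the row of coefficients drops out and only
        the subdiagonal of the companion matrix acts, shifting the coordinates down by one.\<close>
      have tr: "transport a u (Suc j) = (if Suc j < p then u (Suc (Suc j)) else 0)" for j
      proof -
        have "(\<Sum>i<p. companion_fn a i j * u (Suc i)) = (\<Sum>i<p. if i = Suc j then u (Suc i) else 0)"
          using u1 by (intro sum.cong) (auto simp: companion_fn_def)
        then show ?thesis by (simp add: transport_def)
      qed
      have tr0: "transport a u 0 = u 0" using u1 by (simp add: transport_def)
      have "\<forall>i. n \<le> i \<and> i < p \<longrightarrow> transport a u (Suc i) = 0" using u by (auto simp: tr)
      then have z: "\<forall>i\<le>p. transport a u i = 0" using Suc.IH *(1) by blast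
      show "u i = 0"
      proof (cases i)
        case 0 then show ?thesis using z tr0 by auto
      next
        case (Suc j)
        show ?thesis
        proof (cases j)
          case 0 then show ?thesis using u1 Suc by simp
        next
          case (Suc k)
          then show ?thesis using z[rule_format, of "Suc k"] tr[of k] \<open>i = Suc j\<close> i by auto
        qed
      qed
    qed
  qed
  from this[of p] show ?thesis using assms by auto
qed

end

section \<open>Perturbation of the inverse covariance\<close>

definition norm1 :: "nat \<Rightarrow> (nat \<Rightarrow> real) \<Rightarrow> real" where "norm1 d x = (\<Sum>i<d. \<bar>x i\<bar>)"

definition entry_sum :: "nat \<Rightarrow> (nat \<Rightarrow> nat \<Rightarrow> real) \<Rightarrow> real" where
  "entry_sum d A = (\<Sum>i<d. \<Sum>j<d. \<bar>A i j\<bar>)"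

lemma norm1_nonneg: "0 \<le> norm1 d x" by (simp add: norm1_def sum_nonneg)

lemma entry_sum_nonneg: "0 \<le> entry_sum d x" by (simp add: entry_sum_def sum_nonneg)

lemma norm1_coord: "i < d \<Longrightarrow> \<bar>x i\<bar> \<le> norm1 d x"
  unfolding norm1_def by (rule member_le_sum) auto

lemma norm1_add: "norm1 d (\<lambda>i. x i + y i) \<le> norm1 d x + norm1 d y"
  unfolding norm1_def sum.distrib[symmetric] by (intro sum_mono abs_triangle_ineq)

lemma norm1_mult: "norm1 d (\<lambda>i. \<Sum>j<d. A i j * x j) \<le> entry_sum d A * norm1 d x"
proof -
  have "\<bar>\<Sum>j<d. A i j * x j\<bar> \<le> (\<Sum>j<d. \<bar>A i j\<bar> * norm1 d x)" for i
    by (rule order_trans[OF sum_abs]) (auto intro!: sum_mono mult_left_mono norm1_coord simp: abs_mult)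
  then have "norm1 d (\<lambda>i. \<Sum>j<d. A i j * x j) \<le> (\<Sum>i<d. \<Sum>j<d. \<bar>A i j\<bar> * norm1 d x)"
    unfolding norm1_def[of d "\<lambda>i. \<Sum>j<d. A i j * x j"] by (rule sum_mono)
  then show ?thesis by (simp add: entry_sum_def sum_distrib_right)
qed

lemma bilinear_bound: "\<bar>\<Sum>i<d. \<Sum>j<d. x i * A i j * y j\<bar> \<le> entry_sum d A * (norm1 d x * norm1 d y)"
proof -
  have "\<bar>\<Sum>i<d. \<Sum>j<d. x i * A i j * y j\<bar> \<le> (\<Sum>i<d. \<Sum>j<d. \<bar>x i * A i j * y j\<bar>)"
    by (rule order_trans[OF sum_abs]) (intro sum_mono sum_abs)
  also have "\<dots> \<le> (\<Sum>i<d. \<Sum>j<d. norm1 d x * \<bar>A i j\<bar> * norm1 d y)"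
    by (intro sum_mono) (auto simp: abs_mult intro!: mult_mono norm1_coord mult_nonneg_nonneg norm1_nonneg)
  also have "\<dots> = entry_sum d A * (norm1 d x * norm1 d y)"
    unfolding entry_sum_def sum_distrib_right by (intro sum.cong refl) (simp add: mult_ac)
  finally show ?thesis .
qed

lemma norm1_square_le: "(norm1 d x)\<^sup>2 \<le> real d * (\<Sum>i<d. (x i)\<^sup>2)"
  using sum_squared_le_sum_of_squares[of "\<lambda>i. \<bar>x i\<bar>" "{..<d}"] by (simp add: norm1_def mult.commute)

lemma sum_squares_le_norm1: "(\<Sum>i<d. (x i)\<^sup>2) \<le> (norm1 d x)\<^sup>2"
proof -
  have "(\<Sum>i<d. (x i)\<^sup>2) \<le> (\<Sum>i<d. \<bar>x i\<bar> * norm1 d x)"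
  proof (rule sum_mono)
    fix i assume "i \<in> {..<d}"
    then have "\<bar>x i\<bar> * \<bar>x i\<bar> \<le> \<bar>x i\<bar> * norm1 d x" by (intro mult_left_mono norm1_coord) auto
    then show "(x i)\<^sup>2 \<le> \<bar>x i\<bar> * norm1 d x" by (simp add: power2_eq_square)
  qed
  then show ?thesis by (simp add: norm1_def sum_distrib_right power2_eq_square)
qed

text \<open>
  With \<open>K = L\<^sup>-\<^sup>1\<close>, the relation \<open>S w = r\<close> reads \<open>w = K r + K (L - S) w\<close>, so that \<open>w\<close> is comparable to
  \<open>K r\<close> and \<open>w\<^sup>t L w\<close> to \<open>r\<^sup>t K r\<close> as soon as \<open>S\<close> is close to \<open>L\<close>.
\<close>

locale near_inverse =
  fixes d :: nat and L K :: "nat \<Rightarrow> nat \<Rightarrow> real"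
  assumes KL: "\<And>i j. i < d \<Longrightarrow> j < d \<Longrightarrow> (\<Sum>k<d. K i k * L k j) = (if i = j then 1 else 0)"
    and LK: "\<And>i j. i < d \<Longrightarrow> j < d \<Longrightarrow> (\<Sum>k<d. L i k * K k j) = (if i = j then 1 else 0)"
begin

definition err :: "(nat \<Rightarrow> nat \<Rightarrow> real) \<Rightarrow> nat \<Rightarrow> nat \<Rightarrow> real" where
  "err S i j = (\<Sum>k<d. K i k * (L k j - S k j))"

lemma apply_KL:
  assumes "i < d"
  shows "(\<Sum>k<d. K i k * (\<Sum>j<d. L k j * x j)) = x i" "(\<Sum>k<d. L i k * (\<Sum>j<d. K k j * x j)) = x i"
proof -
  have 1: "(\<Sum>k<d. P i k * (\<Sum>j<d. Q k j * x j)) = (\<Sum>j<d. (\<Sum>k<d. P i k * Q k j) * x j)" for P Q :: "nat \<Rightarrow> nat \<Rightarrow> real"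
    unfolding sum_distrib_left sum_distrib_right by (subst sum.swap) (simp add: mult_ac)
  have 2: "(\<Sum>j<d. (if i = j then 1 else 0) * x j) = x i" using assms by (simp add: if_distrib[of "\<lambda>u. u * _"] cong: if_cong)
  show "(\<Sum>k<d. K i k * (\<Sum>j<d. L k j * x j)) = x i"
    unfolding 1 2[symmetric] by (intro sum.cong) (use KL assms in auto)
  show "(\<Sum>k<d. L i k * (\<Sum>j<d. K k j * x j)) = x i"
    unfolding 1 2[symmetric] by (intro sum.cong) (use LK assms in auto)
qed

lemma solution_eq:
  assumes "\<And>i. i < d \<Longrightarrow> (\<Sum>j<d. S i j * w j) = r i" "i < d"
  shows "w i = (\<Sum>k<d. K i k * r k) + (\<Sum>j<d. err S i j * w j)"
proof -
  have "(\<Sum>j<d. err S i j * w j) = (\<Sum>k<d. K i k * (\<Sum>j<d. (L k j - S k j) * w j))"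
    unfolding err_def sum_distrib_left sum_distrib_right by (subst sum.swap) (simp add: mult_ac)
  also have "\<dots> = (\<Sum>k<d. K i k * (\<Sum>j<d. L k j * w j)) - (\<Sum>k<d. K i k * (\<Sum>j<d. S k j * w j))"
    by (simp only: left_diff_distrib sum_subtractf right_diff_distrib)
  also have "(\<Sum>k<d. K i k * (\<Sum>j<d. S k j * w j)) = (\<Sum>k<d. K i k * r k)"
    using assms(1) by (intro sum.cong) auto
  also have "(\<Sum>k<d. K i k * (\<Sum>j<d. L k j * w j)) = w i" by (rule apply_KL(1)[OF assms(2)])
  finally show ?thesis by simp
qed

text \<open>The error term costs at most half the norm of w and is absorbed in the left
  side.\<close>

lemma solution_norm:
  assumes "\<And>i. i < d \<Longrightarrow> (\<Sum>j<d. S i j * w j) = r i" and small: "entry_sum d (err S) \<le> 1/2"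
  shows "norm1 d w \<le> 2 * entry_sum d K * norm1 d r"
proof -
  have "norm1 d w = norm1 d (\<lambda>i. (\<Sum>k<d. K i k * r k) + (\<Sum>j<d. err S i j * w j))"
    unfolding norm1_def using solution_eq[of S w r] assms(1) by (intro sum.cong) auto
  also have "\<dots> \<le> entry_sum d K * norm1 d r + entry_sum d (err S) * norm1 d w"
    by (rule order_trans[OF norm1_add]) (intro add_mono norm1_mult)
  also have "entry_sum d (err S) * norm1 d w \<le> 1/2 * norm1 d w"
    using small norm1_nonneg by (rule mult_right_mono)
  finally show ?thesis by simp
qed

text \<open>With u = K r and z the error part of w, the form splits as w L w = u L u + z L w + u L
  z, and u L u is the form of K at r. Both w and the factor of z are bounded by 2 |K| |r|, hence the
  constant 4 + 2 = 6.\<close>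

lemma form_error:
  assumes eq: "\<And>i. i < d \<Longrightarrow> (\<Sum>j<d. S i j * w j) = r i" and small: "entry_sum d (err S) \<le> 1/2"
  shows "\<bar>(\<Sum>i<d. \<Sum>j<d. w i * L i j * w j) - (\<Sum>i<d. \<Sum>j<d. K i j * (r i * r j))\<bar>
    \<le> entry_sum d (err S) * (6 * entry_sum d L * (entry_sum d K)\<^sup>2 * real d * (\<Sum>i<d. (r i)\<^sup>2))"
proof -
  define u where "u i = (\<Sum>k<d. K i k * r k)" for i
  define z where "z i = (\<Sum>j<d. err S i j * w j)" for i
  let ?b = "\<lambda>x y. \<Sum>i<d. \<Sum>j<d. x i * L i j * y j"
  let ?cL = "entry_sum d L" and ?cK = "entry_sum d K" and ?h = "entry_sum d (err S)" and ?R = "norm1 d r"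
  have w: "w i = u i + z i" if "i < d" for i unfolding u_def z_def by (rule solution_eq[OF eq that])
  have nw: "norm1 d w \<le> 2 * ?cK * ?R" by (rule solution_norm[OF eq small])
  have nu: "norm1 d u \<le> ?cK * ?R" unfolding u_def by (rule norm1_mult)
  have "norm1 d z \<le> ?h * norm1 d w" unfolding z_def by (rule norm1_mult)
  also have "\<dots> \<le> ?h * (2 * ?cK * ?R)" using nw entry_sum_nonneg by (rule mult_left_mono)
  finally have nz: "norm1 d z \<le> ?h * (2 * ?cK * ?R)" .
  have "?b w w = ?b u u + ?b z w + ?b u z"
  proof -
    have "?b w w = (\<Sum>i<d. \<Sum>j<d. u i * L i j * u j + z i * L i j * w j + u i * L i j * z j)"
      by (intro sum.cong refl) (simp add: w algebra_simps)
    then show ?thesis by (simp add: sum.distrib)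
  qed
  moreover have "?b u u = (\<Sum>i<d. \<Sum>j<d. K i j * (r i * r j))"
  proof -
    have "?b u u = (\<Sum>i<d. u i * (\<Sum>j<d. L i j * u j))" by (simp add: sum_distrib_left mult.assoc)
    also have "\<dots> = (\<Sum>i<d. u i * r i)" unfolding u_def by (intro sum.cong) (auto simp: apply_KL(2))
    also have "\<dots> = (\<Sum>i<d. \<Sum>j<d. K i j * (r i * r j))" unfolding u_def by (simp add: sum_distrib_right sum_distrib_left mult_ac)
    finally show ?thesis .
  qed
  ultimately have "\<bar>?b w w - (\<Sum>i<d. \<Sum>j<d. K i j * (r i * r j))\<bar> \<le> \<bar>?b z w\<bar> + \<bar>?b u z\<bar>" by linarith
  also have "\<dots> \<le> ?cL * (norm1 d z * norm1 d w) + ?cL * (norm1 d u * norm1 d z)"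
    by (intro add_mono bilinear_bound)
  also have "\<dots> \<le> ?cL * ((?h * (2 * ?cK * ?R)) * (2 * ?cK * ?R)) + ?cL * ((?cK * ?R) * (?h * (2 * ?cK * ?R)))"
    by (intro add_mono mult_left_mono mult_mono nw nu nz entry_sum_nonneg mult_nonneg_nonneg norm1_nonneg) auto
  also have "\<dots> = ?h * (6 * ?cL * ?cK\<^sup>2 * ?R\<^sup>2)" by (simp add: power2_eq_square algebra_simps)
  also have "\<dots> \<le> ?h * (6 * ?cL * ?cK\<^sup>2 * (real d * (\<Sum>i<d. (r i)\<^sup>2)))"
    by (intro mult_left_mono norm1_square_le mult_nonneg_nonneg entry_sum_nonneg) auto
  finally show ?thesis by (simp add: mult.assoc)
qed

lemma kernel_trivial:
  assumes "\<And>i. i < d \<Longrightarrow> (\<Sum>j<d. S i j * w j) = 0" "entry_sum d (err S) \<le> 1/2" "i < d"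
  shows "w i = 0"
  using solution_norm[of S w "\<lambda>_. 0"] norm1_coord[of i d w] assms by (simp add: norm1_def)

lemma err_tendsto:
  assumes "\<And>i j. i < d \<Longrightarrow> j < d \<Longrightarrow> (\<lambda>n. S n i j) \<longlonglongrightarrow> L i j"
  shows "(\<lambda>n. entry_sum d (err (S n))) \<longlonglongrightarrow> 0"
proof -
  have "(\<lambda>n. entry_sum d (err (S n))) \<longlonglongrightarrow> (\<Sum>i<d. \<Sum>j<d. \<bar>\<Sum>k<d. K i k * (L k j - L k j)\<bar>)"
    unfolding entry_sum_def err_def
    by (intro tendsto_sum tendsto_rabs tendsto_mult tendsto_diff tendsto_const assms) auto
  then show ?thesis by simp
qed

text \<open>The means of the forms of K at r converge to the trace of K (s L), which is s d. The
  difference of the two forms is o(1) times |r|^2, and |r|^2 is bounded only in mean. A single |r|^2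
  is at most a whole partial sum, so it grows at most linearly, which is the second claim.\<close>

lemma mean_form_tendsto:
  assumes S: "\<And>i j. i < d \<Longrightarrow> j < d \<Longrightarrow> (\<lambda>n. S n i j) \<longlonglongrightarrow> L i j"
    and eq: "\<And>n i. n \<ge> n1 \<Longrightarrow> i < d \<Longrightarrow> (\<Sum>j<d. S n i j * w n j) = r n i"
    and mean: "\<And>i j. i < d \<Longrightarrow> j < d \<Longrightarrow> (\<lambda>n. (\<Sum>k<n. r k i * r k j) / real n) \<longlonglongrightarrow> s * L i j"
    and sym: "\<And>i j. i < d \<Longrightarrow> j < d \<Longrightarrow> L i j = L j i"
  shows "(\<lambda>n. (\<Sum>k<n. \<Sum>i<d. \<Sum>j<d. w k i * L i j * w k j) / real n) \<longlonglongrightarrow> s * real d"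
    and "\<exists>C n2. \<forall>n\<ge>n2. (\<Sum>i<d. (w n i)\<^sup>2) \<le> C * real n"
proof -
  define q where "q k = (\<Sum>i<d. (r k i)\<^sup>2)" for k
  define D where "D k = (\<Sum>i<d. \<Sum>j<d. w k i * L i j * w k j) - (\<Sum>i<d. \<Sum>j<d. K i j * (r k i * r k j))" for k
  let ?h = "\<lambda>n. entry_sum d (err (S n))"
  define c where "c = 6 * entry_sum d L * (entry_sum d K)\<^sup>2 * real d"
  have h: "?h \<longlonglongrightarrow> 0" by (rule err_tendsto[OF S])
  have "\<forall>\<^sub>F n in sequentially. ?h n < 1/2" by (rule order_tendstoD(2)[OF h]) simp
  then obtain n3 where n3: "\<And>n. n \<ge> n3 \<Longrightarrow> ?h n < 1/2" by (auto simp: eventually_sequentially)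
  have q0: "0 \<le> q k" for k by (simp add: q_def sum_nonneg)
  have c0: "0 \<le> c" unfolding c_def by (intro mult_nonneg_nonneg entry_sum_nonneg) auto
  have D: "\<bar>D k\<bar> \<le> ?h k * (c * q k)" if "k \<ge> max n1 n3" for k
    using form_error[of "S k" "w k" "r k"] eq[of k] n3[of k] that
    unfolding D_def c_def q_def by (simp add: mult.assoc)
  have "(\<lambda>n. \<Sum>i<d. (\<Sum>k<n. r k i * r k i) / real n) \<longlonglongrightarrow> (\<Sum>i<d. s * L i i)"
    by (intro tendsto_sum mean) auto
  moreover have "(\<Sum>i<d. (\<Sum>k<n. r k i * r k i) / real n) = (\<Sum>k<n. q k) / real n" for n
    unfolding q_def by (subst sum.swap) (simp add: sum_divide_distrib power2_eq_square)
  ultimately have "(\<lambda>n. (\<Sum>k<n. q k) / real n) \<longlonglongrightarrow> (\<Sum>i<d. s * L i i)" by simp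
  then obtain C0 where C0: "\<And>n. (\<Sum>k<n. q k) \<le> C0 * real n" using mean_bounded by blast
  define C where "C = max C0 0"
  have C: "0 \<le> C" by (simp add: C_def)
  have Cn: "(\<Sum>k<n. q k) \<le> C * real n" for n
    by (rule order_trans[OF C0]) (auto simp: C_def intro!: mult_right_mono)
  \<comment> \<open>The added 1 keeps the weight positive where \<open>q\<close> vanishes, and
    changes the linear bound on partial sums only by n.\<close>
  have "(\<lambda>n. (\<Sum>k<n. D k / (q k + 1) * (q k + 1)) / real n) \<longlonglongrightarrow> 0"
  proof (rule mean_vanishing_weights[where C = "C + 1"])
    show "(\<lambda>k. D k / (q k + 1)) \<longlonglongrightarrow> 0"
    proof (rule Lim_null_comparison)
      show "\<forall>\<^sub>F k in sequentially. norm (D k / (q k + 1)) \<le> ?h k * c"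
        using eventually_ge_at_top[of "max n1 n3"]
      proof eventually_elim
        case (elim k)
        have "\<bar>D k\<bar> \<le> ?h k * (c * q k)" by (rule D[OF elim])
        also have "\<dots> \<le> ?h k * (c * (q k + 1))" using c0 entry_sum_nonneg by (intro mult_left_mono) auto
        finally show ?case using q0[of k] by (simp add: pos_divide_le_eq mult.assoc)
      qed
      show "(\<lambda>k. ?h k * c) \<longlonglongrightarrow> 0" by (rule tendsto_mult_left_zero[OF h])
    qed
    show "0 \<le> q k + 1" for k using q0[of k] by simp
    show "(\<Sum>k<n. q k + 1) \<le> (C + 1) * real n" for n using Cn[of n] by (simp add: sum.distrib algebra_simps)
  qed
  moreover have "D k / (q k + 1) * (q k + 1) = D k" for k using q0[of k] by simp
  ultimately have D0: "(\<lambda>n. (\<Sum>k<n. D k) / real n) \<longlonglongrightarrow> 0" by simp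
  have "(\<lambda>n. \<Sum>i<d. \<Sum>j<d. K i j * ((\<Sum>k<n. r k i * r k j) / real n)) \<longlonglongrightarrow> (\<Sum>i<d. \<Sum>j<d. K i j * (s * L i j))"
    by (intro tendsto_sum tendsto_mult tendsto_const mean) auto
  \<comment> \<open>Symmetry of L turns the entrywise pairing of K and L into the trace of K
    L.\<close>
  also have "(\<Sum>i<d. \<Sum>j<d. K i j * (s * L i j)) = (\<Sum>i<d. s * (\<Sum>j<d. K i j * L j i))"
    unfolding sum_distrib_left by (intro sum.cong refl) (simp add: sym mult_ac)
  also have "\<dots> = s * real d" by (simp add: KL)
  also have "(\<lambda>n. \<Sum>i<d. \<Sum>j<d. K i j * ((\<Sum>k<n. r k i * r k j) / real n))
      = (\<lambda>n. (\<Sum>k<n. \<Sum>i<d. \<Sum>j<d. K i j * (r k i * r k j)) / real n)"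
  proof
    fix n
    have "(\<Sum>k<n. \<Sum>i<d. \<Sum>j<d. K i j * (r k i * r k j)) = (\<Sum>i<d. \<Sum>j<d. \<Sum>k<n. K i j * (r k i * r k j))"
      by (subst sum.swap, rule sum.cong[OF refl], rule sum.swap)
    then show "(\<Sum>i<d. \<Sum>j<d. K i j * ((\<Sum>k<n. r k i * r k j) / real n))
        = (\<Sum>k<n. \<Sum>i<d. \<Sum>j<d. K i j * (r k i * r k j)) / real n"
      by (simp add: sum_distrib_left sum_divide_distrib)
  qed
  finally have "(\<lambda>n. (\<Sum>k<n. D k) / real n + (\<Sum>k<n. \<Sum>i<d. \<Sum>j<d. K i j * (r k i * r k j)) / real n) \<longlonglongrightarrow> 0 + s * real d"
    by (intro tendsto_add D0)
  then show "(\<lambda>n. (\<Sum>k<n. \<Sum>i<d. \<Sum>j<d. w k i * L i j * w k j) / real n) \<longlonglongrightarrow> s * real d"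
    unfolding add_divide_distrib[symmetric] sum.distrib[symmetric] by (simp add: D_def)
  have "(\<Sum>i<d. (w n i)\<^sup>2) \<le> ((2 * entry_sum d K)\<^sup>2 * real d * C * 2) * real n" if n: "n \<ge> max 1 (max n1 n3)" for n
  proof -
    have "q n \<le> (\<Sum>k<Suc n. q k)" by (rule member_le_sum) (use q0 in auto)
    also have "\<dots> \<le> C * real (Suc n)" by (rule Cn)
    also have "\<dots> \<le> C * (2 * real n)" using C n by (intro mult_left_mono) auto
    finally have qn: "q n \<le> C * (2 * real n)" .
    have "(\<Sum>i<d. (w n i)\<^sup>2) \<le> (norm1 d (w n))\<^sup>2" by (rule sum_squares_le_norm1)
    also have "\<dots> \<le> (2 * entry_sum d K * norm1 d (r n))\<^sup>2"
      using solution_norm[of "S n" "w n" "r n"] eq[of n] n3[of n] n by (intro power_mono norm1_nonneg) auto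
    also have "\<dots> = (2 * entry_sum d K)\<^sup>2 * (norm1 d (r n))\<^sup>2" by (rule power_mult_distrib)
    also have "\<dots> \<le> (2 * entry_sum d K)\<^sup>2 * (real d * q n)"
      unfolding q_def by (intro mult_left_mono norm1_square_le) auto
    also have "\<dots> \<le> (2 * entry_sum d K)\<^sup>2 * (real d * (C * (2 * real n)))"
      by (intro mult_left_mono qn) auto
    finally show ?thesis by (simp only: mult_ac)
  qed
  then show "\<exists>C n2. \<forall>n\<ge>n2. (\<Sum>i<d. (w n i)\<^sup>2) \<le> C * real n" by blast
qed

end

section \<open>The process and its localization\<close>

lemma tree_iff: "k \<in> tree n \<longleftrightarrow> 1 \<le> k \<and> k < 2 ^ (n + 1)"
proof
  assume "k \<in> tree n"
  then obtain m where m: "m \<le> n" "2 ^ m \<le> k" "k < 2 ^ (m + 1)" by (auto simp: tree_def generation_iff)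
  have "(2::nat) ^ (m + 1) \<le> 2 ^ (n + 1)" using m by (intro power_increasing) auto
  moreover have "(1::nat) \<le> 2 ^ m" by simp
  ultimately show "1 \<le> k \<and> k < 2 ^ (n + 1)" using m by linarith
next
  assume k: "1 \<le> k \<and> k < 2 ^ (n + 1)"
  obtain m where m: "2 ^ m \<le> k" "k < 2 ^ (m + 1)" using ex_power_ivl1[of 2 k] k by auto
  have "(2::nat) ^ m < 2 ^ (n + 1)" using m k by linarith
  then have "m < n + 1" by (rule power_less_imp_less_exp[rotated]) simp
  then have "m \<le> n" by simp
  then show "k \<in> tree n" using m by (auto simp: tree_def generation_iff)
qed

text \<open>Convexity of the fourth power with weights t and 1 - t at the points x and z / (1 - t).
  The coefficient of x^4 stays t < 1, so a moment recursion based on it still contracts.\<close>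

lemma convex_power_four:
  fixes x z t :: real
  assumes t: "0 < t" "t < 1"
  shows "(t * x + z) ^ 4 \<le> t * x ^ 4 + z ^ 4 / (1 - t) ^ 3"
proof -
  have conv: "((1 - u) * v + u * w) ^ 4 \<le> (1 - u) * v ^ 4 + u * w ^ 4" if "0 \<le> u" "u \<le> 1" for u v w :: real
  proof -
    have sq: "((1 - u) * v + u * w)\<^sup>2 \<le> (1 - u) * v\<^sup>2 + u * w\<^sup>2" for v w :: real
    proof -
      have "(1 - u) * v\<^sup>2 + u * w\<^sup>2 - ((1 - u) * v + u * w)\<^sup>2 = u * (1 - u) * (v - w)\<^sup>2"
        by (simp add: power2_eq_square algebra_simps)
      also have "\<dots> \<ge> 0" using that by simp
      finally show ?thesis by simp
    qed
    have "((1 - u) * v + u * w) ^ 4 = (((1 - u) * v + u * w)\<^sup>2)\<^sup>2" by (simp add: power_mult[symmetric])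
    also have "\<dots> \<le> ((1 - u) * v\<^sup>2 + u * w\<^sup>2)\<^sup>2" by (intro power_mono sq) auto
    also have "\<dots> \<le> (1 - u) * (v\<^sup>2)\<^sup>2 + u * (w\<^sup>2)\<^sup>2" by (rule sq)
    finally show ?thesis by (simp add: power_mult[symmetric])
  qed
  have "(t * x + z) ^ 4 = ((1 - (1 - t)) * x + (1 - t) * (z / (1 - t))) ^ 4" using t by simp
  also have "\<dots> \<le> (1 - (1 - t)) * x ^ 4 + (1 - t) * (z / (1 - t)) ^ 4" using t by (intro conv) auto
  also have "(1 - t) * (z / (1 - t)) ^ 4 = z ^ 4 / (1 - t) ^ 3"
    using t by (simp add: power_divide eval_nat_numeral)
  finally show ?thesis by simp
qed

locale bar_process = prob_space M for M :: "'a measure" +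
  fixes X eps :: "nat \<Rightarrow> 'a \<Rightarrow> real" and a b :: "nat \<Rightarrow> real" and p :: nat
    and N :: "real Matrix.vec \<Rightarrow> real" and \<beta> s :: real
  assumes contr: "contracting_pair p N (companion_fn a) (companion_fn b) \<beta>"
    and X_rv: "\<And>n. n \<ge> 1 \<Longrightarrow> X n \<in> borel_measurable M"
    and eps_rv: "\<And>n. n \<ge> 2 ^ p \<Longrightarrow> eps n \<in> borel_measurable M"
    and BAR_even: "\<And>n. n \<ge> 2 ^ (p - 1) \<Longrightarrow>
      AE \<omega> in M. X (2 * n) \<omega> =
        a 0 + (\<Sum>k = 1..p. a k * X (n div 2 ^ (k - 1)) \<omega>) + eps (2 * n) \<omega>"
    and BAR_odd: "\<And>n. n \<ge> 2 ^ (p - 1) \<Longrightarrow>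
      AE \<omega> in M. X (2 * n + 1) \<omega> =
        b 0 + (\<Sum>k = 1..p. b k * X (n div 2 ^ (k - 1)) \<omega>) + eps (2 * n + 1) \<omega>"
    and initial: "\<And>k. 1 \<le> k \<Longrightarrow> k \<le> 2 ^ p - 1 \<Longrightarrow> integrable M (\<lambda>\<omega>. X k \<omega> ^ 8)"
    and s_pos: "0 < s"
    and eps_mean: "\<And>n k. n \<ge> p - 1 \<Longrightarrow> k \<in> generation (n + 1) \<Longrightarrow>
      AE \<omega> in M. real_cond_exp M (natural_filtration M X n) (eps k) \<omega> = 0"
    and eps_var: "\<And>n k. n \<ge> p - 1 \<Longrightarrow> k \<in> generation (n + 1) \<Longrightarrow>
      AE \<omega> in M. real_cond_exp M (natural_filtration M X n) (\<lambda>\<omega>. (eps k \<omega>)\<^sup>2) \<omega> = s"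
    and eps_indep: "\<And>n. n \<ge> p - 1 \<Longrightarrow>
      cond_indep_vars M (natural_filtration M X n) borel (sister_noise eps) (generation n)"
    and eps_fourth: "\<And>n k. n \<ge> p - 1 \<Longrightarrow> k \<in> generation (n + 1) \<Longrightarrow>
      integrable M (\<lambda>\<omega>. eps k \<omega> ^ 4)"
    and eps_sup: "AE \<omega> in M.
      (SUP n \<in> {p - 1..}. SUP k \<in> generation (n + 1).
         ereal (real_cond_exp M (natural_filtration M X n) (\<lambda>\<omega>. eps k \<omega> ^ 4) \<omega>)) < \<infinity>"
begin

interpretation cp: contracting_pair p N "companion_fn a" "companion_fn b" \<beta> by (rule contr)

abbreviation F :: "nat \<Rightarrow> 'a measure" where "F \<equiv> natural_filtration M X"

text \<open>
  Replacing the noise by the residual changes it on a null set only, and makes the recursion hold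
  everywhere and the noise adapted to the filtration.
\<close>

definition e :: "nat \<Rightarrow> 'a \<Rightarrow> real" where
  "e k \<omega> = X k \<omega> - (if even k then a 0 + (\<Sum>j = 1..p. a j * X (k div 2 div 2 ^ (j - 1)) \<omega>)
     else b 0 + (\<Sum>j = 1..p. b j * X (k div 2 div 2 ^ (j - 1)) \<omega>))"

abbreviation y :: "nat \<Rightarrow> nat \<Rightarrow> 'a \<Rightarrow> real" where
  "y k i \<omega> \<equiv> regressor (\<lambda>k. X k \<omega>) k i"

lemma recursion: "bar_recursion p N a b \<beta> (\<lambda>k. X k \<omega>) (\<lambda>k. e k \<omega>)"
  by unfold_locales (simp_all add: e_def)

lemma child_generation: "k \<in> generation n \<Longrightarrow> r < 2 \<Longrightarrow> 2 * k + r \<in> generation (n + 1)"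
  by (auto simp: generation_iff)

lemma child_ge: "k \<in> generation n \<Longrightarrow> n \<ge> p - 1 \<Longrightarrow> 2 * k + r \<ge> 2 ^ p"
proof -
  assume "k \<in> generation n" "n \<ge> p - 1"
  then have "k \<ge> 2 ^ (p - 1)" by (rule generation_ge)
  moreover have "(2::nat) ^ p = 2 * 2 ^ (p - 1)" using cp.p_pos by (cases p) auto
  ultimately show ?thesis by simp
qed

lemma e_eq_eps:
  assumes k: "k \<ge> 2 ^ p"
  shows "AE \<omega> in M. e k \<omega> = eps k \<omega>"
proof -
  have "(2::nat) ^ p = 2 * 2 ^ (p - 1)" using cp.p_pos by (cases p) auto
  then have k2: "k div 2 \<ge> 2 ^ (p - 1)" using k by auto
  show ?thesis
  proof (cases "even k")
    case True
    then have "2 * (k div 2) = k" by simp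
    then show ?thesis using BAR_even[OF k2] True by (auto simp: e_def)
  next
    case False
    then have "2 * (k div 2) + 1 = k" by simp
    then show ?thesis using BAR_odd[OF k2] False by (auto simp: e_def)
  qed
qed

lemma filtration_gen: "{X k -` S \<inter> space M | k S. k \<in> tree n \<and> S \<in> sets borel} \<subseteq> sets M"
  using X_rv by (auto simp: tree_iff intro!: measurable_sets)

lemma filtration_subalg: "subalgebra M (F n)"
proof -
  have pow: "{X k -` S \<inter> space M | k S. k \<in> tree n \<and> S \<in> sets borel} \<subseteq> Pow (space M)" by auto
  show ?thesis
    unfolding subalgebra_def natural_filtration_def sets_measure_of[OF pow] space_measure_of[OF pow]
    using sets.sigma_sets_subset[OF filtration_gen] by simp
qed

lemma X_filtration: "k \<in> tree n \<Longrightarrow> X k \<in> borel_measurable (F n)"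
proof (rule measurableI)
  fix S :: "real set" assume k: "k \<in> tree n" and S: "S \<in> sets borel"
  have sp: "space (F n) = space M" using filtration_subalg by (simp add: subalgebra_def)
  have "sets (F n) = sigma_sets (space M) {X k -` S \<inter> space M | k S. k \<in> tree n \<and> S \<in> sets borel}"
    unfolding natural_filtration_def using filtration_gen[of n] sets.sets_into_space
    by (intro sets_measure_of) blast
  then show "X k -` S \<inter> space (F n) \<in> sets (F n)" unfolding sp using k S by blast
qed auto

lemma filtration_mono:
  assumes "n \<le> n'" "f \<in> borel_measurable (F n)" shows "(f :: 'a \<Rightarrow> real) \<in> borel_measurable (F n')"
proof (rule measurable_from_subalg[OF _ assms(2)])
  have pow: "{X k -` S \<inter> space M | k S. k \<in> tree n \<and> S \<in> sets borel} \<subseteq> Pow (space M)" for n by auto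
  have "tree n \<subseteq> tree n'" unfolding tree_def using assms(1) by (intro UN_mono) auto
  then have "sigma_sets (space M) {X k -` S \<inter> space M | k S. k \<in> tree n \<and> S \<in> sets borel}
      \<subseteq> sigma_sets (space M) {X k -` S \<inter> space M | k S. k \<in> tree n' \<and> S \<in> sets borel}"
    by (intro sigma_sets_subseteq) blast
  then show "subalgebra (F n') (F n)"
    unfolding subalgebra_def natural_filtration_def by (simp add: sets_measure_of[OF pow] space_measure_of[OF pow])
qed

lemma F_to_M: "f \<in> borel_measurable (F n) \<Longrightarrow> (f :: 'a \<Rightarrow> real) \<in> borel_measurable M"
  by (rule measurable_from_subalg[OF filtration_subalg])

lemma ancestor_tree: "k \<in> generation n \<Longrightarrow> n \<ge> p - 1 \<Longrightarrow> i < p \<Longrightarrow> k div 2 ^ i \<in> tree n"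
proof -
  assume k: "k \<in> generation n" "n \<ge> p - 1" and i: "i < p"
  have "(2::nat) ^ i \<le> 2 ^ (p - 1)" using i by (intro power_increasing) auto
  also have "\<dots> \<le> k" by (rule generation_ge[OF k])
  finally have "1 \<le> k div 2 ^ i" by (simp add: div_greater_zero_iff Suc_le_eq)
  moreover have "k div 2 ^ i \<le> k" by simp
  ultimately show ?thesis using k(1) by (auto simp: tree_iff generation_iff simp del: div_le_dividend)
qed

lemma y_filtration:
  assumes "k \<in> generation n" "n \<ge> p - 1" "i \<le> p"
  shows "y k i \<in> borel_measurable (F n)"
  using X_filtration[OF ancestor_tree[OF assms(1,2)]] assms(3) by (cases i) auto

lemma e_filtration:
  assumes k: "k \<in> generation n" "n \<ge> p - 1" and r: "r < 2"
  shows "e (2 * k + r) \<in> borel_measurable (F (Suc n))"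
proof -
  have g: "2 * k + r \<in> generation (Suc n)" using child_generation[OF k(1) r] by simp
  then have x: "X (2 * k + r) \<in> borel_measurable (F (Suc n))" by (intro X_filtration) (auto simp: tree_def)
  have d: "(2 * k + r) div 2 = k" using r by auto
  have "X (k div 2 ^ (j - 1)) \<in> borel_measurable (F (Suc n))" if "j \<in> {1..p}" for j
    by (rule filtration_mono[OF _ X_filtration[OF ancestor_tree[OF k]]]) (use that in auto)
  then show ?thesis unfolding e_def d
    by (cases "even (2 * k + r)")
       (simp_all, intro borel_measurable_diff x borel_measurable_add borel_measurable_sum borel_measurable_times borel_measurable_const; simp)+
qed

lemma e_M: "k \<in> generation n \<Longrightarrow> n \<ge> p - 1 \<Longrightarrow> r < 2 \<Longrightarrow> e (2 * k + r) \<in> borel_measurable M"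
  by (rule F_to_M[OF e_filtration])

lemma sub_fin: "finite_measure_subalgebra M (F n)"
  by (simp add: finite_measure_subalgebra_def finite_measure_subalgebra_axioms_def filtration_subalg finite_measure_axioms)

lemma cond_exp_e:
  assumes k: "k \<in> generation n" "n \<ge> p - 1" and r: "r < 2" and f: "f \<in> borel_measurable borel"
  shows "AE \<omega> in M. real_cond_exp M (F n) (\<lambda>\<omega>. f (e (2 * k + r) \<omega>)) \<omega> = real_cond_exp M (F n) (\<lambda>\<omega>. f (eps (2 * k + r) \<omega>)) \<omega>"
proof -
  interpret finite_measure_subalgebra M "F n" by (rule sub_fin)
  have m: "e (2 * k + r) \<in> borel_measurable M" "eps (2 * k + r) \<in> borel_measurable M"
    using e_M[OF k r] eps_rv[OF child_ge[OF k]] by auto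
  show ?thesis
  proof (rule real_cond_exp_cong)
    show "AE \<omega> in M. f (e (2 * k + r) \<omega>) = f (eps (2 * k + r) \<omega>)"
      using e_eq_eps[OF child_ge[OF k, of r]] by eventually_elim simp
  qed (use measurable_compose[OF m(1) f] measurable_compose[OF m(2) f] in auto)
qed

text \<open>The hypothesis concerns sister pairs. Test sets that are the whole line in the
  coordinate of the other sister reduce it to one daughter type, and the residuals agree with the
  noise almost surely.\<close>

lemma e_indep:
  assumes n: "n \<ge> p - 1" and r: "r < 2"
  shows "cond_indep_vars M (F n) borel (\<lambda>k. e (2 * k + r)) (generation n)"
  unfolding cond_indep_vars_def
proof (intro allI impI)
  fix S :: "nat \<Rightarrow> real set" assume S: "\<forall>i\<in>generation n. S i \<in> sets borel"
  interpret finite_measure_subalgebra M "F n" by (rule sub_fin)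
  define S' where "S' i = (if r = 0 then S i \<times> UNIV else UNIV \<times> S i)" for i
  have ind: "indicator (S' i) (sister_noise eps i \<omega>) = (indicator (S i) (eps (2 * i + r) \<omega>) :: real)" for i \<omega>
    using r by (auto simp: S'_def sister_noise_def indicator_def less_2_cases_iff)
  have "\<forall>i\<in>generation n. S' i \<in> sets borel"
    using S by (auto simp: S'_def intro!: borel_Times)
  then have ae: "AE \<omega> in M. real_cond_exp M (F n) (\<lambda>\<omega>. \<Prod>i\<in>generation n. indicator (S i) (eps (2 * i + r) \<omega>)) \<omega>
      = (\<Prod>i\<in>generation n. real_cond_exp M (F n) (\<lambda>\<omega>. indicator (S i) (eps (2 * i + r) \<omega>)) \<omega>)"
    using eps_indep[OF n] unfolding cond_indep_vars_def ind[symmetric] by blast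
  have m: "(\<lambda>\<omega>. indicator (S i) (e (2 * i + r) \<omega>) :: real) \<in> borel_measurable M"
    "(\<lambda>\<omega>. indicator (S i) (eps (2 * i + r) \<omega>) :: real) \<in> borel_measurable M" if i: "i \<in> generation n" for i
    using measurable_compose[OF e_M[OF i n r] borel_measurable_indicator[of "S i"]]
      measurable_compose[OF eps_rv[OF child_ge[OF i n]] borel_measurable_indicator[of "S i"]] S i by auto
  have 1: "AE \<omega> in M. real_cond_exp M (F n) (\<lambda>\<omega>. \<Prod>i\<in>generation n. indicator (S i) (e (2 * i + r) \<omega>)) \<omega>
      = real_cond_exp M (F n) (\<lambda>\<omega>. \<Prod>i\<in>generation n. indicator (S i) (eps (2 * i + r) \<omega>)) \<omega>"
  proof (rule real_cond_exp_cong)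
    have "AE \<omega> in M. \<forall>i\<in>generation n. e (2 * i + r) \<omega> = eps (2 * i + r) \<omega>"
      by (rule AE_finite_allI) (use e_eq_eps[OF child_ge[OF _ n]] in auto)
    then show "AE \<omega> in M. (\<Prod>i\<in>generation n. indicator (S i) (e (2 * i + r) \<omega>))
        = (\<Prod>i\<in>generation n. indicator (S i) (eps (2 * i + r) \<omega>) :: real)"
      by eventually_elim (auto intro!: prod.cong)
    show "(\<lambda>\<omega>. \<Prod>i\<in>generation n. indicator (S i) (e (2 * i + r) \<omega>) :: real) \<in> borel_measurable M"
      by (rule borel_measurable_prod) (rule m(1))
    show "(\<lambda>\<omega>. \<Prod>i\<in>generation n. indicator (S i) (eps (2 * i + r) \<omega>) :: real) \<in> borel_measurable M"
      by (rule borel_measurable_prod) (rule m(2))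
  qed
  have 2: "AE \<omega> in M. \<forall>i\<in>generation n. real_cond_exp M (F n) (\<lambda>\<omega>. indicator (S i) (e (2 * i + r) \<omega>)) \<omega>
      = real_cond_exp M (F n) (\<lambda>\<omega>. indicator (S i) (eps (2 * i + r) \<omega>)) \<omega>"
    by (rule AE_finite_allI) (use cond_exp_e[OF _ n r] S in auto)
  show "AE \<omega> in M. real_cond_exp M (F n) (\<lambda>\<omega>. \<Prod>i\<in>generation n. indicator (S i) (e (2 * i + r) \<omega>)) \<omega>
      = (\<Prod>i\<in>generation n. real_cond_exp M (F n) (\<lambda>\<omega>. indicator (S i) (e (2 * i + r) \<omega>)) \<omega>)"
    using ae 1 2 by eventually_elim (auto intro!: prod.cong)
qed

lemma generation_noise_block:
  assumes n: "n \<ge> p - 1" and r: "r < 2" and K: "0 \<le> K"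
  shows "noise_block M (F n) (\<lambda>k. e (2 * k + r)) (generation n) s K"
proof -
  have g: "2 * k + r \<in> generation (n + 1)" if k: "k \<in> generation n" for k by (rule child_generation[OF k r])
  have "e (2 * k + r) \<in> borel_measurable M" if k: "k \<in> generation n" for k by (rule e_M[OF k n r])
  moreover have "integrable M (\<lambda>\<omega>. e (2 * k + r) \<omega> ^ 4)" if k: "k \<in> generation n" for k
  proof (rule integrable_cong_AE_imp[OF eps_fourth[OF n g[OF k]]])
    show "(\<lambda>\<omega>. e (2 * k + r) \<omega> ^ 4) \<in> borel_measurable M" using e_M[OF k n r] by simp
    show "AE \<omega> in M. eps (2 * k + r) \<omega> ^ 4 = e (2 * k + r) \<omega> ^ 4"
      using e_eq_eps[OF child_ge[OF k n, of r]] by eventually_elim simp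
  qed
  moreover have "AE \<omega> in M. real_cond_exp M (F n) (e (2 * k + r)) \<omega> = 0" if k: "k \<in> generation n" for k
    using cond_exp_e[OF k n r, of "\<lambda>x. x"] eps_mean[OF n g[OF k]] by auto
  moreover have "AE \<omega> in M. real_cond_exp M (F n) (\<lambda>\<omega>. (e (2 * k + r) \<omega>)\<^sup>2) \<omega> = s" if k: "k \<in> generation n" for k
    using cond_exp_e[OF k n r, of "\<lambda>x. x\<^sup>2"] eps_var[OF n g[OF k]] by auto
  ultimately show ?thesis
    using filtration_subalg e_indep[OF n r] s_pos K by unfold_locales auto
qed

text \<open>The indicator at time n already tests the noise of generation n + 1, but through moments
  conditional on \<open>F n\<close>, so it is \<open>F n\<close>-measurable. The test uses
  \<open>eps\<close>, to which the assumed bound refers; \<open>G_bound\<close> carries it over to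
  \<open>e\<close>.\<close>

definition G :: "real \<Rightarrow> nat \<Rightarrow> 'a \<Rightarrow> real" where
  "G K n \<omega> = (if \<forall>m\<in>{p - 1..n}. \<forall>k\<in>generation (m + 1). real_cond_exp M (F m) (\<lambda>\<omega>. eps k \<omega> ^ 4) \<omega> \<le> K then 1 else 0)"

lemma G_cases: "G K n \<omega> = 0 \<or> G K n \<omega> = 1" by (simp add: G_def)

lemma G_range: "0 \<le> G K n \<omega>" "G K n \<omega> \<le> 1" "\<bar>G K n \<omega>\<bar> \<le> 1" by (simp_all add: G_def)

lemma G_power: "j > 0 \<Longrightarrow> G K n \<omega> ^ j = G K n \<omega>" using G_cases[of K n \<omega>] by auto

lemma G_decreasing: "n \<le> n' \<Longrightarrow> G K n' \<omega> \<le> G K n \<omega>" by (auto simp: G_def)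

lemma G_filtration: "G K n \<in> borel_measurable (F n)"
proof -
  have "Measurable.pred (F n) (\<lambda>\<omega>. \<forall>m\<in>{p - 1..n}. \<forall>k\<in>generation (m + 1). real_cond_exp M (F m) (\<lambda>\<omega>. eps k \<omega> ^ 4) \<omega> \<le> K)"
  proof (intro pred_intros_finite)
    fix m k assume "m \<in> {p - 1..n}"
    then have [measurable]: "real_cond_exp M (F m) (\<lambda>\<omega>. eps k \<omega> ^ 4) \<in> borel_measurable (F n)"
      by (intro filtration_mono[of m n]) auto
    show "Measurable.pred (F n) (\<lambda>\<omega>. real_cond_exp M (F m) (\<lambda>\<omega>. eps k \<omega> ^ 4) \<omega> \<le> K)" by measurable
  qed auto
  then show ?thesis unfolding G_def[abs_def] by measurable
qed

lemma G_M [measurable]: "G K n \<in> borel_measurable M" by (rule F_to_M[OF G_filtration])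

text \<open>The random bound is finite, hence below some integer. Countably many levels thus exhaust
  almost all paths, and almost sure statements at each level combine.\<close>

lemma G_eventually_one: "AE \<omega> in M. \<exists>K::nat. \<forall>n. G (real K) n \<omega> = 1"
  using eps_sup
proof eventually_elim
  case (elim \<omega>)
  let ?k = "\<lambda>m k. real_cond_exp M (F m) (\<lambda>\<omega>. eps k \<omega> ^ 4) \<omega>"
  let ?S = "SUP n \<in> {p - 1..}. SUP k \<in> generation (n + 1). ereal (?k n k)"
  have le: "ereal (?k m k) \<le> ?S" if "m \<ge> p - 1" "k \<in> generation (m + 1)" for m k
    by (rule SUP_upper2[of m], use that in simp, rule SUP_upper, rule that)
  obtain c where c: "?S \<le> ereal c" using elim by (cases ?S) auto
  obtain K :: nat where K: "c \<le> real K" using real_arch_simple by blast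
  have "?k m k \<le> real K" if "m \<ge> p - 1" "k \<in> generation (m + 1)" for m k
    using order_trans[OF le[OF that] c] K by simp
  then have "\<forall>n. G (real K) n \<omega> = 1" by (auto simp: G_def)
  then show ?case by blast
qed

lemma G_bound:
  assumes k: "k \<in> generation n" "n \<ge> p - 1" and r: "r < 2"
  shows "AE \<omega> in M. G K n \<omega> \<noteq> 0 \<longrightarrow> real_cond_exp M (F n) (\<lambda>\<omega>. e (2 * k + r) \<omega> ^ 4) \<omega> \<le> K"
proof -
  have "G K n \<omega> \<noteq> 0 \<longrightarrow> real_cond_exp M (F n) (\<lambda>\<omega>. eps (2 * k + r) \<omega> ^ 4) \<omega> \<le> K" for \<omega>
    using child_generation[OF k(1) r] k(2) by (auto simp: G_def)
  then show ?thesis using cond_exp_e[OF k r, of "\<lambda>x. x ^ 4"] by auto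
qed

lemma G_weight:
  assumes n: "n \<ge> p - 1" and r: "r < 2" and K: "0 \<le> K" and k: "k \<in> generation n"
    and c: "c \<in> borel_measurable (F n)" and int: "integrable M (\<lambda>\<omega>. (G K n \<omega> * c \<omega>) ^ 4)"
  shows "noise_block.weight M (F n) (\<lambda>k. e (2 * k + r)) K k (\<lambda>\<omega>. G K n \<omega> * c \<omega>)"
  unfolding noise_block.weight_def[OF generation_noise_block[OF n r K]]
proof (intro conjI int)
  show "(\<lambda>\<omega>. G K n \<omega> * c \<omega>) \<in> borel_measurable (F n)" using G_filtration c by simp
  show "AE \<omega> in M. G K n \<omega> * c \<omega> \<noteq> 0 \<longrightarrow> real_cond_exp M (F n) (\<lambda>\<omega>. e (2 * k + r) \<omega> ^ 4) \<omega> \<le> K"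
    using G_bound[OF k n r] by eventually_elim auto
qed

section \<open>Uniform fourth moments of the localized states\<close>

definition \<nu> :: "nat \<Rightarrow> 'a \<Rightarrow> real" where "\<nu> k \<omega> = cp.nrm (\<lambda>i. X (k div 2 ^ i) \<omega>)"

lemma \<nu>_nonneg: "0 \<le> \<nu> k \<omega>" unfolding \<nu>_def by (rule cp.nrm_nonneg)

lemma \<nu>_M: "k \<in> generation n \<Longrightarrow> n \<ge> p - 1 \<Longrightarrow> \<nu> k \<in> borel_measurable M"
  unfolding \<nu>_def by (rule cp.nrm_measurable) (rule F_to_M[OF X_filtration[OF ancestor_tree]])

lemma \<nu>_child:
  assumes k: "k \<in> generation n" "n \<ge> p - 1" and r: "r < 2"
  shows "\<nu> (2 * k + r) \<omega> \<le> \<beta> * \<nu> k \<omega> + cp.unit_nrm 0 * (\<bar>if r = 0 then a 0 else b 0\<bar> + \<bar>e (2 * k + r) \<omega>\<bar>)"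
proof -
  interpret br: bar_recursion p N a b \<beta> "\<lambda>k. X k \<omega>" "\<lambda>k. e k \<omega>" by (rule recursion)
  define C where "C = (if r = 0 then companion_fn a else companion_fn b)"
  define w where "w = (if r = 0 then a 0 else b 0) + e (2 * k + r) \<omega>"
  have k': "k \<ge> 2 ^ (p - 1)" by (rule generation_ge[OF k])
  have C: "cp.nrm (\<lambda>i. \<Sum>j<p. C i j * x j) \<le> \<beta> * cp.nrm x" for x
    unfolding C_def using cp.contr_A cp.contr_B by simp
  have "X ((2 * k + r) div 2 ^ i) \<omega> = (\<Sum>j<p. C i j * X (k div 2 ^ j) \<omega>) + (if i = 0 then w else 0)" if i: "i < p" for i
    using br.y_even[OF k' i] br.y_odd[OF k' i] r by (cases "r = 0") (auto simp: C_def w_def less_2_cases_iff)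
  then have "\<nu> (2 * k + r) \<omega> = cp.nrm (\<lambda>i. (\<Sum>j<p. C i j * X (k div 2 ^ j) \<omega>) + w * (if i = 0 then 1 else 0))"
    unfolding \<nu>_def by (intro cp.nrm_cong) auto
  also have "\<dots> \<le> \<beta> * \<nu> k \<omega> + cp.nrm (\<lambda>i. w * (if i = 0 then 1 else 0))"
    unfolding \<nu>_def by (rule order_trans[OF cp.nrm_add]) (intro add_right_mono C)
  also have "cp.nrm (\<lambda>i. w * (if i = 0 then 1 else 0)) = cp.unit_nrm 0 * \<bar>w\<bar>"
    by (subst cp.nrm_scale) (simp add: cp.unit_nrm_def mult.commute)
  also have "\<dots> \<le> cp.unit_nrm 0 * (\<bar>if r = 0 then a 0 else b 0\<bar> + \<bar>e (2 * k + r) \<omega>\<bar>)"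
    unfolding w_def by (intro mult_left_mono abs_triangle_ineq cp.unit_nrm_nonneg)
  finally show ?thesis by simp
qed

text \<open>The ancestors of generation p - 1 are exactly initial cells, whose eighth moments
  dominate fourth moments.\<close>

lemma \<nu>_initial:
  assumes k: "k \<in> generation (p - 1)"
  shows "integrable M (\<lambda>\<omega>. \<nu> k \<omega> ^ 4)"
proof (rule Bochner_Integration.integrable_bound)
  have XM: "X (k div 2 ^ i) \<in> borel_measurable M" if "i < p" for i
    by (rule F_to_M[OF X_filtration[OF ancestor_tree[OF k order_refl that]]])
  have "integrable M (\<lambda>\<omega>. (\<bar>X (k div 2 ^ i) \<omega>\<bar> * cp.unit_nrm i) ^ 4)" if i: "i < p" for i
  proof -
    have t: "k div 2 ^ i \<in> tree (p - 1)" by (rule ancestor_tree[OF k order_refl i])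
    have "integrable M (\<lambda>\<omega>. X (k div 2 ^ i) \<omega> ^ 8)"
      using t cp.p_pos by (intro initial) (auto simp: tree_iff)
    then have "integrable M (\<lambda>\<omega>. (X (k div 2 ^ i) \<omega> ^ 4)\<^sup>2)" by (simp add: power_mult[symmetric])
    then have "integrable M (\<lambda>\<omega>. X (k div 2 ^ i) \<omega> ^ 4)" by (rule integrable_of_square[rotated]) (use XM[OF i] in simp)
    then show ?thesis by (simp add: power_mult_distrib power_even_abs)
  qed
  then show "integrable M (\<lambda>\<omega>. (\<Sum>i<p. \<bar>X (k div 2 ^ i) \<omega>\<bar> * cp.unit_nrm i) ^ 4)"
    using XM by (intro integrable_fourth_sum) auto
  show "AE \<omega> in M. norm (\<nu> k \<omega> ^ 4) \<le> norm ((\<Sum>i<p. \<bar>X (k div 2 ^ i) \<omega>\<bar> * cp.unit_nrm i) ^ 4)"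
  proof (rule AE_I2)
    fix \<omega>
    have "\<nu> k \<omega> ^ 4 \<le> (\<Sum>i<p. \<bar>X (k div 2 ^ i) \<omega>\<bar> * cp.unit_nrm i) ^ 4"
      unfolding \<nu>_def by (intro power_mono cp.nrm_le_sum cp.nrm_nonneg)
    then show "norm (\<nu> k \<omega> ^ 4) \<le> norm ((\<Sum>i<p. \<bar>X (k div 2 ^ i) \<omega>\<bar> * cp.unit_nrm i) ^ 4)"
      using \<nu>_nonneg[of k \<omega>] by simp
  qed
  show "(\<lambda>\<omega>. \<nu> k \<omega> ^ 4) \<in> borel_measurable M" using \<nu>_M[OF k] by simp
qed

lemma G_fourth: "integrable M (\<lambda>\<omega>. (G K n \<omega> * 1) ^ 4)" "expectation (\<lambda>\<omega>. (G K n \<omega> * 1) ^ 4) \<le> 1"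
proof -
  show i: "integrable M (\<lambda>\<omega>. (G K n \<omega> * 1) ^ 4)"
    by (rule integrable_const_bound[where B = 1]) (auto simp: G_power G_range)
  have "expectation (\<lambda>\<omega>. (G K n \<omega> * 1) ^ 4) \<le> expectation (\<lambda>\<omega>. 1)"
    using i by (intro integral_mono) (auto simp: G_power G_range)
  then show "expectation (\<lambda>\<omega>. (G K n \<omega> * 1) ^ 4) \<le> 1" by (simp add: prob_space)
qed

lemma localized_noise_fourth:
  assumes k: "k \<in> generation n" "n \<ge> p - 1" and r: "r < 2" and K: "0 \<le> K"
  shows "integrable M (\<lambda>\<omega>. (e (2 * k + r) \<omega> * G K n \<omega>) ^ 4)"
    "expectation (\<lambda>\<omega>. (e (2 * k + r) \<omega> * G K n \<omega>) ^ 4) \<le> K"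
proof -
  interpret nb: noise_block M "F n" "\<lambda>k. e (2 * k + r)" "generation n" s K by (rule generation_noise_block[OF k(2) r K])
  have w: "nb.weight k (\<lambda>\<omega>. G K n \<omega> * 1)" by (rule G_weight[OF k(2) r K k(1) _ G_fourth(1)]) simp
  show "integrable M (\<lambda>\<omega>. (e (2 * k + r) \<omega> * G K n \<omega>) ^ 4)"
    using nb.weight_fourth(1)[OF k(1) w] by simp
  have "expectation (\<lambda>\<omega>. (e (2 * k + r) \<omega> * G K n \<omega>) ^ 4) \<le> K * expectation (\<lambda>\<omega>. (G K n \<omega> * 1) ^ 4)"
    using nb.weight_fourth(2)[OF k(1) w] by simp
  also have "\<dots> \<le> K * 1" using K G_fourth(2) by (rule mult_left_mono[rotated])
  finally show "expectation (\<lambda>\<omega>. (e (2 * k + r) \<omega> * G K n \<omega>) ^ 4) \<le> K" by simp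
qed

text \<open>Passing to a daughter contracts the norm of the state by \<beta> up to an additive noise
  term, and convexity keeps the factor \<beta> for fourth powers. As \<open>G\<close> decreases in
  time, the indicator of the daughter may be replaced by that of the mother, which controls the
  noise in between.\<close>

lemma state_moment_bound:
  assumes K: "0 \<le> K"
  obtains C where "0 \<le> C" "\<And>n k. n \<ge> p - 1 \<Longrightarrow> k \<in> generation n \<Longrightarrow>
    integrable M (\<lambda>\<omega>. G K n \<omega> * \<nu> k \<omega> ^ 4) \<and> expectation (\<lambda>\<omega>. G K n \<omega> * \<nu> k \<omega> ^ 4) \<le> C"
proof -
  define u where "u = cp.unit_nrm 0"
  define q where "q = (\<bar>a 0\<bar> + \<bar>b 0\<bar>) ^ 4"
  define D where "D = u ^ 4 * (8 * (q + K)) / (1 - \<beta>) ^ 3"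
  define C0 where "C0 = (\<Sum>k\<in>generation (p - 1). expectation (\<lambda>\<omega>. \<nu> k \<omega> ^ 4))"
  \<comment> \<open>Chosen so that \<beta> C + D \<le> C, with \<open>C0\<close> to dominate the
    initial generation.\<close>
  define C where "C = C0 + D / (1 - \<beta>)"
  have D0: "0 \<le> D" unfolding D_def q_def using cp.beta K by simp
  have C00: "0 \<le> C0" unfolding C0_def using \<nu>_nonneg by (intro sum_nonneg Bochner_Integration.integral_nonneg) auto
  have C: "0 \<le> C" unfolding C_def using D0 C00 cp.beta by simp
  have step: "\<beta> * C + D \<le> C"
  proof -
    have "\<beta> * C + D = \<beta> * C0 + (\<beta> * (D / (1 - \<beta>)) + D)" by (simp add: C_def distrib_left)
    also have "\<beta> * (D / (1 - \<beta>)) + D = D / (1 - \<beta>)" using cp.beta by (simp add: field_simps)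
    also have "\<beta> * C0 + D / (1 - \<beta>) \<le> C" unfolding C_def using C00 cp.beta by (simp add: mult_left_le_one_le)
    finally show ?thesis .
  qed
  have main: "\<forall>k\<in>generation (p - 1 + j). integrable M (\<lambda>\<omega>. G K (p - 1 + j) \<omega> * \<nu> k \<omega> ^ 4)
      \<and> expectation (\<lambda>\<omega>. G K (p - 1 + j) \<omega> * \<nu> k \<omega> ^ 4) \<le> C" for j
  proof (induction j)
    case 0
    show ?case
    proof
      fix k assume "k \<in> generation (p - 1 + 0)"
      then have k: "k \<in> generation (p - 1)" by simp
      have le: "G K (p - 1) \<omega> * \<nu> k \<omega> ^ 4 \<le> \<nu> k \<omega> ^ 4" for \<omega>
        using G_range[of K "p - 1" \<omega>] by (simp add: mult_left_le_one_le)
      have int: "integrable M (\<lambda>\<omega>. G K (p - 1) \<omega> * \<nu> k \<omega> ^ 4)"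
        by (rule Bochner_Integration.integrable_bound[OF \<nu>_initial[OF k]])
           (use \<nu>_M[OF k] le G_range(1) in \<open>auto simp: abs_mult\<close>)
      have "expectation (\<lambda>\<omega>. G K (p - 1) \<omega> * \<nu> k \<omega> ^ 4) \<le> expectation (\<lambda>\<omega>. \<nu> k \<omega> ^ 4)"
        by (rule integral_mono[OF int \<nu>_initial[OF k]]) (rule le)
      also have "\<dots> \<le> C0" unfolding C0_def
        by (rule member_le_sum[OF k]) (auto intro!: Bochner_Integration.integral_nonneg)
      also have "\<dots> \<le> C" unfolding C_def using D0 cp.beta by simp
      finally show "integrable M (\<lambda>\<omega>. G K (p - 1 + 0) \<omega> * \<nu> k \<omega> ^ 4)
          \<and> expectation (\<lambda>\<omega>. G K (p - 1 + 0) \<omega> * \<nu> k \<omega> ^ 4) \<le> C" using int by simp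
    qed
  next
    case (Suc j)
    define n where "n = p - 1 + j"
    have n: "n \<ge> p - 1" by (simp add: n_def)
    show ?case
    proof
      fix k' assume "k' \<in> generation (p - 1 + Suc j)"
      then have k': "k' \<in> generation (Suc n)" by (simp add: n_def)
      define k r where "k = k' div 2" and "r = k' mod 2"
      have kr: "k' = 2 * k + r" and r: "r < 2" by (auto simp: k_def r_def)
      have k: "k \<in> generation n" using k' by (auto simp: k_def generation_iff)
      have IH: "integrable M (\<lambda>\<omega>. G K n \<omega> * \<nu> k \<omega> ^ 4)" "expectation (\<lambda>\<omega>. G K n \<omega> * \<nu> k \<omega> ^ 4) \<le> C"
        using Suc k unfolding n_def by auto
      note ef = localized_noise_fourth[OF k n r K]
      \<comment> \<open>If the mother's indicator is 0, so is the daughter's and the left side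
        vanishes. Otherwise it equals 1 and the bound is the convexity estimate.\<close>
      have le: "G K (Suc n) \<omega> * \<nu> k' \<omega> ^ 4 \<le> \<beta> * (G K n \<omega> * \<nu> k \<omega> ^ 4)
          + u ^ 4 * (8 * (q + (e k' \<omega> * G K n \<omega>) ^ 4)) / (1 - \<beta>) ^ 3" for \<omega>
      proof (cases "G K n \<omega> = 0")
        case True
        then have "G K (Suc n) \<omega> = 0" using G_decreasing[of n "Suc n" K \<omega>] G_range[of K "Suc n" \<omega>] by simp
        moreover have "0 \<le> u ^ 4 * (8 * q) / (1 - \<beta>) ^ 3" using cp.beta by (simp add: q_def)
        ultimately show ?thesis using True by simp
      next
        case False
        then have G1: "G K n \<omega> = 1" using G_cases by blast
        have "G K (Suc n) \<omega> * \<nu> k' \<omega> ^ 4 \<le> \<nu> k' \<omega> ^ 4" using G_range by (simp add: mult_left_le_one_le)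
        also have "\<dots> \<le> (\<beta> * \<nu> k \<omega> + u * ((\<bar>a 0\<bar> + \<bar>b 0\<bar>) + \<bar>e k' \<omega>\<bar>)) ^ 4"
        proof (rule power_mono)
          have "u * (\<bar>if r = 0 then a 0 else b 0\<bar> + \<bar>e k' \<omega>\<bar>) \<le> u * ((\<bar>a 0\<bar> + \<bar>b 0\<bar>) + \<bar>e k' \<omega>\<bar>)"
            unfolding u_def by (intro mult_left_mono cp.unit_nrm_nonneg) auto
          then show "\<nu> k' \<omega> \<le> \<beta> * \<nu> k \<omega> + u * ((\<bar>a 0\<bar> + \<bar>b 0\<bar>) + \<bar>e k' \<omega>\<bar>)"
            using \<nu>_child[OF k n r, of \<omega>] unfolding kr u_def by linarith
        qed (rule \<nu>_nonneg)
        also have "\<dots> \<le> \<beta> * \<nu> k \<omega> ^ 4 + (u * ((\<bar>a 0\<bar> + \<bar>b 0\<bar>) + \<bar>e k' \<omega>\<bar>)) ^ 4 / (1 - \<beta>) ^ 3"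
          by (rule convex_power_four[OF cp.beta])
        also have "(u * ((\<bar>a 0\<bar> + \<bar>b 0\<bar>) + \<bar>e k' \<omega>\<bar>)) ^ 4 \<le> u ^ 4 * (8 * (q + e k' \<omega> ^ 4))"
        proof -
          have "((\<bar>a 0\<bar> + \<bar>b 0\<bar>) + \<bar>e k' \<omega>\<bar>) ^ 4 \<le> 8 * ((\<bar>a 0\<bar> + \<bar>b 0\<bar>) ^ 4 + \<bar>e k' \<omega>\<bar> ^ 4)" by (rule sum_power_four_le)
          then show ?thesis unfolding power_mult_distrib q_def by (intro mult_left_mono) (auto simp: power_even_abs)
        qed
        finally show ?thesis using G1 cp.beta by (simp add: divide_right_mono)
      qed
      have int: "integrable M (\<lambda>\<omega>. \<beta> * (G K n \<omega> * \<nu> k \<omega> ^ 4) + u ^ 4 * (8 * (q + (e k' \<omega> * G K n \<omega>) ^ 4)) / (1 - \<beta>) ^ 3)"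
        using IH(1) ef(1) unfolding kr by simp
      have meas: "\<nu> k' \<in> borel_measurable M" by (rule \<nu>_M[OF k']) (use n in simp)
      have int2: "integrable M (\<lambda>\<omega>. G K (Suc n) \<omega> * \<nu> k' \<omega> ^ 4)"
      proof (rule Bochner_Integration.integrable_bound[OF int])
        show "AE \<omega> in M. norm (G K (Suc n) \<omega> * \<nu> k' \<omega> ^ 4)
          \<le> norm (\<beta> * (G K n \<omega> * \<nu> k \<omega> ^ 4) + u ^ 4 * (8 * (q + (e k' \<omega> * G K n \<omega>) ^ 4)) / (1 - \<beta>) ^ 3)"
        proof (rule AE_I2)
          fix \<omega>
          have "0 \<le> G K (Suc n) \<omega> * \<nu> k' \<omega> ^ 4" using G_range(1) \<nu>_nonneg by simp
          then show "norm (G K (Suc n) \<omega> * \<nu> k' \<omega> ^ 4)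
            \<le> norm (\<beta> * (G K n \<omega> * \<nu> k \<omega> ^ 4) + u ^ 4 * (8 * (q + (e k' \<omega> * G K n \<omega>) ^ 4)) / (1 - \<beta>) ^ 3)"
            using le[of \<omega>] by simp
        qed
      qed (use meas in simp)
      have "expectation (\<lambda>\<omega>. G K (Suc n) \<omega> * \<nu> k' \<omega> ^ 4)
          \<le> expectation (\<lambda>\<omega>. \<beta> * (G K n \<omega> * \<nu> k \<omega> ^ 4) + u ^ 4 * (8 * (q + (e k' \<omega> * G K n \<omega>) ^ 4)) / (1 - \<beta>) ^ 3)"
        by (rule integral_mono[OF int2 int]) (rule le)
      also have "\<dots> = \<beta> * expectation (\<lambda>\<omega>. G K n \<omega> * \<nu> k \<omega> ^ 4)
          + u ^ 4 * (8 * (q + expectation (\<lambda>\<omega>. (e k' \<omega> * G K n \<omega>) ^ 4))) / (1 - \<beta>) ^ 3"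
        using IH(1) ef(1) unfolding kr by (simp add: prob_space)
      also have "\<dots> \<le> \<beta> * C + D"
        unfolding D_def using IH(2) ef(2) cp.beta unfolding kr
        by (intro add_mono mult_left_mono divide_right_mono) auto
      also have "\<dots> \<le> C" by (rule step)
      finally show "integrable M (\<lambda>\<omega>. G K (p - 1 + Suc j) \<omega> * \<nu> k' \<omega> ^ 4)
          \<and> expectation (\<lambda>\<omega>. G K (p - 1 + Suc j) \<omega> * \<nu> k' \<omega> ^ 4) \<le> C"
        using int2 by (simp add: n_def)
    qed
  qed
  show ?thesis
  proof (rule that[OF C])
    fix n k assume "n \<ge> p - 1" "k \<in> generation n"
    then show "integrable M (\<lambda>\<omega>. G K n \<omega> * \<nu> k \<omega> ^ 4) \<and> expectation (\<lambda>\<omega>. G K n \<omega> * \<nu> k \<omega> ^ 4) \<le> C"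
      using main[of "n - (p - 1)"] by simp
  qed
qed

lemma regressor_moment_bound:
  assumes K: "0 \<le> K"
  obtains C where "0 \<le> C" "\<And>n k i. n \<ge> p - 1 \<Longrightarrow> k \<in> generation n \<Longrightarrow> i \<le> p \<Longrightarrow>
    integrable M (\<lambda>\<omega>. (G K n \<omega> * y k i \<omega>) ^ 4) \<and> expectation (\<lambda>\<omega>. (G K n \<omega> * y k i \<omega>) ^ 4) \<le> C"
proof -
  obtain C where C: "0 \<le> C" "\<And>n k. n \<ge> p - 1 \<Longrightarrow> k \<in> generation n \<Longrightarrow>
    integrable M (\<lambda>\<omega>. G K n \<omega> * \<nu> k \<omega> ^ 4) \<and> expectation (\<lambda>\<omega>. G K n \<omega> * \<nu> k \<omega> ^ 4) \<le> C"
    using state_moment_bound[OF K] by blast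
  obtain m where m: "0 < m" "\<And>x. m * (\<Sum>i<p. \<bar>x i\<bar>) \<le> cp.nrm x" using cp.nrm_lower_bound by blast
  \<comment> \<open>The summand 1 covers the constant regressor, the other one the coordinates of
    the state.\<close>
  define C' where "C' = 1 + inverse m ^ 4 * C"
  have C': "0 \<le> C'" "1 \<le> C'" "inverse m ^ 4 * C \<le> C'" using C(1) m(1) by (auto simp: C'_def)
  show ?thesis
  proof (rule that[OF C'(1)])
    fix n k i assume n: "n \<ge> p - 1" and k: "k \<in> generation n" and i: "i \<le> p"
    show "integrable M (\<lambda>\<omega>. (G K n \<omega> * y k i \<omega>) ^ 4) \<and> expectation (\<lambda>\<omega>. (G K n \<omega> * y k i \<omega>) ^ 4) \<le> C'"
    proof (cases i)
      case 0 then show ?thesis using G_fourth[of K n] C'(2) by simp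
    next
      case (Suc j)
      then have j: "j < p" using i by simp
      have le: "(G K n \<omega> * y k i \<omega>) ^ 4 \<le> inverse m ^ 4 * (G K n \<omega> * \<nu> k \<omega> ^ 4)" for \<omega>
      proof -
        have "\<bar>X (k div 2 ^ j) \<omega>\<bar> \<le> (\<Sum>i<p. \<bar>X (k div 2 ^ i) \<omega>\<bar>)" by (rule member_le_sum) (use j in auto)
        then have "m * \<bar>X (k div 2 ^ j) \<omega>\<bar> \<le> m * (\<Sum>i<p. \<bar>X (k div 2 ^ i) \<omega>\<bar>)" using m(1) by (intro mult_left_mono) auto
        also have "\<dots> \<le> \<nu> k \<omega>" unfolding \<nu>_def by (rule m(2))
        finally have "\<bar>X (k div 2 ^ j) \<omega>\<bar> \<le> inverse m * \<nu> k \<omega>" using m(1) by (simp add: field_simps)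
        then have "\<bar>X (k div 2 ^ j) \<omega>\<bar> ^ 4 \<le> (inverse m * \<nu> k \<omega>) ^ 4" by (intro power_mono) auto
        then have "X (k div 2 ^ j) \<omega> ^ 4 \<le> inverse m ^ 4 * \<nu> k \<omega> ^ 4" by (simp add: power_even_abs power_mult_distrib)
        then have "G K n \<omega> * X (k div 2 ^ j) \<omega> ^ 4 \<le> G K n \<omega> * (inverse m ^ 4 * \<nu> k \<omega> ^ 4)"
          using G_range(1) by (rule mult_left_mono)
        then show ?thesis using Suc by (simp add: power_mult_distrib G_power mult_ac)
      qed
      have c: "integrable M (\<lambda>\<omega>. inverse m ^ 4 * (G K n \<omega> * \<nu> k \<omega> ^ 4))" using C(2)[OF n k] by simp
      have yM: "y k i \<in> borel_measurable M" by (rule F_to_M[OF y_filtration[OF k n i]])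
      have int: "integrable M (\<lambda>\<omega>. (G K n \<omega> * y k i \<omega>) ^ 4)"
      proof (rule Bochner_Integration.integrable_bound[OF c])
        show "AE \<omega> in M. norm ((G K n \<omega> * y k i \<omega>) ^ 4) \<le> norm (inverse m ^ 4 * (G K n \<omega> * \<nu> k \<omega> ^ 4))"
        proof (rule AE_I2)
          fix \<omega> have "0 \<le> (G K n \<omega> * y k i \<omega>) ^ 4" by simp
          then show "norm ((G K n \<omega> * y k i \<omega>) ^ 4) \<le> norm (inverse m ^ 4 * (G K n \<omega> * \<nu> k \<omega> ^ 4))"
            using le[of \<omega>] by (simp only: real_norm_def abs_of_nonneg order_trans[OF _ abs_ge_self])
        qed
      qed (use yM in simp)
      have "expectation (\<lambda>\<omega>. (G K n \<omega> * y k i \<omega>) ^ 4) \<le> expectation (\<lambda>\<omega>. inverse m ^ 4 * (G K n \<omega> * \<nu> k \<omega> ^ 4))"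
        by (rule integral_mono[OF int c]) (rule le)
      also have "\<dots> \<le> inverse m ^ 4 * C" using C(2)[OF n k] by (simp add: mult_left_mono)
      also have "\<dots> \<le> C'" by (rule C'(3))
      finally show ?thesis using int by simp
    qed
  qed
qed

end

section \<open>Almost sure limits of noise sums\<close>

lemma power_two_four: "((2::real) ^ n)\<^sup>2 = 4 ^ n"
  by (induction n) (simp_all add: power2_eq_square)

context prob_space begin

lemma fourth_product_square:
  fixes f g :: "'a \<Rightarrow> real"
  assumes [measurable]: "f \<in> borel_measurable M" "g \<in> borel_measurable M"
    and int: "integrable M (\<lambda>x. f x ^ 4)" "integrable M (\<lambda>x. g x ^ 4)"
    and bd: "expectation (\<lambda>x. f x ^ 4) \<le> B" "expectation (\<lambda>x. g x ^ 4) \<le> B"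
  shows "integrable M (\<lambda>x. (f x * g x)\<^sup>2)" "expectation (\<lambda>x. (f x * g x)\<^sup>2) \<le> B"
proof -
  show i: "integrable M (\<lambda>x. (f x * g x)\<^sup>2)" by (rule integrable_square_mult) (use int in auto)
  have "expectation (\<lambda>x. (f x * g x)\<^sup>2) \<le> expectation (\<lambda>x. (f x ^ 4 + g x ^ 4) / 2)"
  proof (rule integral_mono[OF i])
    show "(f x * g x)\<^sup>2 \<le> (f x ^ 4 + g x ^ 4) / 2" for x
      using zero_le_power2[of "(f x)\<^sup>2 - (g x)\<^sup>2"]
      by (simp add: power2_diff power_mult[symmetric] power_mult_distrib)
  qed (use int in auto)
  also have "\<dots> = (expectation (\<lambda>x. f x ^ 4) + expectation (\<lambda>x. g x ^ 4)) / 2" using int by simp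
  also have "\<dots> \<le> B" using bd by simp
  finally show "expectation (\<lambda>x. (f x * g x)\<^sup>2) \<le> B" .
qed

end

section \<open>Localized noise sums: moments and limits in mean\<close>

context bar_process begin

text \<open>Before generation p - 1 a cell lacks the p - 1 ancestors its state requires; the value 0
  there lets all sums over generations start at 0 and matches the sums of the estimator. The
  indicator multiplies the regressor, so that it becomes part of a predictable weight.\<close>

definition WG :: "real \<Rightarrow> nat \<Rightarrow> nat \<Rightarrow> nat \<Rightarrow> 'a \<Rightarrow> real" where
  "WG K r n i \<omega> = (if p - 1 \<le> n then \<Sum>k\<in>generation n. e (2 * k + r) \<omega> * (G K n \<omega> * y k i \<omega>) else 0)"

definition UG :: "real \<Rightarrow> nat \<Rightarrow> nat \<Rightarrow> nat \<Rightarrow> 'a \<Rightarrow> real" where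
  "UG K r n i \<omega> = (\<Sum>m<n. WG K r m i \<omega>)"

text \<open>Times \<open>s\<close>, this is the conditional expectation of the product of two
  coordinates of the localized noise sum.\<close>

definition VG :: "real \<Rightarrow> nat \<Rightarrow> nat \<Rightarrow> nat \<Rightarrow> 'a \<Rightarrow> real" where
  "VG K n i j \<omega> = (if p - 1 \<le> n then \<Sum>k\<in>generation n. (G K n \<omega> * y k i \<omega>) * (G K n \<omega> * y k j \<omega>) else 0)"

lemma Gy_filtration:
  "k \<in> generation n \<Longrightarrow> n \<ge> p - 1 \<Longrightarrow> i \<le> p \<Longrightarrow> (\<lambda>\<omega>. G K n \<omega> * y k i \<omega>) \<in> borel_measurable (F n)"
  using G_filtration[of K n] y_filtration[of k n i] by (rule borel_measurable_times)

lemma WG_filtration: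
  assumes r: "r < 2" and i: "i \<le> p"
  shows "WG K r n i \<in> borel_measurable (F (Suc n))"
proof (cases "p - 1 \<le> n")
  case True
  have "(\<lambda>\<omega>. e (2 * k + r) \<omega> * (G K n \<omega> * y k i \<omega>)) \<in> borel_measurable (F (Suc n))" if k: "k \<in> generation n" for k
    by (intro borel_measurable_times e_filtration[OF k True r] filtration_mono[OF le_SucI[OF order_refl] Gy_filtration[OF k True i, unfolded atomize_eq]]
        filtration_mono[OF le_SucI[OF order_refl] G_filtration] filtration_mono[OF le_SucI[OF order_refl] y_filtration[OF k True i]])
  then show ?thesis unfolding WG_def[abs_def] using True by simp
qed (simp add: WG_def[abs_def])

lemma UG_filtration:
  assumes r: "r < 2" and i: "i \<le> p"
  shows "UG K r n i \<in> borel_measurable (F n)"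
  unfolding UG_def[abs_def]
  by (intro borel_measurable_sum filtration_mono[OF _ WG_filtration[OF r i]]) auto

lemma VG_filtration:
  assumes "i \<le> p" "j \<le> p"
  shows "VG K n i j \<in> borel_measurable (F n)"
proof (cases "p - 1 \<le> n")
  case True
  have "(\<lambda>\<omega>. (G K n \<omega> * y k i \<omega>) * (G K n \<omega> * y k j \<omega>)) \<in> borel_measurable (F n)" if "k \<in> generation n" for k
    using Gy_filtration[OF that True] assms by simp
  then show ?thesis unfolding VG_def[abs_def] using True by simp
qed (simp add: VG_def[abs_def])

text \<open>The rate 4^n is the square of the size of the generation, the natural order of the
  fourth moment of a sum of 2^n centred terms.\<close>

definition moment_constant :: "real \<Rightarrow> real \<Rightarrow> bool" where
  "moment_constant K C \<longleftrightarrow> 0 \<le> C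
    \<and> (\<forall>n k i. n \<ge> p - 1 \<longrightarrow> k \<in> generation n \<longrightarrow> i \<le> p \<longrightarrow>
        integrable M (\<lambda>\<omega>. (G K n \<omega> * y k i \<omega>) ^ 4) \<and> expectation (\<lambda>\<omega>. (G K n \<omega> * y k i \<omega>) ^ 4) \<le> C)
    \<and> (\<forall>n i r. i \<le> p \<longrightarrow> r < 2 \<longrightarrow>
        integrable M (\<lambda>\<omega>. WG K r n i \<omega> ^ 4) \<and> expectation (\<lambda>\<omega>. WG K r n i \<omega> ^ 4) \<le> C * 4 ^ n
        \<and> integrable M (\<lambda>\<omega>. UG K r n i \<omega> ^ 4) \<and> expectation (\<lambda>\<omega>. UG K r n i \<omega> ^ 4) \<le> C * 4 ^ n)"

lemma moment_constantD:
  assumes "moment_constant K C"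
  shows "0 \<le> C"
    "\<And>n k i. n \<ge> p - 1 \<Longrightarrow> k \<in> generation n \<Longrightarrow> i \<le> p \<Longrightarrow> integrable M (\<lambda>\<omega>. (G K n \<omega> * y k i \<omega>) ^ 4)"
    "\<And>n k i. n \<ge> p - 1 \<Longrightarrow> k \<in> generation n \<Longrightarrow> i \<le> p \<Longrightarrow> expectation (\<lambda>\<omega>. (G K n \<omega> * y k i \<omega>) ^ 4) \<le> C"
    "\<And>n i r. i \<le> p \<Longrightarrow> r < 2 \<Longrightarrow> integrable M (\<lambda>\<omega>. WG K r n i \<omega> ^ 4)"
    "\<And>n i r. i \<le> p \<Longrightarrow> r < 2 \<Longrightarrow> expectation (\<lambda>\<omega>. WG K r n i \<omega> ^ 4) \<le> C * 4 ^ n"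
    "\<And>n i r. i \<le> p \<Longrightarrow> r < 2 \<Longrightarrow> integrable M (\<lambda>\<omega>. UG K r n i \<omega> ^ 4)"
    "\<And>n i r. i \<le> p \<Longrightarrow> r < 2 \<Longrightarrow> expectation (\<lambda>\<omega>. UG K r n i \<omega> ^ 4) \<le> C * 4 ^ n"
  using assms unfolding moment_constant_def by blast+

text \<open>For one generation this is the fourth moment bound for conditionally independent sums.
  For \<open>UG\<close> no orthogonality across generations is needed: the bounds for
  \<open>WG\<close> grow so fast that a crude recursion suffices.\<close>

lemma moment_constant_exists:
  assumes K: "0 \<le> K"
  shows "\<exists>C. moment_constant K C"
proof -
  obtain C where C: "0 \<le> C" "\<And>n k i. n \<ge> p - 1 \<Longrightarrow> k \<in> generation n \<Longrightarrow> i \<le> p \<Longrightarrow>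
    integrable M (\<lambda>\<omega>. (G K n \<omega> * y k i \<omega>) ^ 4) \<and> expectation (\<lambda>\<omega>. (G K n \<omega> * y k i \<omega>) ^ 4) \<le> C"
    using regressor_moment_bound[OF K] by blast
  define D where "D = (8 * s\<^sup>2 + 3 * K) * C"
  have D0: "0 \<le> D" unfolding D_def using K C(1) by simp
  have W: "integrable M (\<lambda>\<omega>. WG K r n i \<omega> ^ 4) \<and> expectation (\<lambda>\<omega>. WG K r n i \<omega> ^ 4) \<le> D * 4 ^ n"
    if i: "i \<le> p" and r: "r < 2" for r n i
  proof (cases "p - 1 \<le> n")
    case True
    interpret nb: noise_block M "F n" "\<lambda>k. e (2 * k + r)" "generation n" s K by (rule generation_noise_block[OF True r K])
    have w: "nb.weight k (\<lambda>\<omega>. G K n \<omega> * y k i \<omega>)" if k: "k \<in> generation n" for k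
      by (rule G_weight[OF True r K k y_filtration[OF k True i]]) (use C(2)[OF True k i] in blast)
    have "integrable M (\<lambda>\<omega>. (\<Sum>k\<in>generation n. e (2 * k + r) \<omega> * (G K n \<omega> * y k i \<omega>)) ^ 4)"
      by (rule nb.expectation_sum_fourth(1)[OF order_refl w _ C(1)]) (use C(2)[OF True _ i] in auto)
    moreover have "expectation (\<lambda>\<omega>. (\<Sum>k\<in>generation n. e (2 * k + r) \<omega> * (G K n \<omega> * y k i \<omega>)) ^ 4)
        \<le> D * (real (card (generation n)))\<^sup>2"
      unfolding D_def
      by (rule nb.expectation_sum_fourth(2)[OF order_refl w _ C(1)]) (use C(2)[OF True _ i] in auto)
    moreover have "(real (card (generation n)))\<^sup>2 = 4 ^ n" by (simp add: power_two_four)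
    ultimately show ?thesis using True by (simp add: WG_def)
  next
    case False
    then show ?thesis using D0 by (simp add: WG_def)
  qed
  have U: "integrable M (\<lambda>\<omega>. UG K r n i \<omega> ^ 4) \<and> expectation (\<lambda>\<omega>. UG K r n i \<omega> ^ 4) \<le> 40 * D * 4 ^ n"
    if i: "i \<le> p" and r: "r < 2" for r n i
  proof (induction n)
    case 0 then show ?case using D0 by (simp add: UG_def)
  next
    case (Suc n)
    have UM: "UG K r n i \<in> borel_measurable M" by (rule F_to_M[OF UG_filtration[OF r i]])
    have WM: "WG K r n i \<in> borel_measurable M" by (rule F_to_M[OF WG_filtration[OF r i]])
    have eq: "UG K r (Suc n) i \<omega> = UG K r n i \<omega> + WG K r n i \<omega>" for \<omega> by (simp add: UG_def)
    have int: "integrable M (\<lambda>\<omega>. UG K r (Suc n) i \<omega> ^ 4)"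
      unfolding eq by (rule integrable_fourth_add[OF UM WM]) (use Suc W[OF i r] in auto)
    \<comment> \<open>Convexity with t = 3/4 gives the coefficients (3/4) (4/3)^4 = 64/27 and 1 /
      (1/4)^3 = 64. As 64/27 < 4, growth of order 4^n is preserved, and 40 satisfies (64/27) 40 + 64
      \<le> 160.\<close>
    have "expectation (\<lambda>\<omega>. UG K r (Suc n) i \<omega> ^ 4) \<le> expectation (\<lambda>\<omega>. 64/27 * UG K r n i \<omega> ^ 4 + 64 * WG K r n i \<omega> ^ 4)"
    proof (rule integral_mono[OF int])
      fix \<omega>
      show "UG K r (Suc n) i \<omega> ^ 4 \<le> 64/27 * UG K r n i \<omega> ^ 4 + 64 * WG K r n i \<omega> ^ 4"
        using convex_power_four[of "3/4" "4/3 * UG K r n i \<omega>" "WG K r n i \<omega>"]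
        unfolding eq by (simp add: power_mult_distrib power_divide eval_nat_numeral)
    qed (use Suc W[OF i r] in auto)
    also have "\<dots> = 64/27 * expectation (\<lambda>\<omega>. UG K r n i \<omega> ^ 4) + 64 * expectation (\<lambda>\<omega>. WG K r n i \<omega> ^ 4)"
      using Suc W[OF i r] by simp
    also have "\<dots> \<le> 64/27 * (40 * D * 4 ^ n) + 64 * (D * 4 ^ n)"
      using Suc W[OF i r] by (intro add_mono mult_left_mono) auto
    also have "\<dots> \<le> 40 * D * 4 ^ Suc n" using D0 by simp
    finally show ?case using int by blast
  qed
  define C' where "C' = C + 40 * D"
  have "D \<le> C'" "40 * D \<le> C'" "C \<le> C'" "0 \<le> C'" using D0 C(1) by (auto simp: C'_def)
  then have le: "D * 4 ^ n \<le> C' * 4 ^ n" "40 * D * 4 ^ n \<le> C' * 4 ^ n" for n :: nat by (auto intro: mult_right_mono)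
  have "moment_constant K C'"
    unfolding moment_constant_def
  proof (intro conjI allI impI)
    show "expectation (\<lambda>\<omega>. WG K r n i \<omega> ^ 4) \<le> C' * 4 ^ n" if "i \<le> p" "r < 2" for n i r
      using W[OF that, of n] le(1)[of n] by linarith
    show "expectation (\<lambda>\<omega>. UG K r n i \<omega> ^ 4) \<le> C' * 4 ^ n" if "i \<le> p" "r < 2" for n i r
      using U[OF that, of n] le(2)[of n] by linarith
    show "expectation (\<lambda>\<omega>. (G K n \<omega> * y k i \<omega>) ^ 4) \<le> C'" if "n \<ge> p - 1" "k \<in> generation n" "i \<le> p" for n k i
      using C(2)[OF that] \<open>C \<le> C'\<close> by linarith
  qed (use C(2) W U \<open>0 \<le> C'\<close> in blast)+
  then show ?thesis by blast
qed

text \<open>Dividing by 2^n turns the fourth moment bound C 4^n into C 4^-n, which is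
  summable.\<close>

lemma WG_law:
  assumes K: "0 \<le> K" and r: "r < 2" and i: "i \<le> p"
  shows "AE \<omega> in M. (\<lambda>n. WG K r n i \<omega> / 2 ^ n) \<longlonglongrightarrow> 0"
proof -
  obtain C where "moment_constant K C" using moment_constant_exists[OF K] by blast
  note C = moment_constantD[OF this]
  show ?thesis
  proof (rule AE_tendsto_0_power[where r = 4 and B = "\<lambda>n. C * (1/4) ^ n"])
    fix n
    show "integrable M (\<lambda>\<omega>. (WG K r n i \<omega> / 2 ^ n) ^ 4)" unfolding power_divide using C(4)[OF i r] by simp
    have "expectation (\<lambda>\<omega>. (WG K r n i \<omega> / 2 ^ n) ^ 4) = expectation (\<lambda>\<omega>. WG K r n i \<omega> ^ 4) / (2 ^ n) ^ 4"
      unfolding power_divide by simp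
    also have "\<dots> \<le> C * 4 ^ n / (2 ^ n) ^ 4" by (intro divide_right_mono C(5)[OF i r]) simp
    also have "((2::real) ^ n) ^ 4 = 4 ^ n * 4 ^ n"
      unfolding power_two_four[symmetric] by (simp add: power4_eq_xxxx power2_eq_square)
    finally show "expectation (\<lambda>\<omega>. (WG K r n i \<omega> / 2 ^ n) ^ 4) \<le> C * (1/4) ^ n"
      by (simp add: power_divide)
  qed (auto intro!: summable_mult summable_geometric)
qed

text \<open>Second moments suffice: the sum over the generation has variance of order 2^n, and the
  normalization divides it by 4^n.\<close>

lemma square_noise_law:
  assumes K: "0 \<le> K" and r: "r < 2"
  shows "AE \<omega> in M. (\<lambda>n. if p - 1 \<le> n then (\<Sum>k\<in>generation n. ((e (2 * k + r) \<omega>)\<^sup>2 - s) * G K n \<omega>) / 2 ^ n else 0) \<longlonglongrightarrow> 0"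
proof (rule AE_tendsto_0_power[where r = 2 and B = "\<lambda>n. (K + s\<^sup>2) * (1/2) ^ n"])
  fix n
  let ?f = "\<lambda>\<omega>. if p - 1 \<le> n then (\<Sum>k\<in>generation n. ((e (2 * k + r) \<omega>)\<^sup>2 - s) * G K n \<omega>) / 2 ^ n else 0"
  have "integrable M (\<lambda>\<omega>. (?f \<omega>)\<^sup>2) \<and> expectation (\<lambda>\<omega>. (?f \<omega>)\<^sup>2) \<le> (K + s\<^sup>2) * (1/2) ^ n"
  proof (cases "p - 1 \<le> n")
    case False then show ?thesis using K by simp
  next
    case True
    interpret nb: noise_block M "F n" "\<lambda>k. e (2 * k + r)" "generation n" s K by (rule generation_noise_block[OF True r K])
    have w: "nb.weight k (G K n)" if k: "k \<in> generation n" for k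
      using G_weight[OF True r K k _ G_fourth(1)] by simp
    note sd = nb.expectation_square_deviation[OF w G_cases]
    have i: "integrable M (\<lambda>\<omega>. (?f \<omega>)\<^sup>2)" unfolding power_divide if_P[OF True] using sd(1) by simp
    have "expectation (\<lambda>\<omega>. (?f \<omega>)\<^sup>2) = expectation (\<lambda>\<omega>. (\<Sum>k\<in>generation n. ((e (2 * k + r) \<omega>)\<^sup>2 - s) * G K n \<omega>)\<^sup>2) / (2 ^ n)\<^sup>2"
      unfolding power_divide if_P[OF True] by simp
    also have "\<dots> \<le> (K + s\<^sup>2) * real (card (generation n)) / (2 ^ n)\<^sup>2"
      by (rule divide_right_mono[OF sd(2) zero_le_power2])
    also have "\<dots> = (K + s\<^sup>2) * (1/2) ^ n" by (simp add: power2_eq_square power_divide)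
    finally show ?thesis using i by blast
  qed
  then show "integrable M (\<lambda>\<omega>. (?f \<omega>)\<^sup>2)" "expectation (\<lambda>\<omega>. (?f \<omega>)\<^sup>2) \<le> (K + s\<^sup>2) * (1/2) ^ n" by blast+
qed (auto intro!: summable_mult summable_geometric)

text \<open>The bounds on the normalized terms do not decay, so only their means are treated. Each
  term is conditionally centred given the past of its generation, and earlier terms belong to that
  past; this is the orthogonality for the strong law.\<close>

lemma product_noise_law:
  assumes K: "0 \<le> K" and r: "r < 2" and i: "i \<le> p" and j: "j \<le> p"
  shows "AE \<omega> in M. (\<lambda>n. (\<Sum>k<n. (WG K r k i \<omega> * WG K r k j \<omega> - s * VG K k i j \<omega>) / 2 ^ k) / real n) \<longlonglongrightarrow> 0"
proof -
  obtain C where "moment_constant K C" using moment_constant_exists[OF K] by blast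
  note C = moment_constantD[OF this]
  define f where "f k \<omega> = (WG K r k i \<omega> * WG K r k j \<omega> - s * VG K k i j \<omega>) / 2 ^ k" for k \<omega>
  have WM: "WG K r n i \<in> borel_measurable M" if "i \<le> p" for n i by (rule F_to_M[OF WG_filtration[OF r that]])
  have VM: "VG K n i j \<in> borel_measurable M" for n by (rule F_to_M[OF VG_filtration[OF i j]])
  have fF: "f k \<in> borel_measurable (F (Suc k))" for k
    unfolding f_def[abs_def]
    using WG_filtration[OF r i, of K k] WG_filtration[OF r j, of K k]
      filtration_mono[OF le_SucI[OF order_refl] VG_filtration[OF i j, of K k]] by simp
  have WW: "integrable M (\<lambda>\<omega>. (WG K r n i \<omega> * WG K r n j \<omega>)\<^sup>2)"
      "expectation (\<lambda>\<omega>. (WG K r n i \<omega> * WG K r n j \<omega>)\<^sup>2) \<le> C * 4 ^ n" for n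
    using fourth_product_square[OF WM[OF i] WM[OF j] C(4)[OF i r] C(4)[OF j r] C(5)[OF i r] C(5)[OF j r]] by auto
  have VV: "integrable M (\<lambda>\<omega>. (VG K n i j \<omega>)\<^sup>2) \<and> expectation (\<lambda>\<omega>. (VG K n i j \<omega>)\<^sup>2) \<le> C * 4 ^ n" for n
  proof (cases "p - 1 \<le> n")
    case False then show ?thesis using C(1) by (simp add: VG_def)
  next
    case True
    let ?g = "\<lambda>k \<omega>. (G K n \<omega> * y k i \<omega>) * (G K n \<omega> * y k j \<omega>)"
    have gM: "?g k \<in> borel_measurable M" if k: "k \<in> generation n" for k
      using F_to_M[OF Gy_filtration[OF k True i]] F_to_M[OF Gy_filtration[OF k True j]] by simp
    have g: "integrable M (\<lambda>\<omega>. (?g k \<omega>)\<^sup>2) \<and> expectation (\<lambda>\<omega>. (?g k \<omega>)\<^sup>2) \<le> C" if k: "k \<in> generation n" for k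
      using fourth_product_square[OF F_to_M[OF Gy_filtration[OF k True i]] F_to_M[OF Gy_filtration[OF k True j]]
        C(2)[OF True k i] C(2)[OF True k j] C(3)[OF True k i] C(3)[OF True k j]] by blast
    have int: "integrable M (\<lambda>\<omega>. (\<Sum>k\<in>generation n. ?g k \<omega>)\<^sup>2)"
      by (rule integrable_sum_squared) (use gM g in auto)
    have "expectation (\<lambda>\<omega>. (\<Sum>k\<in>generation n. ?g k \<omega>)\<^sup>2) \<le> expectation (\<lambda>\<omega>. 2 ^ n * (\<Sum>k\<in>generation n. (?g k \<omega>)\<^sup>2))"
    proof (rule integral_mono[OF int])
      show "(\<Sum>k\<in>generation n. ?g k \<omega>)\<^sup>2 \<le> 2 ^ n * (\<Sum>k\<in>generation n. (?g k \<omega>)\<^sup>2)" for \<omega>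
        using sum_squared_le_sum_of_squares[of "\<lambda>k. ?g k \<omega>" "generation n"] by (simp add: mult.commute)
    qed (use g in auto)
    also have "\<dots> = 2 ^ n * (\<Sum>k\<in>generation n. expectation (\<lambda>\<omega>. (?g k \<omega>)\<^sup>2))"
      using g by (subst integral_mult_right_zero, subst Bochner_Integration.integral_sum) auto
    also have "\<dots> \<le> 2 ^ n * (\<Sum>k\<in>generation n. C)" using g by (intro mult_left_mono sum_mono) auto
    also have "\<dots> = C * 4 ^ n" unfolding power_two_four[symmetric] by (simp add: power2_eq_square)
    finally show ?thesis using int True by (simp add: VG_def)
  qed
  have fM: "f k \<in> borel_measurable M" for k by (rule F_to_M[OF fF])
  have f2: "integrable M (\<lambda>\<omega>. (f n \<omega>)\<^sup>2) \<and> expectation (\<lambda>\<omega>. (f n \<omega>)\<^sup>2) \<le> 2 * (C + s\<^sup>2 * C)" for n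
  proof -
    let ?h = "\<lambda>\<omega>. 2 * ((WG K r n i \<omega> * WG K r n j \<omega>)\<^sup>2 + s\<^sup>2 * (VG K n i j \<omega>)\<^sup>2) / 4 ^ n"
    have h: "integrable M ?h" using WW(1)[of n] VV[of n] by simp
    have le: "(f n \<omega>)\<^sup>2 \<le> ?h \<omega>" for \<omega>
    proof -
      have "(u - v)\<^sup>2 \<le> 2 * (u\<^sup>2 + v\<^sup>2)" for u v :: real
        using zero_le_power2[of "u + v"] by (simp add: power2_sum power2_diff)
      then have "(WG K r n i \<omega> * WG K r n j \<omega> - s * VG K n i j \<omega>)\<^sup>2
          \<le> 2 * ((WG K r n i \<omega> * WG K r n j \<omega>)\<^sup>2 + s\<^sup>2 * (VG K n i j \<omega>)\<^sup>2)"
        unfolding power_mult_distrib[of s, symmetric] .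
      then show ?thesis unfolding f_def power_divide power_two_four by (rule divide_right_mono) simp
    qed
    have int: "integrable M (\<lambda>\<omega>. (f n \<omega>)\<^sup>2)"
    proof (rule Bochner_Integration.integrable_bound[OF h])
      show "AE \<omega> in M. norm ((f n \<omega>)\<^sup>2) \<le> norm (?h \<omega>)"
      proof (rule AE_I2)
        fix \<omega> show "norm ((f n \<omega>)\<^sup>2) \<le> norm (?h \<omega>)"
          using le[of \<omega>] abs_ge_self[of "?h \<omega>"] by (simp only: real_norm_def abs_power2)
      qed
    qed (use fM in simp)
    have "expectation (\<lambda>\<omega>. (f n \<omega>)\<^sup>2) \<le> expectation ?h" by (rule integral_mono[OF int h]) (rule le)
    also have "\<dots> = 2 * (expectation (\<lambda>\<omega>. (WG K r n i \<omega> * WG K r n j \<omega>)\<^sup>2) + s\<^sup>2 * expectation (\<lambda>\<omega>. (VG K n i j \<omega>)\<^sup>2)) / 4 ^ n"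
      using WW(1)[of n] VV[of n] by simp
    also have "\<dots> \<le> 2 * (C * 4 ^ n + s\<^sup>2 * (C * 4 ^ n)) / 4 ^ n"
      using WW(2)[of n] VV[of n] by (intro divide_right_mono mult_left_mono add_mono) auto
    also have "\<dots> = 2 * (C + s\<^sup>2 * C)" by (simp add: field_simps)
    finally show ?thesis using int by blast
  qed
  have orth: "expectation (\<lambda>\<omega>. f m \<omega> * f n \<omega>) = 0" if mn: "m < n" for m n
  proof (cases "p - 1 \<le> n")
    case False then show ?thesis by (simp add: f_def WG_def VG_def)
  next
    case True
    interpret nb: noise_block M "F n" "\<lambda>k. e (2 * k + r)" "generation n" s K by (rule generation_noise_block[OF True r K])
    have w: "nb.weight k (\<lambda>\<omega>. G K n \<omega> * y k i \<omega>)" if k: "k \<in> generation n" and i: "i \<le> p" for k i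
      by (rule G_weight[OF True r K k y_filtration[OF k True i] C(2)[OF True k i]])
    have fmF: "f m \<in> borel_measurable (F n)" by (rule filtration_mono[OF _ fF]) (use mn in simp)
    have "expectation (\<lambda>\<omega>. f m \<omega> * f n \<omega>) = expectation (\<lambda>\<omega>. (WG K r n i \<omega> * WG K r n j \<omega> - s * VG K n i j \<omega>) * f m \<omega> / 2 ^ n)"
      by (rule Bochner_Integration.integral_cong) (simp_all add: f_def[of n])
    also have "\<dots> = expectation (\<lambda>\<omega>. (WG K r n i \<omega> * WG K r n j \<omega> - s * VG K n i j \<omega>) * f m \<omega>) / 2 ^ n" by simp
    also have "expectation (\<lambda>\<omega>. (WG K r n i \<omega> * WG K r n j \<omega> - s * VG K n i j \<omega>) * f m \<omega>) = 0"
      using nb.expectation_product_mult[OF w[OF _ i] w[OF _ j] fmF] f2[of m] True by (simp add: WG_def VG_def)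
    finally show ?thesis by simp
  qed
  have "AE \<omega> in M. (\<lambda>n. (\<Sum>k<n. f k \<omega>) / real n) \<longlonglongrightarrow> 0"
    by (rule orthogonal_strong_law[OF fM, where C = "2 * (C + s\<^sup>2 * C)"]) (use f2 orth in auto)
  then show ?thesis by (simp add: f_def)
qed

text \<open>Here \<open>UG\<close> belongs to the past and \<open>WG\<close> is conditionally
  centred, so no centring term appears. Boundedness in L^2 uses fourth moments of both
  factors.\<close>

lemma cross_noise_law:
  assumes K: "0 \<le> K" and r: "r < 2" and i: "i \<le> p" and j: "j \<le> p"
  shows "AE \<omega> in M. (\<lambda>n. (\<Sum>k<n. UG K r k i \<omega> * WG K r k j \<omega> / 2 ^ k) / real n) \<longlonglongrightarrow> 0"
proof -
  obtain C where "moment_constant K C" using moment_constant_exists[OF K] by blast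
  note C = moment_constantD[OF this]
  define f where "f k \<omega> = UG K r k i \<omega> * WG K r k j \<omega> / 2 ^ k" for k \<omega>
  have WM: "WG K r n j \<in> borel_measurable M" for n by (rule F_to_M[OF WG_filtration[OF r j]])
  have UM: "UG K r n i \<in> borel_measurable M" for n by (rule F_to_M[OF UG_filtration[OF r i]])
  have fF: "f k \<in> borel_measurable (F (Suc k))" for k
    unfolding f_def[abs_def]
    using WG_filtration[OF r j, of K k] filtration_mono[OF le_SucI[OF order_refl] UG_filtration[OF r i, of K k]] by simp
  have fM: "f k \<in> borel_measurable M" for k by (rule F_to_M[OF fF])
  have UW: "integrable M (\<lambda>\<omega>. (UG K r n i \<omega> * WG K r n j \<omega>)\<^sup>2)"
      "expectation (\<lambda>\<omega>. (UG K r n i \<omega> * WG K r n j \<omega>)\<^sup>2) \<le> C * 4 ^ n" for n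
    using fourth_product_square[OF UM WM C(6)[OF i r] C(4)[OF j r] C(7)[OF i r] C(5)[OF j r]] by auto
  have f2: "integrable M (\<lambda>\<omega>. (f n \<omega>)\<^sup>2)" "expectation (\<lambda>\<omega>. (f n \<omega>)\<^sup>2) \<le> C" for n
  proof -
    show "integrable M (\<lambda>\<omega>. (f n \<omega>)\<^sup>2)" unfolding f_def power_divide using UW(1)[of n] by simp
    have "expectation (\<lambda>\<omega>. (f n \<omega>)\<^sup>2) = expectation (\<lambda>\<omega>. (UG K r n i \<omega> * WG K r n j \<omega>)\<^sup>2) / 4 ^ n"
      unfolding f_def power_divide power_two_four by simp
    also have "\<dots> \<le> C * 4 ^ n / 4 ^ n" using UW(2)[of n] by (rule divide_right_mono) simp
    finally show "expectation (\<lambda>\<omega>. (f n \<omega>)\<^sup>2) \<le> C" by simp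
  qed
  have orth: "expectation (\<lambda>\<omega>. f m \<omega> * f n \<omega>) = 0" if mn: "m < n" for m n
  proof (cases "p - 1 \<le> n")
    case False then show ?thesis by (simp add: f_def WG_def)
  next
    case True
    interpret nb: noise_block M "F n" "\<lambda>k. e (2 * k + r)" "generation n" s K by (rule generation_noise_block[OF True r K])
    have w: "nb.weight k (\<lambda>\<omega>. G K n \<omega> * y k j \<omega>)" if k: "k \<in> generation n" for k
      by (rule G_weight[OF True r K k y_filtration[OF k True j] C(2)[OF True k j]])
    have fmF: "f m \<in> borel_measurable (F n)" by (rule filtration_mono[OF _ fF]) (use mn in simp)
    have gF: "(\<lambda>\<omega>. UG K r n i \<omega> * f m \<omega>) \<in> borel_measurable (F n)"
      using fmF UG_filtration[OF r i, of K n] by simp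
    have "expectation (\<lambda>\<omega>. f m \<omega> * f n \<omega>) = expectation (\<lambda>\<omega>. WG K r n j \<omega> * (UG K r n i \<omega> * f m \<omega>) / 2 ^ n)"
      by (rule Bochner_Integration.integral_cong) (simp_all add: f_def[of n] mult_ac)
    also have "\<dots> = expectation (\<lambda>\<omega>. WG K r n j \<omega> * (UG K r n i \<omega> * f m \<omega>)) / 2 ^ n" by simp
    also have "expectation (\<lambda>\<omega>. WG K r n j \<omega> * (UG K r n i \<omega> * f m \<omega>)) = 0"
    proof -
      have "expectation (\<lambda>\<omega>. (\<Sum>k\<in>generation n. e (2 * k + r) \<omega> * (G K n \<omega> * y k j \<omega>)) * (UG K r n i \<omega> * f m \<omega>)) = 0"
      proof (rule nb.expectation_sum_mult[OF _ gF])
        fix k assume k: "k \<in> generation n"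
        show "(\<lambda>\<omega>. G K n \<omega> * y k j \<omega>) \<in> borel_measurable (F n)" by (rule Gy_filtration[OF k True j])
        have vM: "(\<lambda>\<omega>. e (2 * k + r) \<omega> * (G K n \<omega> * y k j \<omega>)) \<in> borel_measurable M"
          using e_M[OF k True r] F_to_M[OF Gy_filtration[OF k True j]] by simp
        have m: "(\<lambda>\<omega>. e (2 * k + r) \<omega> * (G K n \<omega> * y k j \<omega>) * UG K r n i \<omega>) \<in> borel_measurable M"
          using vM UM[of n] by (rule borel_measurable_times)
        have "integrable M (\<lambda>\<omega>. (e (2 * k + r) \<omega> * (G K n \<omega> * y k j \<omega>) * UG K r n i \<omega>)\<^sup>2)"
          by (rule integrable_square_mult[OF vM UM nb.weight_fourth(1)[OF k w[OF k]] C(6)[OF i r]])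
        from integrable_mult_squares[OF m fM[of m] this f2(1)]
        show "integrable M (\<lambda>\<omega>. e (2 * k + r) \<omega> * (G K n \<omega> * y k j \<omega>) * (UG K r n i \<omega> * f m \<omega>))"
          by (simp add: mult.assoc)
      qed
      then show ?thesis using True by (simp add: WG_def)
    qed
    finally show ?thesis by simp
  qed
  have "AE \<omega> in M. (\<lambda>n. (\<Sum>k<n. f k \<omega>) / real n) \<longlonglongrightarrow> 0"
    by (rule orthogonal_strong_law[OF fM, where C = C]) (use f2 orth in auto)
  then show ?thesis by (simp add: f_def)
qed

end

section \<open>The estimator and the limiting matrices\<close>

lemma mult_mat_vec_entry:
  assumes "P \<in> carrier_mat n k" "i < n" "dim_vec v = k"
  shows "vec_index (P *\<^sub>v v) i = (\<Sum>j<k. P $$ (i, j) * vec_index v j)"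
  using assms by (auto simp: scalar_prod_def atLeast0LessThan intro!: sum.cong)

lemma mult_mat_entry:
  assumes "P \<in> carrier_mat n k" "Q \<in> carrier_mat k q" "i < n" "j < q"
  shows "(P * Q) $$ (i, j) = (\<Sum>l<k. P $$ (i, l) * Q $$ (l, j))"
  using assms by (auto simp: scalar_prod_def atLeast0LessThan intro!: sum.cong)

text \<open>The kernel is described by scalar sums, the form in which the analytic arguments prove
  it trivial. It forces a nonzero determinant, and this makes the partial function behind
  \<open>inv_mat\<close> return an inverse.\<close>

lemma inv_mat_of_trivial_kernel:
  fixes P :: "real mat"
  assumes P: "P \<in> carrier_mat n n"
    and ker: "\<And>x i. (\<And>i. i < n \<Longrightarrow> (\<Sum>j<n. P $$ (i, j) * x j) = 0) \<Longrightarrow> i < n \<Longrightarrow> x i = 0"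
  shows "invertible_mat P" "inv_mat P \<in> carrier_mat n n" "P * inv_mat P = 1\<^sub>m n" "inv_mat P * P = 1\<^sub>m n"
proof -
  have "det P \<noteq> 0"
  proof
    assume "det P = 0"
    then obtain v where v: "v \<in> carrier_vec n" "v \<noteq> 0\<^sub>v n" "P *\<^sub>v v = 0\<^sub>v n"
      using det_0_iff_vec_prod_zero_field[OF P] by blast
    have "(\<Sum>j<n. P $$ (i, j) * vec_index v j) = 0" if "i < n" for i
    proof -
      have "vec_index (P *\<^sub>v v) i = 0" using v(3) that by simp
      then show ?thesis using mult_mat_vec_entry[OF P that, of v] v(1) by simp
    qed
    then have "vec_index v i = 0" if "i < n" for i using ker[of "vec_index v" i] that by blast
    then have "v = 0\<^sub>v n" using v(1) by (intro eq_vecI) auto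
    then show False using v(2) by simp
  qed
  then have "P \<in> Units (ring_mat TYPE(real) n ())" by (rule det_non_zero_imp_unit[OF P])
  then obtain Q where Q: "mat_inverse P = Some Q" using mat_inverse(1)[OF P, of "()"] by (cases "mat_inverse P") auto
  then have "inv_mat P = Q" by (simp add: inv_mat_def)
  with mat_inverse(2)[OF P Q] show 1: "inv_mat P \<in> carrier_mat n n" "P * inv_mat P = 1\<^sub>m n" "inv_mat P * P = 1\<^sub>m n"
    by auto
  show "invertible_mat P" unfolding invertible_mat_def inverts_mat_def
    using P 1 by (intro conjI exI[of _ "inv_mat P"]) auto
qed

lemma companion_carrier [simp]: "companion p a \<in> carrier_mat p p" by (simp add: companion_def)

lemma companion_dim [simp]: "dim_row (companion p a) = p" "dim_col (companion p a) = p"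
  by (simp_all add: companion_def)

lemma companion_entry: "i < p \<Longrightarrow> j < p \<Longrightarrow> companion p a $$ (i, j) = companion_fn a i j"
  by (simp add: companion_def companion_fn_def)

lemma companion_mult_vec:
  "i < p \<Longrightarrow> dim_vec v = p \<Longrightarrow> vec_index (companion p a *\<^sub>v v) i = (\<Sum>j<p. companion_fn a i j * vec_index v j)"
  using mult_mat_vec_entry[OF companion_carrier, of i p v a] by (simp add: companion_entry)

section \<open>Lambda and ell as fixed points of contractions\<close>

locale companion_pair = contracting_pair p N "companion_fn a" "companion_fn b" \<beta>
  for p N a b \<beta>
begin

text \<open>The mean of the two companion matrices contracts, so a null vector of identity minus
  mean is a fixed point of a contraction and vanishes. The inverse in the definition of lambda is
  therefore genuine.\<close>

lemma lambda_carrier: "lambda_vec p a b \<in> carrier_vec p"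
  and lambda_fixed: "i < p \<Longrightarrow> vec_index (lambda_vec p a b) i
    = mean_op (vec_index (lambda_vec p a b)) i + (if i = 0 then (a 0 + b 0) / 2 else 0)"
proof -
  define P where "P = 1\<^sub>m p - (1 / 2) \<cdot>\<^sub>m (companion p a + companion p b)"
  have P: "P \<in> carrier_mat p p" unfolding P_def by (intro minus_carrier_mat smult_carrier_mat add_carrier_mat companion_carrier)
  have Px: "(\<Sum>j<p. P $$ (i, j) * x j) = x i - mean_op x i" if i: "i < p" for x i
  proof -
    have "(\<Sum>j<p. P $$ (i, j) * x j) = (\<Sum>j<p. (if i = j then x j else 0) - (companion_fn a i j * x j + companion_fn b i j * x j) / 2)"
    proof (rule sum.cong[OF refl])
      fix j assume "j \<in> {..<p}"
      then have "P $$ (i, j) = (if i = j then 1 else 0) - (companion_fn a i j + companion_fn b i j) / 2"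
        using i companion_carrier[of p a] companion_carrier[of p b] by (simp add: P_def companion_entry)
      then show "P $$ (i, j) * x j = (if i = j then x j else 0) - (companion_fn a i j * x j + companion_fn b i j * x j) / 2"
        by (cases "i = j") (simp_all add: left_diff_distrib distrib_right)
    qed
    also have "\<dots> = x i - mean_op x i"
      using i by (simp add: sum_subtractf mean_op_def sum.distrib[symmetric] sum_divide_distrib)
    finally show ?thesis .
  qed
  note inv = inv_mat_of_trivial_kernel[OF P]
  have ker: "x i = 0" if "\<And>i. i < p \<Longrightarrow> (\<Sum>j<p. P $$ (i, j) * x j) = 0" "i < p" for x i
    by (rule mean_op_fixed_0[OF _ that(2)]) (use that(1) Px in force)
  have iP: "inv_mat P \<in> carrier_mat p p" "P * inv_mat P = 1\<^sub>m p" using inv(2,3) ker by blast+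
  define c where "c = (a 0 + b 0) / 2"
  have lam: "lambda_vec p a b = c \<cdot>\<^sub>v (inv_mat P *\<^sub>v unit_vec p 0)"
    by (simp add: lambda_vec_def P_def c_def)
  show car: "lambda_vec p a b \<in> carrier_vec p" unfolding lam using iP by simp
  have "P *\<^sub>v lambda_vec p a b = c \<cdot>\<^sub>v (P *\<^sub>v (inv_mat P *\<^sub>v unit_vec p 0))"
    unfolding lam using P iP by (simp add: mult_mat_vec)
  also have "P *\<^sub>v (inv_mat P *\<^sub>v unit_vec p 0) = (P * inv_mat P) *\<^sub>v unit_vec p 0"
    using P iP by (intro assoc_mult_mat_vec[symmetric]) auto
  also have "\<dots> = unit_vec p 0" using iP by simp
  finally have eq: "P *\<^sub>v lambda_vec p a b = c \<cdot>\<^sub>v unit_vec p 0" .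
  assume i: "i < p"
  have "(\<Sum>j<p. P $$ (i, j) * vec_index (lambda_vec p a b) j) = vec_index (c \<cdot>\<^sub>v unit_vec p 0) i"
    unfolding eq[symmetric] by (rule mult_mat_vec_entry[symmetric, OF P i]) (use car in simp)
  also have "\<dots> = (if i = 0 then c else 0)" using i p_pos by simp
  finally show "vec_index (lambda_vec p a b) i
    = mean_op (vec_index (lambda_vec p a b)) i + (if i = 0 then (a 0 + b 0) / 2 else 0)"
    unfolding Px[OF i] c_def by simp
qed

lemma congr_entry:
  assumes l: "l \<in> carrier_mat p p" and ij: "i < p" "j < p"
  shows "((1 / 2) \<cdot>\<^sub>m (companion p a * l * transpose_mat (companion p a)
      + companion p b * l * transpose_mat (companion p b))) $$ (i, j) = congr_op (\<lambda>i j. l $$ (i, j)) i j"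
proof -
  have 1: "(companion p c * l * transpose_mat (companion p c)) $$ (i, j)
      = (\<Sum>k<p. \<Sum>m<p. companion_fn c i k * l $$ (k, m) * companion_fn c j m)" for c
  proof -
    have cl: "companion p c * l \<in> carrier_mat p p" by (rule mult_carrier_mat[OF companion_carrier l])
    have ct: "transpose_mat (companion p c) \<in> carrier_mat p p" by simp
    have "(companion p c * l * transpose_mat (companion p c)) $$ (i, j)
        = (\<Sum>m<p. (companion p c * l) $$ (i, m) * transpose_mat (companion p c) $$ (m, j))"
      by (rule mult_mat_entry[OF cl ct ij])
    also have "\<dots> = (\<Sum>m<p. (\<Sum>k<p. companion_fn c i k * l $$ (k, m)) * companion_fn c j m)"
    proof (rule sum.cong[OF refl])
      fix m assume m: "m \<in> {..<p}"
      have "transpose_mat (companion p c) $$ (m, j) = companion_fn c j m"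
        using m ij companion_carrier[of p c] by (simp add: companion_entry)
      moreover have "(companion p c * l) $$ (i, m) = (\<Sum>k<p. companion_fn c i k * l $$ (k, m))"
        using mult_mat_entry[OF companion_carrier l ij(1), of m c] m ij by (simp add: companion_entry)
      ultimately show "(companion p c * l) $$ (i, m) * transpose_mat (companion p c) $$ (m, j)
          = (\<Sum>k<p. companion_fn c i k * l $$ (k, m)) * companion_fn c j m" by simp
    qed
    also have "\<dots> = (\<Sum>m<p. \<Sum>k<p. companion_fn c i k * l $$ (k, m) * companion_fn c j m)"
      by (simp add: sum_distrib_right)
    also have "\<dots> = (\<Sum>k<p. \<Sum>m<p. companion_fn c i k * l $$ (k, m) * companion_fn c j m)" by (rule sum.swap)
    finally show ?thesis .
  qed
  have half: "((1 / 2) \<cdot>\<^sub>m (P + Q)) $$ (i, j) = (P $$ (i, j) + Q $$ (i, j)) / 2"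
    if "P \<in> carrier_mat p p" "Q \<in> carrier_mat p p" for P Q :: "real mat"
    using that ij by simp
  have car: "companion p c * l * transpose_mat (companion p c) \<in> carrier_mat p p" for c
    by (rule carrier_matI) simp_all
  show ?thesis unfolding half[OF car car] 1 congr_op_def ..
qed

lemma T_carrier: "T_mat p a b \<sigma> \<in> carrier_mat p p"
  unfolding T_mat_def Let_def outer_prod_def
  using lambda_carrier by (intro carrier_matI) simp_all

lemma T_entry:
  assumes ij: "i < p" "j < p"
  defines "l \<equiv> vec_index (lambda_vec p a b)"
  shows "T_mat p a b \<sigma> $$ (i, j) = (if i = 0 \<and> j = 0 then \<sigma>\<^sup>2 + ((a 0)\<^sup>2 + (b 0)\<^sup>2) / 2 else 0)
      + (a 0 * ((if j = 0 then \<Sum>k<p. companion_fn a i k * l k else 0) + (if i = 0 then \<Sum>k<p. companion_fn a j k * l k else 0))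
       + b 0 * ((if j = 0 then \<Sum>k<p. companion_fn b i k * l k else 0) + (if i = 0 then \<Sum>k<p. companion_fn b j k * l k else 0))) / 2"
proof -
  let ?lam = "lambda_vec p a b" and ?e = "unit_vec p 0 :: real Matrix.vec"
  have dl: "dim_vec ?lam = p" using lambda_carrier by simp
  have e: "vec_index ?e k = (if k = 0 then 1 else 0)" if "k < p" for k using that by simp
  have o1: "outer_prod (companion p c *\<^sub>v ?lam) ?e $$ (i, j) = (if j = 0 then \<Sum>k<p. companion_fn c i k * l k else 0)" for c
  proof -
    have d: "dim_vec (companion p c *\<^sub>v ?lam) = p" using companion_carrier[of p c] by simp
    have "outer_prod (companion p c *\<^sub>v ?lam) ?e $$ (i, j) = vec_index (companion p c *\<^sub>v ?lam) i * vec_index ?e j"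
      unfolding outer_prod_def using ij d by (simp del: index_mult_mat_vec dim_mult_mat_vec)
    then show ?thesis unfolding companion_mult_vec[OF ij(1) dl] e[OF ij(2)] l_def by simp
  qed
  have o2: "(outer_prod ?e ?lam * transpose_mat (companion p c)) $$ (i, j) = (if i = 0 then \<Sum>k<p. companion_fn c j k * l k else 0)" for c
  proof -
    have oc: "outer_prod ?e ?lam \<in> carrier_mat p p" using dl by (simp add: outer_prod_def)
    have tc: "transpose_mat (companion p c) \<in> carrier_mat p p" by simp
    have "(outer_prod ?e ?lam * transpose_mat (companion p c)) $$ (i, j)
        = (\<Sum>k<p. outer_prod ?e ?lam $$ (i, k) * transpose_mat (companion p c) $$ (k, j))"
      by (rule mult_mat_entry[OF oc tc ij])
    also have "\<dots> = (\<Sum>k<p. (if i = 0 then companion_fn c j k * l k else 0))"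
      using ij dl companion_carrier[of p c] by (intro sum.cong refl) (auto simp: outer_prod_def companion_entry l_def)
    finally show ?thesis by simp
  qed
  have o3: "outer_prod ?e ?e $$ (i, j) = (if i = 0 \<and> j = 0 then 1 else 0)" using ij by (simp add: outer_prod_def)
  have idx: "(c \<cdot>\<^sub>m O1 + (1 / 2) \<cdot>\<^sub>m (a 0 \<cdot>\<^sub>m (P1 + P2) + b 0 \<cdot>\<^sub>m (Q1 + Q2))) $$ (i, j)
      = c * O1 $$ (i, j) + (a 0 * (P1 $$ (i, j) + P2 $$ (i, j)) + b 0 * (Q1 $$ (i, j) + Q2 $$ (i, j))) / 2"
    if "O1 \<in> carrier_mat p p" "P1 \<in> carrier_mat p p" "P2 \<in> carrier_mat p p" "Q1 \<in> carrier_mat p p" "Q2 \<in> carrier_mat p p"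
    for c O1 P1 P2 Q1 Q2
    using that ij by simp
  have car: "outer_prod ?e ?e \<in> carrier_mat p p" "outer_prod (companion p c *\<^sub>v ?lam) ?e \<in> carrier_mat p p"
    "outer_prod ?e ?lam * transpose_mat (companion p c) \<in> carrier_mat p p" for c
    using companion_carrier[of p c] dl by (auto simp: outer_prod_def)
  show ?thesis unfolding T_mat_def Let_def idx[OF car(1,2,3,2,3)] o1 o2 o3 by simp
qed

text \<open>The definite description is justified by existence from the Picard iteration and by
  uniqueness, the difference of two solutions being a fixed point of the linear part.\<close>

lemma ell_carrier: "ell_mat p a b \<sigma> \<in> carrier_mat p p"
  and ell_fixed: "i < p \<Longrightarrow> j < p \<Longrightarrow> ell_mat p a b \<sigma> $$ (i, j)
    = T_mat p a b \<sigma> $$ (i, j) + congr_op (\<lambda>i j. ell_mat p a b \<sigma> $$ (i, j)) i j"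
proof -
  define rhs where "rhs l = T_mat p a b \<sigma> + (1 / 2) \<cdot>\<^sub>m
              (companion p a * l * transpose_mat (companion p a)
               + companion p b * l * transpose_mat (companion p b))" for l
  have rc: "rhs l \<in> carrier_mat p p" if "l \<in> carrier_mat p p" for l
    unfolding rhs_def by (rule carrier_matI) simp_all
  have re: "rhs l $$ (i, j) = T_mat p a b \<sigma> $$ (i, j) + congr_op (\<lambda>i j. l $$ (i, j)) i j"
    if "l \<in> carrier_mat p p" "i < p" "j < p" for l i j
    unfolding congr_entry[OF that, symmetric] rhs_def
    using that T_carrier companion_carrier[of p a] companion_carrier[of p b] by simp
  obtain m where m: "\<And>i j. i < p \<Longrightarrow> j < p \<Longrightarrow> m i j = T_mat p a b \<sigma> $$ (i, j) + congr_op m i j"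
    using congr_op_affine_fixed_point[of "\<lambda>i j. T_mat p a b \<sigma> $$ (i, j)"] by blast
  let ?P = "\<lambda>l. l \<in> carrier_mat p p \<and> l = rhs l"
  have "\<exists>!l. ?P l"
  proof (rule ex1I)
    define l where "l = Matrix.mat p p (\<lambda>(i, j). m i j)"
    have lc: "l \<in> carrier_mat p p" by (simp add: l_def)
    have "congr_op (\<lambda>i j. l $$ (i, j)) = congr_op m" by (rule congr_op_cong) (simp add: l_def)
    then have "l = rhs l" using lc rc[OF lc] re[OF lc] m by (intro eq_matI) (auto simp: l_def)
    then show "?P l" using lc by blast
    fix l' assume l': "?P l'"
    have eq: "l' $$ (i, j) = T_mat p a b \<sigma> $$ (i, j) + congr_op (\<lambda>i j. l' $$ (i, j)) i j" if "i < p" "j < p" for i j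
      using re[OF conjunct1[OF l'] that] conjunct2[OF l'] by simp
    have "l' $$ (i, j) - m i j = 0" if ij: "i < p" "j < p" for i j
    proof (rule congr_op_fixed_0[OF _ ij])
      fix i j assume "i < p" "j < p"
      then show "l' $$ (i, j) - m i j = congr_op (\<lambda>i j. l' $$ (i, j) - m i j) i j"
        unfolding congr_op_diff using eq m by simp
    qed
    then show "l' = l" using l' by (intro eq_matI) (auto simp: l_def)
  qed
  then have P: "?P (ell_mat p a b \<sigma>)"
    unfolding ell_mat_def rhs_def by (rule theI')
  then show "ell_mat p a b \<sigma> \<in> carrier_mat p p" by blast
  assume ij: "i < p" "j < p"
  show "ell_mat p a b \<sigma> $$ (i, j)
    = T_mat p a b \<sigma> $$ (i, j) + congr_op (\<lambda>i j. ell_mat p a b \<sigma> $$ (i, j)) i j"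
    using re[OF conjunct1[OF P] ij] conjunct2[OF P] by simp
qed

lemma L_mat_entry:
  assumes "i \<le> p" "j \<le> p"
  shows "L_mat p a b \<sigma> $$ (i, j)
    = block_limit (vec_index (lambda_vec p a b)) (\<lambda>i j. ell_mat p a b \<sigma> $$ (i, j)) i j"
  using assms lambda_carrier ell_carrier[of \<sigma>]
  by (auto simp: L_mat_def block_limit_def mat_of_rows_index mat_of_cols_index split: nat.split)

lemma L_mat_carrier: "L_mat p a b \<sigma> \<in> carrier_mat (p + 1) (p + 1)"
  unfolding L_mat_def using ell_carrier[of \<sigma>] by (intro carrier_matI) simp_all

end

section \<open>Block forms and the normal equations\<close>

lemma sum_two_blocks: "(\<Sum>k<2 * d. f k) = (\<Sum>i<d. f i) + (\<Sum>i<d. f (d + i))" for f :: "nat \<Rightarrow> real"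
proof -
  have "(\<Sum>k<2 * d. f k) = (\<Sum>k<d. f k) + (\<Sum>k\<in>{d..<d + d}. f k)"
    by (subst sum.union_disjoint[symmetric]) (auto intro!: sum.cong)
  also have "(\<Sum>k\<in>{d..<d + d}. f k) = (\<Sum>i<d. f (d + i))"
    using sum.shift_bounds_nat_ivl[of f 0 d d] by (simp add: atLeast0LessThan add.commute)
  finally show ?thesis .
qed

text \<open>The Kronecker product with the 2 by 2 identity is block diagonal; position r d + i is
  coordinate i of the block for daughter type r, the order in which stacking arranges the
  columns.\<close>

lemma kronecker_form:
  assumes P: "P \<in> carrier_mat d d" and v: "v \<in> carrier_vec (2 * d)" and d: "0 < d"
  shows "scalar_prod v (kronecker_prod (1\<^sub>m 2) P *\<^sub>v v)
    = (\<Sum>r<2. \<Sum>i<d. \<Sum>j<d. vec_index v (r * d + i) * P $$ (i, j) * vec_index v (r * d + j))"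
proof -
  let ?K = "kronecker_prod (1\<^sub>m 2) P"
  have K: "?K \<in> carrier_mat (2 * d) (2 * d)" using P by (simp add: kronecker_prod_def)
  have ent: "?K $$ (r * d + i, q * d + j) = (if r = q then P $$ (i, j) else 0)"
    if "r < 2" "q < 2" "i < d" "j < d" for r q i j
  proof -
    have "r * d + i < 2 * d" "q * d + j < 2 * d"
      using that by (auto simp: less_2_cases_iff)
    then show ?thesis using that P by (simp add: kronecker_prod_def)
  qed
  have "scalar_prod v (?K *\<^sub>v v) = (\<Sum>k<2 * d. vec_index v k * (\<Sum>l<2 * d. ?K $$ (k, l) * vec_index v l))"
    unfolding scalar_prod_def using K v mult_mat_vec_entry[OF K, of _ v]
    by (auto simp: atLeast0LessThan intro!: sum.cong simp del: index_mult_mat_vec)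
  also have "\<dots> = (\<Sum>i<d. vec_index v i * (\<Sum>j<d. P $$ (i, j) * vec_index v j))
      + (\<Sum>i<d. vec_index v (d + i) * (\<Sum>j<d. P $$ (i, j) * vec_index v (d + j)))"
  proof -
    have "(\<Sum>l<2 * d. ?K $$ (i, l) * vec_index v l) = (\<Sum>j<d. P $$ (i, j) * vec_index v j)"
      "(\<Sum>l<2 * d. ?K $$ (d + i, l) * vec_index v l) = (\<Sum>j<d. P $$ (i, j) * vec_index v (d + j))" if i: "i < d" for i
      unfolding sum_two_blocks using ent[of 0 0 i] ent[of 0 1 i] ent[of 1 0 i] ent[of 1 1 i] i by simp_all
    then show ?thesis unfolding sum_two_blocks by simp
  qed
  also have "\<dots> = (\<Sum>r<2. \<Sum>i<d. \<Sum>j<d. vec_index v (r * d + i) * P $$ (i, j) * vec_index v (r * d + j))"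
    by (simp add: numeral_2_eq_2 sum_distrib_left mult.assoc)
  finally show ?thesis .
qed

lemma Y_vec_index: "i \<le> p \<Longrightarrow> vec_index (Y_vec p X k \<omega>) i = regressor (\<lambda>k. X k \<omega>) k i"
  by (cases i) (simp_all add: Y_vec_def state_vec_def)

lemma Y_vec_dim: "dim_vec (Y_vec p X k \<omega>) = p + 1"
  by (simp add: Y_vec_def state_vec_def)

lemma Z_vec_index: "r < 2 \<Longrightarrow> vec_index (Z_vec X k \<omega>) r = X (2 * k + r) \<omega>"
  by (auto simp: Z_vec_def vec_of_list_index less_2_cases_iff)

lemma Z_vec_dim: "dim_vec (Z_vec X k \<omega>) = 2"
  by (simp add: Z_vec_def)

lemma S_sum_entry:
  "i \<le> p \<Longrightarrow> j \<le> p \<Longrightarrow> S_sum p X n \<omega> $$ (i, j)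
    = (\<Sum>k\<in>tree_from n (p - 1). regressor (\<lambda>k. X k \<omega>) k i * regressor (\<lambda>k. X k \<omega>) k j)"
  by (auto simp: S_sum_def outer_prod_def Y_vec_index Y_vec_dim)

lemma YZ_sum_entry:
  "i \<le> p \<Longrightarrow> r < 2 \<Longrightarrow> YZ_sum p X n \<omega> $$ (i, r)
    = (\<Sum>k\<in>tree_from n (p - 1). regressor (\<lambda>k. X k \<omega>) k i * X (2 * k + r) \<omega>)"
  by (auto simp: YZ_sum_def outer_prod_def Y_vec_index Y_vec_dim Z_vec_index Z_vec_dim)

lemma vec_stack_entry:
  assumes Q: "Q \<in> carrier_mat d m" and "j < d" "r < m"
  shows "vec_index (vec_stack Q) (r * d + j) = Q $$ (j, r)"
proof -
  have "r * d + j < Suc r * d" using assms by simp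
  also have "\<dots> \<le> m * d" using assms by (intro mult_le_mono1) simp
  finally have "r * d + j < d * m" by (simp add: mult.commute)
  then show ?thesis using assms carrier_matD[OF Q] by (simp add: vec_stack_def)
qed

lemma theta_index: "r < 2 \<Longrightarrow> i \<le> p \<Longrightarrow> vec_index (theta p a b) (r * (p + 1) + i) = (if r = 0 then a i else b i)"
  by (auto simp: theta_def less_2_cases_iff)

lemma theta_carrier: "theta p a b \<in> carrier_vec (2 * (p + 1))"
  by (rule carrier_vecI) (simp add: theta_def)

lemma theta_hat_carrier:
  assumes "inv_mat (S_mat p X (n - 1) \<omega>) \<in> carrier_mat (p + 1) (p + 1)"
  shows "theta_hat p X n \<omega> \<in> carrier_vec (2 * (p + 1))"
  by (rule carrier_vecI) (use carrier_matD[OF assms] in \<open>simp add: theta_hat_def vec_stack_def YZ_sum_def\<close>)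

text \<open>A trivial kernel excludes the replacement of S by S + I. Then S times the estimator is
  the sum of Y Z^t, and inserting the recursion for the daughters cancels S times the parameter,
  leaving noise times regressor.\<close>

lemma normal_equations:
  assumes ker: "\<And>x i. (\<And>i. i < p + 1 \<Longrightarrow> (\<Sum>j<p + 1. S_sum p X (n - 1) \<omega> $$ (i, j) * x j) = 0) \<Longrightarrow> i < p + 1 \<Longrightarrow> x i = 0"
    and rec: "\<And>k r. k \<in> tree_from (n - 1) (p - 1) \<Longrightarrow> r < 2 \<Longrightarrow>
      X (2 * k + r) \<omega> = (\<Sum>j\<le>p. (if r = 0 then a j else b j) * regressor (\<lambda>k. X k \<omega>) k j) + e (2 * k + r)"
  shows "theta_hat p X n \<omega> \<in> carrier_vec (2 * (p + 1))"
    "\<And>i r. i < p + 1 \<Longrightarrow> r < 2 \<Longrightarrow>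
      (\<Sum>j<p + 1. S_sum p X (n - 1) \<omega> $$ (i, j) * vec_index (theta_hat p X n \<omega> - theta p a b) (r * (p + 1) + j))
      = (\<Sum>k\<in>tree_from (n - 1) (p - 1). e (2 * k + r) * regressor (\<lambda>k. X k \<omega>) k i)"
proof -
  let ?S = "S_sum p X (n - 1) \<omega>" and ?YZ = "YZ_sum p X (n - 1) \<omega>" and ?y = "regressor (\<lambda>k. X k \<omega>)"
  have S: "?S \<in> carrier_mat (p + 1) (p + 1)" by (simp add: S_sum_def)
  have YZ: "?YZ \<in> carrier_mat (p + 1) 2" by (simp add: YZ_sum_def)
  note inv = inv_mat_of_trivial_kernel[OF S]
  have "invertible_mat ?S" using inv(1) ker by blast
  then have Sm: "S_mat p X (n - 1) \<omega> = ?S" by (simp add: S_mat_def)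
  have iS: "inv_mat ?S \<in> carrier_mat (p + 1) (p + 1)" "?S * inv_mat ?S = 1\<^sub>m (p + 1)" using inv(2,3) ker by blast+
  show tc: "theta_hat p X n \<omega> \<in> carrier_vec (2 * (p + 1))"
    by (rule theta_hat_carrier) (use iS Sm in simp)
  let ?D = "inv_mat ?S * ?YZ"
  have D: "?D \<in> carrier_mat (p + 1) 2" using iS YZ by simp
  have SD: "?S * ?D = ?YZ"
  proof -
    have "?S * ?D = (?S * inv_mat ?S) * ?YZ" using S iS YZ by (intro assoc_mult_mat[symmetric]) auto
    then show ?thesis using iS YZ by simp
  qed
  fix i r assume i: "i < p + 1" and r: "r < (2::nat)"
  have idx: "r * (p + 1) + j < 2 * (p + 1)" if "j < p + 1" for j using r that by (auto simp: less_2_cases_iff)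
  have th: "vec_index (theta_hat p X n \<omega> - theta p a b) (r * (p + 1) + j) = ?D $$ (j, r) - (if r = 0 then a j else b j)"
    if j: "j < p + 1" for j
  proof -
    have "vec_index (theta_hat p X n \<omega>) (r * (p + 1) + j) = ?D $$ (j, r)"
      unfolding theta_hat_def Sm by (rule vec_stack_entry[OF D j r])
    then show ?thesis
      using idx[OF j] theta_carrier[of p a b] tc theta_index[OF r, of j p a b] j by (simp del: index_mult_mat(1))
  qed
  have "(\<Sum>j<p + 1. ?S $$ (i, j) * vec_index (theta_hat p X n \<omega> - theta p a b) (r * (p + 1) + j))
      = (\<Sum>j<p + 1. ?S $$ (i, j) * ?D $$ (j, r)) - (\<Sum>j<p + 1. ?S $$ (i, j) * (if r = 0 then a j else b j))"
    unfolding sum_subtractf[symmetric]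
  proof (rule sum.cong[OF refl])
    fix j assume "j \<in> {..<p + 1}"
    then have j: "j < p + 1" by simp
    show "?S $$ (i, j) * vec_index (theta_hat p X n \<omega> - theta p a b) (r * (p + 1) + j)
        = ?S $$ (i, j) * ?D $$ (j, r) - ?S $$ (i, j) * (if r = 0 then a j else b j)"
      unfolding th[OF j] by (rule right_diff_distrib)
  qed
  also have "(\<Sum>j<p + 1. ?S $$ (i, j) * ?D $$ (j, r)) = ?YZ $$ (i, r)"
    using mult_mat_entry[OF S D i r] SD by simp
  also have "\<dots> = (\<Sum>k\<in>tree_from (n - 1) (p - 1). ?y k i * X (2 * k + r) \<omega>)"
    using i r by (simp add: YZ_sum_entry)
  also have "\<dots> = (\<Sum>k\<in>tree_from (n - 1) (p - 1). (\<Sum>j\<le>p. ?y k i * ?y k j * (if r = 0 then a j else b j)) + e (2 * k + r) * ?y k i)"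
  proof (rule sum.cong[OF refl])
    fix k assume k: "k \<in> tree_from (n - 1) (p - 1)"
    show "?y k i * X (2 * k + r) \<omega> = (\<Sum>j\<le>p. ?y k i * ?y k j * (if r = 0 then a j else b j)) + e (2 * k + r) * ?y k i"
      unfolding rec[OF k r] by (simp only: distrib_left sum_distrib_left mult_ac)
  qed
  also have "\<dots> = (\<Sum>j<p + 1. ?S $$ (i, j) * (if r = 0 then a j else b j))
      + (\<Sum>k\<in>tree_from (n - 1) (p - 1). e (2 * k + r) * ?y k i)"
  proof -
    have "(\<Sum>k\<in>tree_from (n - 1) (p - 1). \<Sum>j\<le>p. ?y k i * ?y k j * (if r = 0 then a j else b j))
        = (\<Sum>j\<le>p. \<Sum>k\<in>tree_from (n - 1) (p - 1). ?y k i * ?y k j * (if r = 0 then a j else b j))" by (rule sum.swap)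
    also have "\<dots> = (\<Sum>j\<le>p. ?S $$ (i, j) * (if r = 0 then a j else b j))"
      using i by (intro sum.cong refl) (simp add: S_sum_entry sum_distrib_right)
    finally show ?thesis by (simp add: sum.distrib lessThan_Suc_atMost)
  qed
  finally show "(\<Sum>j<p + 1. ?S $$ (i, j) * vec_index (theta_hat p X n \<omega> - theta p a b) (r * (p + 1) + j))
      = (\<Sum>k\<in>tree_from (n - 1) (p - 1). e (2 * k + r) * ?y k i)" by simp
qed

section \<open>Regular paths\<close>

lemma tree_eq: "tree n = {1..<2 ^ (n + 1)}"
  by (auto simp: tree_iff)

lemma card_tree: "real (card (tree n)) = 2 ^ (n + 1) - 1"
  by (simp add: tree_eq of_nat_diff)

lemma sum_tree_from:
  "(\<Sum>k\<in>tree_from n q. f k) = (\<Sum>m<Suc n. if q \<le> m then \<Sum>k\<in>generation m. f k else 0)"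
  for f :: "nat \<Rightarrow> real"
proof (induction n)
  case 0
  have "(2::nat) \<le> 2 ^ q" if "0 < q" using that power_increasing[of 1 q "2::nat"] by simp
  then have "tree_from 0 q = (if q = 0 then generation 0 else {})"
    by (force simp: tree_from_def tree_iff generation_iff)
  then show ?case by simp
next
  case (Suc n)
  have ge: "(2::nat) ^ q > k" if "Suc n < q" "k < 2 ^ (Suc (Suc n))" for k
    using that power_increasing[of "Suc (Suc n)" q "2::nat"] by simp
  have le: "(2::nat) ^ q \<le> k" if "q \<le> Suc n" "2 ^ (Suc n) \<le> k" for k
    using that power_increasing[of q "Suc n" "2::nat"] by linarith
  have split: "tree_from (Suc n) q = tree_from n q \<union> (if q \<le> Suc n then generation (Suc n) else {})"
  proof (intro equalityI subsetI)
    fix k assume "k \<in> tree_from (Suc n) q"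
    then have k: "1 \<le> k" "k < 2 ^ (Suc (Suc n))" "2 ^ q \<le> k" by (auto simp: tree_from_def tree_iff)
    then have "q \<le> Suc n" using ge[of k] by (meson not_le)
    then show "k \<in> tree_from n q \<union> (if q \<le> Suc n then generation (Suc n) else {})"
      using k by (cases "k < 2 ^ Suc n") (auto simp: tree_from_def tree_iff generation_iff)
  next
    fix k assume k: "k \<in> tree_from n q \<union> (if q \<le> Suc n then generation (Suc n) else {})"
    show "k \<in> tree_from (Suc n) q"
    proof (cases "k \<in> tree_from n q")
      case True then show ?thesis by (auto simp: tree_from_def tree_iff)
    next
      case False
      then have q: "q \<le> Suc n" and g: "2 ^ Suc n \<le> k" "k < 2 ^ Suc (Suc n)"
        using k by (auto simp: generation_iff split: if_splits)
      have "(1::nat) \<le> 2 ^ q" by simp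
      then show ?thesis using le[OF q g(1)] g by (auto simp: tree_from_def tree_iff)
    qed
  qed
  have "finite (tree_from n q)" by (simp add: tree_from_def tree_eq)
  moreover have "tree_from n q \<inter> generation (Suc n) = {}" by (auto simp: tree_from_def tree_iff generation_iff)
  ultimately have "(\<Sum>k\<in>tree_from (Suc n) q. f k)
      = (\<Sum>k\<in>tree_from n q. f k) + (if q \<le> Suc n then \<Sum>k\<in>generation (Suc n). f k else 0)"
    unfolding split by (simp add: sum.union_disjoint)
  then show ?case using Suc by simp
qed

text \<open>Half of the normalized sum comes from the last term, so its deviation from c halves at
  each step up to a vanishing perturbation. This passes from averages over generations to sums over
  the whole tree.\<close>

lemma dyadic_sum_tendsto:
  fixes v :: "nat \<Rightarrow> real"
  assumes v: "v \<longlonglongrightarrow> c"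
  shows "(\<lambda>n. (\<Sum>m<n. 2 ^ m * v m) / 2 ^ n) \<longlonglongrightarrow> c"
proof -
  define z where "z n = (\<Sum>m<n. 2 ^ m * v m) / 2 ^ n - c" for n
  have rec: "z (Suc n) = z n / 2 + (v n - c) / 2" for n by (simp add: z_def field_simps)
  have "(\<lambda>n. \<bar>z n\<bar>) \<longlonglongrightarrow> 0"
  proof (rule perturbed_contraction_tendsto_0)
    show "\<bar>z (Suc n)\<bar> \<le> 1/2 * \<bar>z n\<bar> + \<bar>v n - c\<bar> / 2" if "n \<ge> 0" for n
      unfolding rec using abs_triangle_ineq[of "z n / 2" "(v n - c) / 2"] by simp
    have "(\<lambda>n. \<bar>v n - c\<bar> / 2) \<longlonglongrightarrow> \<bar>c - c\<bar> / 2" by (intro tendsto_intros v) auto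
    then show "(\<lambda>n. \<bar>v n - c\<bar> / 2) \<longlonglongrightarrow> 0" by simp
  qed auto
  then have "z \<longlonglongrightarrow> 0" by (simp add: tendsto_rabs_zero_iff)
  then show ?thesis unfolding z_def by (simp add: LIM_zero_iff)
qed

text \<open>Changing finitely many terms, the first index and the last index by one does not affect
  a limit of means.\<close>

lemma mean_from_eventually:
  fixes g g' :: "nat \<Rightarrow> real"
  assumes lim: "(\<lambda>n. (\<Sum>k<n. g' k) / real n) \<longlonglongrightarrow> c" and eq: "\<And>k. k \<ge> N \<Longrightarrow> g k = g' k"
  shows "(\<lambda>n. 1 / real n * (\<Sum>k = p..n. g k)) \<longlonglongrightarrow> c"
proof -
  define K where "K = max N p"
  define D where "D = (\<Sum>k = p..K. g k) - (\<Sum>k<Suc K. g' k)"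
  have sum: "(\<Sum>k = p..n. g k) = (\<Sum>k<Suc n. g' k) + D" if "n \<ge> K" for n
    using that
  proof (induction n rule: dec_induct)
    case base show ?case by (simp add: D_def)
  next
    case (step n)
    have "(\<Sum>k = p..Suc n. g k) = (\<Sum>k = p..n. g k) + g (Suc n)" using step by (simp add: K_def)
    then show ?case using step eq[of "Suc n"] by (simp add: K_def)
  qed
  have "(\<lambda>n. (1 + 1 / real n) * ((\<Sum>k<Suc n. g' k) / real (Suc n)) + D / real n) \<longlonglongrightarrow> (1 + 0) * c + 0"
    by (intro tendsto_add tendsto_mult tendsto_const lim_const_over_n LIMSEQ_Suc[OF lim])
  then have "(\<lambda>n. (1 + 1 / real n) * ((\<Sum>k<Suc n. g' k) / real (Suc n)) + D / real n) \<longlonglongrightarrow> c" by simp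
  moreover have "\<forall>\<^sub>F n in sequentially. (1 + 1 / real n) * ((\<Sum>k<Suc n. g' k) / real (Suc n)) + D / real n
      = 1 / real n * (\<Sum>k = p..n. g k)"
    using eventually_ge_at_top[of "max 1 K"]
  proof eventually_elim
    case (elim n)
    have "(1 + 1 / real n) * ((\<Sum>k<Suc n. g' k) / real (Suc n)) = (\<Sum>k<Suc n. g' k) / real n"
    proof -
      have "(1 + 1 / real n) * (T / real (Suc n)) = T / real n" for T :: real
      proof -
        have "1 + 1 / real n = real (Suc n) / real n" using elim by (simp add: field_simps)
        then show ?thesis by simp
      qed
      then show ?thesis .
    qed
    then show ?case using sum[of n] elim by (simp only: add_divide_distrib) (simp add: add_divide_distrib)
  qed
  ultimately show ?thesis by (rule Lim_transform_eventually)
qed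

text \<open>The tree up to generation k - 1 has 2^k - 1 cells and not 2^k; the relative defect 2^-k
  is invisible in the mean.\<close>

lemma mean_halving_weight:
  fixes q :: "nat \<Rightarrow> real"
  assumes lim: "(\<lambda>n. (\<Sum>k<n. q k) / real n) \<longlonglongrightarrow> c" and pos: "\<And>k. 0 \<le> q k"
  shows "(\<lambda>n. (\<Sum>k<n. (1 - 1 / 2 ^ k) * q k) / real n) \<longlonglongrightarrow> c"
proof -
  obtain C where C: "\<And>n. (\<Sum>k<n. q k) \<le> C * real n" using mean_bounded[OF lim] by blast
  have "(\<lambda>k. (1/2 :: real) ^ k) \<longlonglongrightarrow> 0" by (rule LIMSEQ_power_zero) simp
  then have h: "(\<lambda>k. 1 / 2 ^ k :: real) \<longlonglongrightarrow> 0" by (simp add: power_divide)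
  have "(\<lambda>n. (\<Sum>k<n. 1 / 2 ^ k * q k) / real n) \<longlonglongrightarrow> 0"
    by (rule mean_vanishing_weights[OF h pos C])
  from tendsto_diff[OF lim this] show ?thesis
    by (simp add: left_diff_distrib sum_subtractf diff_divide_distrib)
qed

text \<open>From 2^n - 1 \<ge> 2^(n-1) and n - 1 \<ge> n/2, the number n is at most 2 / ln 2 times
  the logarithm of the size of the tree.\<close>

lemma log_rate:
  assumes n: "n \<ge> 2"
  shows "real n / 2 ^ n \<le> 2 / ln 2 * (ln (2 ^ n - 1) / (2 ^ n - 1))"
proof -
  have two: "(2::real) ^ n = 2 * 2 ^ (n - 1)" using n by (cases n) auto
  have one: "(2::real) ^ (n - 1) \<ge> 1" by simp
  have "real n * ln 2 / 2 \<le> real (n - 1) * ln 2" using n by (simp add: of_nat_diff field_simps)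
  also have "\<dots> = ln (2 ^ (n - 1))" by (simp add: ln_realpow)
  also have "\<dots> \<le> ln (2 ^ n - 1)" by (subst ln_le_cancel_iff) (use two one in linarith)+
  finally have "real n \<le> 2 / ln 2 * ln (2 ^ n - 1)" by (simp add: field_simps)
  moreover have "0 < (2::real) ^ n - 1" using two one by linarith
  ultimately have "real n / 2 ^ n \<le> (2 / ln 2 * ln (2 ^ n - 1)) / (2 ^ n - 1)"
    by (intro frac_le) auto
  then show ?thesis by simp
qed

section \<open>From almost sure limits to the behaviour of the estimator\<close>

context bar_process begin

definition W :: "nat \<Rightarrow> nat \<Rightarrow> nat \<Rightarrow> 'a \<Rightarrow> real" where
  "W r n i \<omega> = (if p - 1 \<le> n then \<Sum>k\<in>generation n. e (2 * k + r) \<omega> * y k i \<omega> else 0)"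

definition U :: "nat \<Rightarrow> nat \<Rightarrow> nat \<Rightarrow> 'a \<Rightarrow> real" where
  "U r n i \<omega> = (\<Sum>m<n. W r m i \<omega>)"

definition V :: "nat \<Rightarrow> nat \<Rightarrow> nat \<Rightarrow> 'a \<Rightarrow> real" where
  "V n i j \<omega> = (if p - 1 \<le> n then avg n (\<lambda>k. y k i \<omega> * y k j \<omega>) else 0)"

text \<open>The interface between probability and analysis: a path with these four limits, for both
  daughter types and all coordinates, satisfies every conclusion.\<close>

definition regular_path :: "'a \<Rightarrow> bool" where
  "regular_path \<omega> \<longleftrightarrow> (\<forall>r<2. \<forall>i\<le>p. \<forall>j\<le>p.
     (\<lambda>n. W r n i \<omega> / 2 ^ n) \<longlonglongrightarrow> 0
   \<and> (\<lambda>n. avg n (\<lambda>k. (e (2 * k + r) \<omega>)\<^sup>2)) \<longlonglongrightarrow> s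
   \<and> (\<lambda>n. (\<Sum>k<n. W r k i \<omega> * W r k j \<omega> / 2 ^ k - s * V k i j \<omega>) / real n) \<longlonglongrightarrow> 0
   \<and> (\<lambda>n. (\<Sum>k<n. U r k i \<omega> * W r k j \<omega> / 2 ^ k) / real n) \<longlonglongrightarrow> 0)"

text \<open>The localized limits hold for all integer levels at once outside one null set. On a path
  whose moments stay below some level, the indicators of that level are 1 throughout and the
  localized sums are the original ones.\<close>

lemma AE_regular_path: "AE \<omega> in M. regular_path \<omega>"
proof -
  have *: "AE \<omega> in M. \<forall>K::nat. \<forall>r\<in>{..<2::nat}. \<forall>i\<in>{..p}. \<forall>j\<in>{..p}.
     (\<lambda>n. WG (real K) r n i \<omega> / 2 ^ n) \<longlonglongrightarrow> 0
   \<and> (\<lambda>n. if p - 1 \<le> n then (\<Sum>k\<in>generation n. ((e (2 * k + r) \<omega>)\<^sup>2 - s) * G (real K) n \<omega>) / 2 ^ n else 0) \<longlonglongrightarrow> 0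
   \<and> (\<lambda>n. (\<Sum>k<n. (WG (real K) r k i \<omega> * WG (real K) r k j \<omega> - s * VG (real K) k i j \<omega>) / 2 ^ k) / real n) \<longlonglongrightarrow> 0
   \<and> (\<lambda>n. (\<Sum>k<n. UG (real K) r k i \<omega> * WG (real K) r k j \<omega> / 2 ^ k) / real n) \<longlonglongrightarrow> 0"
    unfolding AE_all_countable
  proof (intro allI AE_finite_allI)
    fix K r i j :: nat assume *: "r \<in> {..<2}" "i \<in> {..p}" "j \<in> {..p}"
    then have r: "r < 2" and i: "i \<le> p" and j: "j \<le> p" by auto
    have K: "0 \<le> real K" by simp
    show "AE \<omega> in M. (\<lambda>n. WG (real K) r n i \<omega> / 2 ^ n) \<longlonglongrightarrow> 0
   \<and> (\<lambda>n. if p - 1 \<le> n then (\<Sum>k\<in>generation n. ((e (2 * k + r) \<omega>)\<^sup>2 - s) * G (real K) n \<omega>) / 2 ^ n else 0) \<longlonglongrightarrow> 0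
   \<and> (\<lambda>n. (\<Sum>k<n. (WG (real K) r k i \<omega> * WG (real K) r k j \<omega> - s * VG (real K) k i j \<omega>) / 2 ^ k) / real n) \<longlonglongrightarrow> 0
   \<and> (\<lambda>n. (\<Sum>k<n. UG (real K) r k i \<omega> * WG (real K) r k j \<omega> / 2 ^ k) / real n) \<longlonglongrightarrow> 0"
      using WG_law[OF K r i] square_noise_law[OF K r] product_noise_law[OF K r i j] cross_noise_law[OF K r i j]
      by eventually_elim blast
  qed auto
  show ?thesis using * G_eventually_one
  proof eventually_elim
    case (elim \<omega>)
    then obtain K :: nat where K: "\<And>n. G (real K) n \<omega> = 1" by blast
    have WG: "WG (real K) r n i \<omega> = W r n i \<omega>" for r n i by (simp add: WG_def W_def K)
    have UG: "UG (real K) r n i \<omega> = U r n i \<omega>" for r n i by (simp add: UG_def U_def WG)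
    have VG: "VG (real K) n i j \<omega> / 2 ^ n = V n i j \<omega>" for n i j by (simp add: VG_def V_def K avg_def)
    show ?case unfolding regular_path_def
    proof (intro allI impI)
      fix r i j :: nat assume r: "r < 2" and i: "i \<le> p" and j: "j \<le> p"
      have mem: "r \<in> {..<2}" "i \<in> {..p}" "j \<in> {..p}" using r i j by auto
      note f = bspec[OF bspec[OF bspec[OF spec[OF elim(1), of K] mem(1)] mem(2)] mem(3)]
      have all: "(\<lambda>n. W r n i \<omega> / 2 ^ n) \<longlonglongrightarrow> 0"
        "(\<lambda>n. if p - 1 \<le> n then (\<Sum>k\<in>generation n. ((e (2 * k + r) \<omega>)\<^sup>2 - s) * 1) / 2 ^ n else 0) \<longlonglongrightarrow> 0"
        "(\<lambda>n. (\<Sum>k<n. (W r k i \<omega> * W r k j \<omega> - s * VG (real K) k i j \<omega>) / 2 ^ k) / real n) \<longlonglongrightarrow> 0"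
        "(\<lambda>n. (\<Sum>k<n. U r k i \<omega> * W r k j \<omega> / 2 ^ k) / real n) \<longlonglongrightarrow> 0"
        using f unfolding WG UG K by blast+
      have sq: "(\<lambda>n. avg n (\<lambda>k. (e (2 * k + r) \<omega>)\<^sup>2) - s) \<longlonglongrightarrow> 0"
      proof (rule Lim_transform_eventually[OF all(2)])
        show "\<forall>\<^sub>F n in sequentially. (if p - 1 \<le> n then (\<Sum>k\<in>generation n. ((e (2 * k + r) \<omega>)\<^sup>2 - s) * 1) / 2 ^ n else 0)
            = avg n (\<lambda>k. (e (2 * k + r) \<omega>)\<^sup>2) - s"
          using eventually_ge_at_top[of "p - 1"]
          by eventually_elim (simp add: avg_def sum_subtractf diff_divide_distrib)
      qed
      have "(W r k i \<omega> * W r k j \<omega> - s * VG (real K) k i j \<omega>) / 2 ^ k = W r k i \<omega> * W r k j \<omega> / 2 ^ k - s * V k i j \<omega>" for k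
        unfolding VG[symmetric] by (simp add: diff_divide_distrib)
      then show "(\<lambda>n. W r n i \<omega> / 2 ^ n) \<longlonglongrightarrow> 0
         \<and> (\<lambda>n. avg n (\<lambda>k. (e (2 * k + r) \<omega>)\<^sup>2)) \<longlonglongrightarrow> s
         \<and> (\<lambda>n. (\<Sum>k<n. W r k i \<omega> * W r k j \<omega> / 2 ^ k - s * V k i j \<omega>) / real n) \<longlonglongrightarrow> 0
         \<and> (\<lambda>n. (\<Sum>k<n. U r k i \<omega> * W r k j \<omega> / 2 ^ k) / real n) \<longlonglongrightarrow> 0"
        using all sq by (simp add: LIM_zero_iff)
    qed
  qed
qed

lemma X_child:
  assumes k: "k \<ge> 2 ^ (p - 1)" and r: "r < 2"
  shows "X (2 * k + r) \<omega> = (\<Sum>j\<le>p. (if r = 0 then a j else b j) * y k j \<omega>) + e (2 * k + r) \<omega>"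
proof -
  have "(\<Sum>j\<le>p. c j * y k j \<omega>) = c 0 + (\<Sum>j = 1..p. c j * X (k div 2 ^ (j - 1)) \<omega>)" for c
    by (simp add: sum.atMost_shift sum.atLeast1_atMost_eq)
  then show ?thesis using r by (auto simp: e_def less_2_cases_iff)
qed

end

context bar_process begin

lemma regular_path_conclusion:
  assumes s: "s = \<sigma>\<^sup>2" and reg: "regular_path \<omega>"
  shows "(\<lambda>n. euclidean_norm (theta_hat p X n \<omega> - theta p a b)) \<longlonglongrightarrow> 0"
    and "(\<lambda>n. (euclidean_norm (theta_hat p X n \<omega> - theta p a b))\<^sup>2)
              \<in> O(\<lambda>n. ln (real (card (tree (n - 1)))) / real (card (tree (n - 1))))"
    and "(\<lambda>n. 1 / real n *
               (\<Sum>k = p..n. real (card (tree (k - 1))) *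
                  scalar_prod (theta_hat p X k \<omega> - theta p a b)
                    (Lambda_mat p a b \<sigma> *\<^sub>v (theta_hat p X k \<omega> - theta p a b))))
            \<longlonglongrightarrow> 2 * (real p + 1) * s"
proof -
  interpret cpp: companion_pair p N a b \<beta> by (rule companion_pair.intro[OF contr])
  define l where "l = vec_index (lambda_vec p a b)"
  define m where "m i j = ell_mat p a b \<sigma> $$ (i, j)" for i j
  have reg1: "(\<lambda>n. W r n i \<omega> / 2 ^ n) \<longlonglongrightarrow> 0" if "r < 2" "i \<le> p" for r i
    using reg that unfolding regular_path_def by blast
  have reg2: "(\<lambda>n. avg n (\<lambda>k. (e (2 * k + r) \<omega>)\<^sup>2)) \<longlonglongrightarrow> s" if "r < 2" for r
    using reg that unfolding regular_path_def by blast
  have reg3: "(\<lambda>n. (\<Sum>k<n. W r k i \<omega> * W r k j \<omega> / 2 ^ k - s * V k i j \<omega>) / real n) \<longlonglongrightarrow> 0"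
    if "r < 2" "i \<le> p" "j \<le> p" for r i j
    using reg that unfolding regular_path_def by blast
  have reg4: "(\<lambda>n. (\<Sum>k<n. U r k i \<omega> * W r k j \<omega> / 2 ^ k) / real n) \<longlonglongrightarrow> 0"
    if "r < 2" "i \<le> p" "j \<le> p" for r i j
    using reg that unfolding regular_path_def by blast
  interpret bp: bar_path p N a b \<beta> "\<lambda>k. X k \<omega>" "\<lambda>k. e k \<omega>" s l m
  proof (intro bar_path.intro recursion bar_path_axioms.intro)
    show "(\<lambda>n. avg n (\<lambda>k. e (2 * k + r) \<omega> * y k i \<omega>)) \<longlonglongrightarrow> 0" if "i \<le> p" "r < 2" for i r
    proof (rule Lim_transform_eventually[OF reg1[OF that(2,1)]])
      show "\<forall>\<^sub>F n in sequentially. W r n i \<omega> / 2 ^ n = avg n (\<lambda>k. e (2 * k + r) \<omega> * y k i \<omega>)"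
        using eventually_ge_at_top[of "p - 1"] by eventually_elim (simp add: W_def avg_def)
    qed
    show "l i = cpp.mean_op l i + (if i = 0 then (a 0 + b 0) / 2 else 0)" if "i < p" for i
      unfolding l_def by (rule cpp.lambda_fixed[OF that])
    show "m i j = cpp.congr_op m i j
      + (if i = 0 \<and> j = 0 then s + ((a 0)\<^sup>2 + (b 0)\<^sup>2) / 2 else 0)
      + (a 0 * ((if j = 0 then \<Sum>k<p. companion_fn a i k * l k else 0) + (if i = 0 then \<Sum>k<p. companion_fn a j k * l k else 0))
       + b 0 * ((if j = 0 then \<Sum>k<p. companion_fn b i k * l k else 0) + (if i = 0 then \<Sum>k<p. companion_fn b j k * l k else 0))) / 2"
      if "i < p" "j < p" for i j
      unfolding m_def cpp.ell_fixed[OF that, of \<sigma>] cpp.T_entry[OF that, of \<sigma>] s l_def by (simp only: add_ac)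
  qed (use s_pos reg2 in auto)
  have V_lim: "(\<lambda>n. V n i j \<omega>) \<longlonglongrightarrow> bp.L i j" if "i \<le> p" "j \<le> p" for i j
  proof (rule Lim_transform_eventually[OF bp.avg_product_tendsto[OF that]])
    show "\<forall>\<^sub>F n in sequentially. avg n (\<lambda>k. y k i \<omega> * y k j \<omega>) = V n i j \<omega>"
      using eventually_ge_at_top[of "p - 1"] by eventually_elim (simp add: V_def)
  qed
  define d where "d = p + 1"
  have lt_d: "i < d \<longleftrightarrow> i \<le> p" for i by (auto simp: d_def)
  have set_d: "{..<d} = {..p}" by (auto simp: d_def)
  let ?Lm = "L_mat p a b \<sigma>"
  have Lm_c: "?Lm \<in> carrier_mat d d" unfolding d_def by (rule cpp.L_mat_carrier)
  have Lm: "?Lm $$ (i, j) = bp.L i j" if "i < d" "j < d" for i j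
    unfolding bp.L_def unfolding l_def m_def[abs_def] using cpp.L_mat_entry[of i j \<sigma>] that lt_d by simp
  have ker: "z i = 0" if z: "\<And>i. i < d \<Longrightarrow> (\<Sum>j<d. ?Lm $$ (i, j) * z j) = 0" and i: "i < d" for z i
  proof -
    \<comment> \<open>A null vector of L makes the form vanish, and definiteness then makes it
      zero.\<close>
    have "bp.qf z = (\<Sum>i<d. z i * (\<Sum>j<d. ?Lm $$ (i, j) * z j))"
      unfolding bp.qf_def set_d[symmetric] sum_distrib_left by (intro sum.cong refl) (simp add: Lm mult.assoc)
    then have "bp.qf z = 0" using z by simp
    then show ?thesis using bp.qf_definite i lt_d by blast
  qed
  define K where "K i j = inv_mat ?Lm $$ (i, j)" for i j
  have iL: "inv_mat ?Lm \<in> carrier_mat d d" "?Lm * inv_mat ?Lm = 1\<^sub>m d" "inv_mat ?Lm * ?Lm = 1\<^sub>m d"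
    using inv_mat_of_trivial_kernel(2,3,4)[OF Lm_c] ker by blast+
  interpret ni: near_inverse d bp.L K
  proof
    fix i j assume ij: "i < d" "j < d"
    have "(inv_mat ?Lm * ?Lm) $$ (i, j) = (\<Sum>k<d. K i k * bp.L k j)"
      unfolding mult_mat_entry[OF iL(1) Lm_c ij] K_def using ij by (intro sum.cong refl) (simp add: Lm)
    then show "(\<Sum>k<d. K i k * bp.L k j) = (if i = j then 1 else 0)" unfolding iL(3) using ij by simp
    have "(?Lm * inv_mat ?Lm) $$ (i, j) = (\<Sum>k<d. bp.L i k * K k j)"
      unfolding mult_mat_entry[OF Lm_c iL(1) ij] K_def using ij by (intro sum.cong refl) (simp add: Lm)
    then show "(\<Sum>k<d. bp.L i k * K k j) = (if i = j then 1 else 0)" unfolding iL(2) using ij by simp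
  qed
  \<comment> \<open>The estimator at time n sums up to generation n - 1, so that about 2^n cells
    enter.\<close>
  define S where "S n i j = S_sum p X (n - 1) \<omega> $$ (i, j) / 2 ^ n" for n i j
  have S_lim: "(\<lambda>n. S n i j) \<longlonglongrightarrow> bp.L i j" if ij: "i < d" "j < d" for i j
  proof (rule Lim_transform_eventually[OF dyadic_sum_tendsto[OF V_lim[of i j]]])
    show "\<forall>\<^sub>F n in sequentially. (\<Sum>m<n. 2 ^ m * V m i j \<omega>) / 2 ^ n = S n i j"
      using eventually_ge_at_top[of 1]
    proof eventually_elim
      case (elim n)
      then have n: "Suc (n - 1) = n" by simp
      have "S_sum p X (n - 1) \<omega> $$ (i, j) = (\<Sum>k\<in>tree_from (n - 1) (p - 1). y k i \<omega> * y k j \<omega>)"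
        by (rule S_sum_entry) (use ij lt_d in blast)+
      also have "\<dots> = (\<Sum>m<n. if p - 1 \<le> m then \<Sum>k\<in>generation m. y k i \<omega> * y k j \<omega> else 0)"
        unfolding sum_tree_from n ..
      also have "\<dots> = (\<Sum>m<n. 2 ^ m * V m i j \<omega>)"
        by (intro sum.cong refl) (simp add: V_def avg_def)
      finally show ?case by (simp add: S_def)
    qed
  qed (use ij lt_d in auto)
  have U_sum: "(\<Sum>k\<in>tree_from (n - 1) (p - 1). e (2 * k + r) \<omega> * y k i \<omega>) = U r n i \<omega>" if "n \<ge> 1" for n r i
  proof -
    have n: "Suc (n - 1) = n" using that by simp
    show ?thesis unfolding sum_tree_from n U_def W_def ..
  qed
  have "\<forall>\<^sub>F n in sequentially. entry_sum d (ni.err (S n)) < 1/2"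
    by (rule order_tendstoD(2)[OF ni.err_tendsto[of S, OF S_lim]]) simp_all
  then obtain n1 where n1: "\<And>n. n \<ge> n1 \<Longrightarrow> entry_sum d (ni.err (S n)) \<le> 1/2"
    unfolding eventually_sequentially by (meson less_imp_le)
  \<comment> \<open>From here on the normalized S is close enough to L to be invertible, and n - 1
    is the true predecessor of n.\<close>
  define N0 where "N0 = max n1 (max p 1)"
  have N0: "n \<ge> n1" "n \<ge> p" "n \<ge> 1" if "n \<ge> N0" for n using that by (auto simp: N0_def)
  let ?v = "\<lambda>n. theta_hat p X n \<omega> - theta p a b"
  have S_ker: "z i = 0" if n: "n \<ge> N0" and z: "\<And>i. i < p + 1 \<Longrightarrow> (\<Sum>j<p + 1. S_sum p X (n - 1) \<omega> $$ (i, j) * z j) = 0"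
    and i: "i < p + 1" for n z i
  proof (rule ni.kernel_trivial)
    show "(\<Sum>j<d. S n i j * z j) = 0" if "i < d" for i
      using z[of i] that unfolding S_def d_def by (simp add: sum_divide_distrib[symmetric])
  qed (use n1 N0(1)[OF n] i in \<open>auto simp: d_def\<close>)
  have lower: "k \<ge> 2 ^ (p - 1)" if "k \<in> tree_from n (p - 1)" for k n using that by (simp add: tree_from_def)
  have normal: "theta_hat p X n \<omega> \<in> carrier_vec (2 * d)"
    "\<And>i r. i < d \<Longrightarrow> r < 2 \<Longrightarrow> (\<Sum>j<d. S_sum p X (n - 1) \<omega> $$ (i, j) * vec_index (?v n) (r * d + j)) = U r n i \<omega>"
    if n: "n \<ge> N0" for n
  proof -
    have rc: "X (2 * k + r) \<omega> = (\<Sum>j\<le>p. (if r = 0 then a j else b j) * y k j \<omega>) + e (2 * k + r) \<omega>"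
      if "k \<in> tree_from (n - 1) (p - 1)" "r < 2" for k r
      by (rule X_child[OF lower[OF that(1)] that(2)])
    show "theta_hat p X n \<omega> \<in> carrier_vec (2 * d)" unfolding d_def
    proof (rule normal_equations(1)[where e = "\<lambda>k. e k \<omega>" and a = a and b = b])
      show "z i = 0" if "\<And>i. i < p + 1 \<Longrightarrow> (\<Sum>j<p + 1. S_sum p X (n - 1) \<omega> $$ (i, j) * z j) = 0" "i < p + 1" for z i
        using S_ker[OF n] that by blast
    qed (rule rc)
    fix i r assume ir: "i < d" "r < (2::nat)"
    show "(\<Sum>j<d. S_sum p X (n - 1) \<omega> $$ (i, j) * vec_index (?v n) (r * d + j)) = U r n i \<omega>"
      unfolding d_def U_sum[OF N0(3)[OF n], symmetric]
    proof (rule normal_equations(2)[where e = "\<lambda>k. e k \<omega>" and a = a and b = b])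
      show "z i = 0" if "\<And>i. i < p + 1 \<Longrightarrow> (\<Sum>j<p + 1. S_sum p X (n - 1) \<omega> $$ (i, j) * z j) = 0" "i < p + 1" for z i
        using S_ker[OF n] that by blast
    qed (use rc ir in \<open>auto simp: d_def\<close>)
  qed
  \<comment> \<open>The error is scaled by the root of 2^n; dividing S by 2^n then leaves
    \<open>U\<close> divided by the same root on the right side.\<close>
  define w where "w r n i = sqrt (2 ^ n) * vec_index (?v n) (r * d + i)" for r n i
  define q where "q r n i = U r n i \<omega> / sqrt (2 ^ n)" for r n i
  have eqn: "(\<Sum>j<d. S n i j * w r n j) = q r n i" if "n \<ge> N0" "i < d" "r < 2" for n i r
  proof -
    have "(\<Sum>j<d. S n i j * w r n j) = (\<Sum>j<d. S_sum p X (n - 1) \<omega> $$ (i, j) * vec_index (?v n) (r * d + j)) * (sqrt (2 ^ n) / 2 ^ n)"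
      unfolding S_def w_def sum_distrib_right by (intro sum.cong refl) simp
    also have "\<dots> = U r n i \<omega> * (sqrt (2 ^ n) / 2 ^ n)" using normal(2)[OF that] by simp
    also have "sqrt (2 ^ n) / 2 ^ n = 1 / sqrt (2 ^ n)"
      using real_div_sqrt[of "2 ^ n"] by (simp add: field_simps)
    finally show ?thesis by (simp add: q_def)
  qed
  have mean: "(\<lambda>n. (\<Sum>k<n. q r k i * q r k j) / real n) \<longlonglongrightarrow> s * bp.L i j" if r: "r < 2" and "i < d" "j < d" for r i j
  proof -
    have i: "i \<le> p" and j: "j \<le> p" using that lt_d by auto
    \<comment> \<open>Expanding the product of (U + W)_i and (U + W)_j over 2^(k+1) leaves half the
      previous matrix plus \<open>J\<close>. Only the W W part contributes to the mean of
      \<open>J\<close>, namely s L / 2, and the halving recursion doubles it.\<close>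
    define J where "J k = (U r k i \<omega> * W r k j \<omega> / 2 ^ k + U r k j \<omega> * W r k i \<omega> / 2 ^ k + W r k i \<omega> * W r k j \<omega> / 2 ^ k) / 2" for k
    have "(\<lambda>n. (\<Sum>k<n. W r k i \<omega> * W r k j \<omega> / 2 ^ k - s * V k i j \<omega>) / real n + s * ((\<Sum>k<n. V k i j \<omega>) / real n))
        \<longlonglongrightarrow> 0 + s * bp.L i j"
      by (intro tendsto_add tendsto_mult tendsto_const reg3[OF r i j] mean_tendsto[OF V_lim[OF i j]])
    then have WW: "(\<lambda>n. (\<Sum>k<n. W r k i \<omega> * W r k j \<omega> / 2 ^ k) / real n) \<longlonglongrightarrow> s * bp.L i j"
      by (simp add: sum_subtractf diff_divide_distrib sum_distrib_left)
    have "(\<lambda>n. ((\<Sum>k<n. U r k i \<omega> * W r k j \<omega> / 2 ^ k) / real n + (\<Sum>k<n. U r k j \<omega> * W r k i \<omega> / 2 ^ k) / real n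
        + (\<Sum>k<n. W r k i \<omega> * W r k j \<omega> / 2 ^ k) / real n) / 2) \<longlonglongrightarrow> (0 + 0 + s * bp.L i j) / 2"
      by (intro tendsto_divide tendsto_add tendsto_const reg4[OF r i j] reg4[OF r j i] WW) simp
    moreover have "((\<Sum>k<n. U r k i \<omega> * W r k j \<omega> / 2 ^ k) / real n + (\<Sum>k<n. U r k j \<omega> * W r k i \<omega> / 2 ^ k) / real n
        + (\<Sum>k<n. W r k i \<omega> * W r k j \<omega> / 2 ^ k) / real n) / 2 = (\<Sum>k<n. J k) / real n" for n
    proof -
      have "(\<Sum>k<n. J k) = ((\<Sum>k<n. U r k i \<omega> * W r k j \<omega> / 2 ^ k) + (\<Sum>k<n. U r k j \<omega> * W r k i \<omega> / 2 ^ k)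
        + (\<Sum>k<n. W r k i \<omega> * W r k j \<omega> / 2 ^ k)) / 2"
        by (simp only: J_def sum_divide_distrib[symmetric] sum.distrib)
      then show ?thesis by (simp add: add_divide_distrib)
    qed
    ultimately have J: "(\<lambda>n. (\<Sum>k<n. J k) / real n) \<longlonglongrightarrow> s * bp.L i j / 2" by simp
    have "(\<lambda>n. (\<Sum>k<n. U r k i \<omega> * U r k j \<omega> / 2 ^ k) / real n) \<longlonglongrightarrow> 2 * (s * bp.L i j / 2)"
    proof (rule halving_recursion_mean[OF _ J])
      fix k
      have "U r (Suc k) i \<omega> = U r k i \<omega> + W r k i \<omega>" for i by (simp add: U_def)
      then show "U r (Suc k) i \<omega> * U r (Suc k) j \<omega> / 2 ^ Suc k = U r k i \<omega> * U r k j \<omega> / 2 ^ k / 2 + J k"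
        by (simp add: J_def field_simps)
    qed
    moreover have "q r k i * q r k j = U r k i \<omega> * U r k j \<omega> / 2 ^ k" for k by (simp add: q_def)
    ultimately show ?thesis by simp
  qed
  define Q where "Q r k = (\<Sum>i<d. \<Sum>j<d. w r k i * bp.L i j * w r k j)" for r k
  have sym: "bp.L i j = bp.L j i" if "i < d" "j < d" for i j using bp.L_sym that lt_d by blast
  have Q: "(\<lambda>n. (\<Sum>k<n. Q r k) / real n) \<longlonglongrightarrow> s * real d"
    and rate: "\<exists>C n2. \<forall>n\<ge>n2. (\<Sum>i<d. (w r n i)\<^sup>2) \<le> C * real n" if r: "r < 2" for r
    unfolding Q_def using ni.mean_form_tendsto[OF S_lim eqn[OF _ _ r] mean[OF r] sym] by blast+
  have Q0: "0 \<le> Q r k" for r k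
    using bp.qf_nonneg[of "w r k"] by (simp add: Q_def bp.qf_def set_d)
  have "(\<lambda>n. (\<Sum>k<n. Q 0 k) / real n + (\<Sum>k<n. Q 1 k) / real n) \<longlonglongrightarrow> s * real d + s * real d"
    by (intro tendsto_add Q) auto
  then have "(\<lambda>n. (\<Sum>k<n. Q 0 k + Q 1 k) / real n) \<longlonglongrightarrow> 2 * (real p + 1) * s"
    by (simp add: sum.distrib add_divide_distrib d_def algebra_simps)
  then have lim: "(\<lambda>n. (\<Sum>k<n. (1 - 1 / 2 ^ k) * (Q 0 k + Q 1 k)) / real n) \<longlonglongrightarrow> 2 * (real p + 1) * s"
    by (rule mean_halving_weight) (simp add: Q0)
  have card: "real (card (tree (n - 1))) = 2 ^ n - 1" if "n \<ge> 1" for n using that by (simp add: card_tree)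
  have v_c: "?v n \<in> carrier_vec (2 * d)" if "n \<ge> N0" for n
    using normal(1)[OF that] theta_carrier[of p a b] by (simp add: d_def)
  have w2: "w r n i * x * w r n j = 2 ^ n * (vec_index (?v n) (r * d + i) * x * vec_index (?v n) (r * d + j))" for r n i j x
    by (simp add: w_def)
  show "(\<lambda>n. 1 / real n *
               (\<Sum>k = p..n. real (card (tree (k - 1))) *
                  scalar_prod (?v k) (Lambda_mat p a b \<sigma> *\<^sub>v ?v k))) \<longlonglongrightarrow> 2 * (real p + 1) * s"
  proof (rule mean_from_eventually[OF lim])
    fix k assume k: "k \<ge> N0"
    have "scalar_prod (?v k) (Lambda_mat p a b \<sigma> *\<^sub>v ?v k)
        = (\<Sum>r<2. \<Sum>i<d. \<Sum>j<d. vec_index (?v k) (r * d + i) * ?Lm $$ (i, j) * vec_index (?v k) (r * d + j))"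
      unfolding Lambda_mat_def by (rule kronecker_form[OF Lm_c v_c[OF k]]) (simp add: d_def)
    also have "\<dots> = (\<Sum>r<2. \<Sum>i<d. \<Sum>j<d. vec_index (?v k) (r * d + i) * bp.L i j * vec_index (?v k) (r * d + j))"
      by (intro sum.cong refl) (simp add: Lm)
    finally have "2 ^ k * scalar_prod (?v k) (Lambda_mat p a b \<sigma> *\<^sub>v ?v k) = (\<Sum>r<2. Q r k)"
      unfolding Q_def w2 by (simp only: sum_distrib_left)
    then have "scalar_prod (?v k) (Lambda_mat p a b \<sigma> *\<^sub>v ?v k) = (Q 0 k + Q 1 k) / 2 ^ k"
      by (simp add: numeral_2_eq_2 field_simps)
    then show "real (card (tree (k - 1))) * scalar_prod (?v k) (Lambda_mat p a b \<sigma> *\<^sub>v ?v k) = (1 - 1 / 2 ^ k) * (Q 0 k + Q 1 k)"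
      unfolding card[OF N0(3)[OF k]] by (simp add: field_simps)
  qed
  obtain C0 m0 where C0: "\<And>n. n \<ge> m0 \<Longrightarrow> (\<Sum>i<d. (w 0 n i)\<^sup>2) \<le> C0 * real n" using rate[of 0] by auto
  obtain C1 m1 where C1: "\<And>n. n \<ge> m1 \<Longrightarrow> (\<Sum>i<d. (w 1 n i)\<^sup>2) \<le> C1 * real n" using rate[of 1] by auto
  define N1 where "N1 = max (max N0 2) (max m0 m1)"
  define C where "C = \<bar>C0 + C1\<bar>"
  have sq: "(euclidean_norm (?v n))\<^sup>2 \<le> C * (real n / 2 ^ n)" if n: "n \<ge> N1" for n
  proof -
    have n': "n \<ge> N0" "n \<ge> m0" "n \<ge> m1" using n by (auto simp: N1_def)
    have sp: "scalar_prod (?v n) (?v n) = (\<Sum>I<2 * d. (vec_index (?v n) I)\<^sup>2)"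
      unfolding scalar_prod_def carrier_vecD[OF v_c[OF n'(1)]] atLeast0LessThan power2_eq_square ..
    have "(euclidean_norm (?v n))\<^sup>2 = scalar_prod (?v n) (?v n)"
      unfolding euclidean_norm_def sp by (intro real_sqrt_pow2 sum_nonneg) simp
    also have "\<dots> = (\<Sum>i<d. (vec_index (?v n) i)\<^sup>2) + (\<Sum>i<d. (vec_index (?v n) (d + i))\<^sup>2)"
      unfolding sp by (rule sum_two_blocks)
    finally have "2 ^ n * (euclidean_norm (?v n))\<^sup>2 = (\<Sum>i<d. (w 0 n i)\<^sup>2) + (\<Sum>i<d. (w 1 n i)\<^sup>2)"
      by (simp add: w_def power_mult_distrib sum_distrib_left distrib_left)
    also have "\<dots> \<le> (C0 + C1) * real n" using C0[OF n'(2)] C1[OF n'(3)] by (simp add: distrib_right)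
    also have "\<dots> \<le> C * real n" unfolding C_def by (intro mult_right_mono) auto
    finally show ?thesis by (simp add: field_simps)
  qed
  have C: "0 \<le> C" by (simp add: C_def)
  show "(\<lambda>n. (euclidean_norm (?v n))\<^sup>2)
              \<in> O(\<lambda>n. ln (real (card (tree (n - 1)))) / real (card (tree (n - 1))))"
  proof (rule bigoI[where c = "C * (2 / ln 2)"])
    show "\<forall>\<^sub>F n in sequentially. norm ((euclidean_norm (?v n))\<^sup>2)
        \<le> C * (2 / ln 2) * norm (ln (real (card (tree (n - 1)))) / real (card (tree (n - 1))))"
      using eventually_ge_at_top[of N1]
    proof eventually_elim
      case (elim n)
      then have n: "n \<ge> 2" "n \<ge> 1" by (auto simp: N1_def)
      have "(euclidean_norm (?v n))\<^sup>2 \<le> C * (real n / 2 ^ n)" by (rule sq[OF elim])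
      also have "\<dots> \<le> C * (2 / ln 2 * (ln (2 ^ n - 1) / (2 ^ n - 1)))" by (intro mult_left_mono log_rate n C)
      also have "\<dots> \<le> C * (2 / ln 2 * \<bar>ln (2 ^ n - 1) / (2 ^ n - 1)\<bar>)"
        by (intro mult_left_mono C abs_ge_self) auto
      finally show ?case unfolding card[OF n(2)] by (simp add: mult.assoc)
    qed
  qed
  have "(\<lambda>n. C * (real n / 2 ^ n)) \<longlonglongrightarrow> C * 0"
    by (intro tendsto_mult tendsto_const lim_n_over_pown) simp
  then have lim0: "(\<lambda>n. C * (real n / 2 ^ n)) \<longlonglongrightarrow> 0" by simp
  have sq0: "(\<lambda>n. (euclidean_norm (?v n))\<^sup>2) \<longlonglongrightarrow> 0"
  proof (rule Lim_null_comparison[OF _ lim0])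
    show "\<forall>\<^sub>F n in sequentially. norm ((euclidean_norm (?v n))\<^sup>2) \<le> C * (real n / 2 ^ n)"
      using eventually_ge_at_top[of N1] by eventually_elim (use sq in simp)
  qed
  have "(\<lambda>n. sqrt ((euclidean_norm (?v n))\<^sup>2)) \<longlonglongrightarrow> sqrt 0" by (intro tendsto_real_sqrt sq0)
  then show "(\<lambda>n. euclidean_norm (?v n)) \<longlonglongrightarrow> 0" by (simp add: tendsto_rabs_zero_iff)
qed

end

section \<open>Both conclusions from the hypotheses on the process\<close>

theorem theorem5p2:
  fixes M :: "'a measure"
    and X eps :: "nat \<Rightarrow> 'a \<Rightarrow> real"
    and a b :: "nat \<Rightarrow> real"
    and p :: nat
    and N :: "real vec \<Rightarrow> real"
    and \<sigma> \<rho> :: real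
  assumes prob: "prob_space M"
    and p: "p \<ge> 1"
    and X_rv: "\<And>n. n \<ge> 1 \<Longrightarrow> X n \<in> borel_measurable M"
    and eps_rv: "\<And>n. n \<ge> 2 ^ p \<Longrightarrow> eps n \<in> borel_measurable M"
    and BAR_even: "\<And>n. n \<ge> 2 ^ (p - 1) \<Longrightarrow>
      AE \<omega> in M. X (2 * n) \<omega> =
        a 0 + (\<Sum>k = 1..p. a k * X (n div 2 ^ (k - 1)) \<omega>) + eps (2 * n) \<omega>"
    and BAR_odd: "\<And>n. n \<ge> 2 ^ (p - 1) \<Longrightarrow>
      AE \<omega> in M. X (2 * n + 1) \<omega> =
        b 0 + (\<Sum>k = 1..p. b k * X (n div 2 ^ (k - 1)) \<omega>) + eps (2 * n + 1) \<omega>"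
    and initial: "\<And>k. 1 \<le> k \<Longrightarrow> k \<le> 2 ^ p - 1 \<Longrightarrow> integrable M (\<lambda>\<omega>. X k \<omega> ^ 8)"
    and norm: "is_norm p N"
    and contraction:
      "max (operator_norm p N (companion p a)) (operator_norm p N (companion p b)) < 1"
    and sigma: "\<sigma>\<^sup>2 > 0"
    and rho: "\<bar>\<rho>\<bar> < \<sigma>\<^sup>2"
    and H1_L2: "\<And>n k. n \<ge> p - 1 \<Longrightarrow> k \<in> generation (n + 1) \<Longrightarrow>
      integrable M (\<lambda>\<omega>. (eps k \<omega>)\<^sup>2)"
    and H1_mean: "\<And>n k. n \<ge> p - 1 \<Longrightarrow> k \<in> generation (n + 1) \<Longrightarrow>
      AE \<omega> in M. real_cond_exp M (natural_filtration M X n) (eps k) \<omega> = 0"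
    and H1_var: "\<And>n k. n \<ge> p - 1 \<Longrightarrow> k \<in> generation (n + 1) \<Longrightarrow>
      AE \<omega> in M. real_cond_exp M (natural_filtration M X n) (\<lambda>\<omega>. (eps k \<omega>)\<^sup>2) \<omega> = \<sigma>\<^sup>2"
    and H2_sisters: "\<And>n k l. n \<ge> p - 1 \<Longrightarrow> k \<in> generation (n + 1) \<Longrightarrow>
      l \<in> generation (n + 1) \<Longrightarrow> k \<noteq> l \<Longrightarrow> k div 2 = l div 2 \<Longrightarrow>
      AE \<omega> in M. real_cond_exp M (natural_filtration M X n) (\<lambda>\<omega>. eps k \<omega> * eps l \<omega>) \<omega> = \<rho>"
    and H2_indep: "\<And>n. n \<ge> p - 1 \<Longrightarrow>
      cond_indep_vars M (natural_filtration M X n) borel (sister_noise eps) (generation n)"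
    and H3_L4: "\<And>n k. n \<ge> p - 1 \<Longrightarrow> k \<in> generation (n + 1) \<Longrightarrow>
      integrable M (\<lambda>\<omega>. eps k \<omega> ^ 4)"
    and H3_sup: "AE \<omega> in M.
      (SUP n \<in> {p - 1..}. SUP k \<in> generation (n + 1).
         ereal (real_cond_exp M (natural_filtration M X n) (\<lambda>\<omega>. eps k \<omega> ^ 4) \<omega>)) < \<infinity>"
  shows "(AE \<omega> in M.
            ((\<lambda>n. euclidean_norm (theta_hat p X n \<omega> - theta p a b)) \<longlonglongrightarrow> 0) \<and>
            (\<lambda>n. (euclidean_norm (theta_hat p X n \<omega> - theta p a b))\<^sup>2)
              \<in> O(\<lambda>n. ln (real (card (tree (n - 1)))) / real (card (tree (n - 1))))) \<and>
         (AE \<omega> in M.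
            (\<lambda>n. 1 / real n *
               (\<Sum>k = p..n. real (card (tree (k - 1))) *
                  scalar_prod (theta_hat p X k \<omega> - theta p a b)
                    (Lambda_mat p a b \<sigma> *\<^sub>v (theta_hat p X k \<omega> - theta p a b))))
            \<longlonglongrightarrow> 2 * (real p + 1) * \<sigma>\<^sup>2)"
proof -
  interpret vn: vec_norm p N using p norm by unfold_locales
  \<comment> \<open>The maximum with 1/2 keeps the contraction factor positive, since the argument
    with the dual ball divides by it.\<close>
  define \<beta> where "\<beta> = max (1/2) (max (operator_norm p N (companion p a)) (operator_norm p N (companion p b)))"
  have \<beta>: "0 < \<beta>" "\<beta> < 1" using contraction by (auto simp: \<beta>_def)
  have contr: "vn.nrm (\<lambda>i. \<Sum>j<p. companion_fn c i j * x j) \<le> \<beta> * vn.nrm x"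
    if "operator_norm p N (companion p c) \<le> \<beta>" for c x
  proof -
    have "vn.nrm (\<lambda>i. \<Sum>j<p. companion_fn c i j * x j) = vn.nrm (\<lambda>i. \<Sum>j<p. companion p c $$ (i, j) * x j)"
      by (intro vn.nrm_cong sum.cong refl) (simp add: companion_entry)
    also have "\<dots> \<le> operator_norm p N (companion p c) * vn.nrm x"
      by (rule vn.nrm_mult_le_operator_norm[OF companion_carrier])
    also have "\<dots> \<le> \<beta> * vn.nrm x" using that vn.nrm_nonneg by (rule mult_right_mono)
    finally show ?thesis .
  qed
  have cp: "contracting_pair p N (companion_fn a) (companion_fn b) \<beta>"
    using \<beta> contr by unfold_locales (auto simp: \<beta>_def)
  interpret bar_process M X eps a b p N \<beta> "\<sigma>\<^sup>2"
    by (intro bar_process.intro bar_process_axioms.intro prob cp X_rv eps_rv BAR_even BAR_odd initial sigma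
        H1_mean H1_var H2_indep H3_L4 H3_sup)
  note main = regular_path_conclusion[OF refl]
  show ?thesis
  proof (rule conjI)
    show "AE \<omega> in M.
            ((\<lambda>n. euclidean_norm (theta_hat p X n \<omega> - theta p a b)) \<longlonglongrightarrow> 0) \<and>
            (\<lambda>n. (euclidean_norm (theta_hat p X n \<omega> - theta p a b))\<^sup>2)
              \<in> O(\<lambda>n. ln (real (card (tree (n - 1)))) / real (card (tree (n - 1))))"
      using AE_regular_path by eventually_elim (intro conjI main(1,2))
    show "AE \<omega> in M.
            (\<lambda>n. 1 / real n *
               (\<Sum>k = p..n. real (card (tree (k - 1))) *
                  scalar_prod (theta_hat p X k \<omega> - theta p a b)
                    (Lambda_mat p a b \<sigma> *\<^sub>v (theta_hat p X k \<omega> - theta p a b))))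
            \<longlonglongrightarrow> 2 * (real p + 1) * \<sigma>\<^sup>2"
      using AE_regular_path by eventually_elim (rule main(3))
  qed
qed

end
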